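(* Let $k\ge1$, let $K=\{z_1,\dots,z_{2k}\}\subset\mathbb{C}$ be a set of $2k$ distinct points, $X=\mathbb{C}\setminus K$, $D(z)=\prod_{i=1}^{2k}(z-z_i)$, and let $G_D$ and $U_D$ be the $\mathbb{Z}_2$ harmonic function and the admissible entire function corresponding to the harmonic function $\ln|z|$ on $\mathbb{C}\setminus\{0\}$. Then: (1) Any $\mathbb{Z}_2$ harmonic function $f$ on $X$ such that $f=o(|z|)$ as $|z|\to+\infty$ is a scalar multiple of $G_D$ by a real constant. (2) The zero locus $Z(G_D)=\{z\in\mathbb{C}: G_D(z)=0\}$ is compact. Moreover, any $\mathbb{Z}_2$ harmonic function on $X$ whose zero locus is compact is a multiple of $G_D$ by a real constant. (3) Any admissible entire function $u(z)$ on $\mathbb{C}$ such that $u(z)=o(|z|^k)$ as $|z|\to+\infty$ is a scalar multiple of $U_D$ by a real constant.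
   Context: Identify $\mathbb{R}^2$ with $\mathbb{C}$. $\mathcal{L}$ denotes the unique real line bundle on $X$ with monodromy $-1$ around each point of $K$. A $\mathbb{Z}_2$ function is a section of $\mathcal{L}$; in a local trivialization it is an ordinary real function, well defined up to sign. A $\mathbb{Z}_2$ harmonic function is a $\mathbb{Z}_2$ function $f$ with $\Delta f=0$ in every local trivialization, and such that $|\nabla f|$ has finite $L^2$ norm on every bounded open subset of $X$ (including punctured neighborhoods of the points of $K$). For such $f$, $|f|$ extends continuously to $\mathbb{C}$ by setting $|f|=0$ on $K$, and the points of $K$ are counted as zeros of $f$. A trivialization of $\mathcal{L}$ outside a large disk containing $K$ is fixed, via which $\mathbb{Z}_2$ functions are ordinary functions near infinity. An entire function $u$ is admissible if $\mathrm{Re}\bigl(\int_{z_1}^{z_j}\frac{u(z)}{\sqrt{D(z)}}dz\bigr)=0$ for all $j=2,\dots,2k$ (independent of the choice of paths in $X$ and of sign of $\sqrt D$). A sign convention for $\sqrt{D}$ as a section of $\mathcal{L}\otimes\mathbb{C}$ is fixed. $G_D$ is the unique $\mathbb{Z}_2$ harmonic function on $X$ such that $G_D(z)-\ln|z|$ tends to a constant as $|z|\to+\infty$, and $U_D$ is the unique admissible entire function with $G_D(z)=\mathrm{Re}\bigl(\int_{z_1}^z\frac{U_D(\zeta)}{\sqrt{D(\zeta)}}d\zeta\bigr)$. *)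

theory Defs
  imports "HOL-Complex_Analysis.Complex_Analysis" "HOL-Library.Landau_Symbols"
begin

definition gradient :: "('a::euclidean_space \<Rightarrow> real) \<Rightarrow> 'a \<Rightarrow> 'a" where
  "gradient f x = (THE v. GDERIV f x :> v)"

definition laplacian :: "('a::euclidean_space \<Rightarrow> real) \<Rightarrow> 'a \<Rightarrow> real" where
  "laplacian f x = (\<Sum>b\<in>Basis. frechet_derivative (gradient f) (at x) b \<bullet> b)"

definition C2_on :: "('a::euclidean_space \<Rightarrow> real) \<Rightarrow> 'a set \<Rightarrow> bool" where
  "C2_on f V \<longleftrightarrow>
     (\<forall>x\<in>V. GDERIV f x :> gradient f x) \<and>
     (\<forall>x\<in>V. gradient f differentiable (at x)) \<and>
     (\<forall>h. continuous_on V (\<lambda>x. frechet_derivative (gradient f) (at x) h))"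

definition harmonic_on :: "('a::euclidean_space \<Rightarrow> real) \<Rightarrow> 'a set \<Rightarrow> bool" where
  "harmonic_on f V \<longleftrightarrow> C2_on f V \<and> (\<forall>x\<in>V. laplacian f x = 0)"

text \<open>
  Let \<open>K\<close> be a finite set of complex numbers and \<open>D\<close> its monic polynomial.  The curve
  \<open>w\<^sup>2 = D(x)\<close>, \<open>x \<notin> K\<close>, is the double cover of the complement of \<open>K\<close> with monodromy -1
  around each point of \<open>K\<close>.  The real line bundle \<open>L\<close> is the one associated to it by the sign
  representation, so a section of \<open>L\<close> is a function \<open>F x w\<close> on that curve which is odd in
  \<open>w\<close>; values of \<open>F\<close> off the curve are irrelevant.  A trivialization of \<open>L\<close> over an
  open set \<open>V\<close> is a continuous branch \<open>s\<close> of the square root of \<open>D\<close> on \<open>V\<close>, and in it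
  the section becomes the ordinary function \<open>\<lambda>x. F x (s x)\<close>.  The section \<open>sqrt D\<close> of
  the complexification of \<open>L\<close> is \<open>(x, w) \<mapsto> w\<close>, which fixes its sign.
\<close>

definition monic_poly :: "complex set \<Rightarrow> complex \<Rightarrow> complex" where
  "monic_poly K x = (\<Prod>p\<in>K. x - p)"

definition z2_function :: "complex set \<Rightarrow> (complex \<Rightarrow> complex \<Rightarrow> real) \<Rightarrow> bool" where
  "z2_function K F \<longleftrightarrow>
     (\<forall>x w. x \<notin> K \<longrightarrow> w\<^sup>2 = monic_poly K x \<longrightarrow> F x (- w) = - F x w)"

definition trivialization :: "complex set \<Rightarrow> complex set \<Rightarrow> (complex \<Rightarrow> complex) \<Rightarrow> bool" where
  "trivialization K V s \<longleftrightarrow>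
     open V \<and> V \<inter> K = {} \<and> continuous_on V s \<and> (\<forall>x\<in>V. (s x)\<^sup>2 = monic_poly K x)"

text \<open>
  A trivialization near a given point \<open>x \<notin> K\<close>: the quotient under the second root is close
  to 1 for \<open>y\<close> near \<open>x\<close>, away from the branch cut of the principal square root.  The norm
  of the gradient does not depend on the trivialization, so this one serves to define it.
\<close>

definition trivialization_at :: "complex set \<Rightarrow> complex \<Rightarrow> complex \<Rightarrow> complex" where
  "trivialization_at K x y =
     csqrt (monic_poly K x) * csqrt (monic_poly K y / monic_poly K x)"

definition z2_grad_norm :: "complex set \<Rightarrow> (complex \<Rightarrow> complex \<Rightarrow> real) \<Rightarrow> complex \<Rightarrow> real" where
  "z2_grad_norm K F x = norm (gradient (\<lambda>y. F y (trivialization_at K x y)) x)"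

definition z2_harmonic :: "complex set \<Rightarrow> (complex \<Rightarrow> complex \<Rightarrow> real) \<Rightarrow> bool" where
  "z2_harmonic K F \<longleftrightarrow>
     z2_function K F \<and>
     (\<forall>V s. trivialization K V s \<longrightarrow> harmonic_on (\<lambda>x. F x (s x)) V) \<and>
     (\<forall>B. open B \<longrightarrow> bounded B \<longrightarrow> B \<inter> K = {} \<longrightarrow>
        set_integrable lborel B (\<lambda>x. (z2_grad_norm K F x)\<^sup>2))"

definition z2_zeros :: "complex set \<Rightarrow> (complex \<Rightarrow> complex \<Rightarrow> real) \<Rightarrow> complex set" where
  "z2_zeros K F = K \<union> {x. \<forall>w. w\<^sup>2 = monic_poly K x \<longrightarrow> F x w = 0}"

definition z2_real_multiple ::
    "complex set \<Rightarrow> (complex \<Rightarrow> complex \<Rightarrow> real) \<Rightarrow> (complex \<Rightarrow> complex \<Rightarrow> real) \<Rightarrow> bool" where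
  "z2_real_multiple K F G \<longleftrightarrow>
     (\<exists>c::real. \<forall>x w. x \<notin> K \<longrightarrow> w\<^sup>2 = monic_poly K x \<longrightarrow> F x w = c * G x w)"

definition lifted_path ::
    "complex set \<Rightarrow> complex \<Rightarrow> complex \<Rightarrow> (real \<Rightarrow> complex) \<Rightarrow> (real \<Rightarrow> complex) \<Rightarrow> bool" where
  "lifted_path K p q g r \<longleftrightarrow>
     valid_path g \<and> pathstart g = p \<and> pathfinish g = q \<and> g ` {0<..<1} \<inter> K = {} \<and>
     continuous_on {0..1} r \<and> (\<forall>t\<in>{0..1}. (r t)\<^sup>2 = monic_poly K (g t))"

text \<open>
  Here \<open>r\<close> is the branch of the square root of \<open>D\<close> along \<open>g\<close>.  The integrand
  may be unbounded where \<open>g\<close> ends at a point of \<open>K\<close>; the gauge integral covers the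
  convergent improper integral which is meant there.
\<close>

definition lifted_integral ::
    "(complex \<Rightarrow> complex) \<Rightarrow> (real \<Rightarrow> complex) \<Rightarrow> (real \<Rightarrow> complex) \<Rightarrow> complex" where
  "lifted_integral u g r =
     integral {0..1} (\<lambda>t. u (g t) / r t * vector_derivative g (at t within {0..1}))"

definition admissible :: "complex set \<Rightarrow> complex \<Rightarrow> (complex \<Rightarrow> complex) \<Rightarrow> bool" where
  "admissible K p u \<longleftrightarrow>
     u holomorphic_on UNIV \<and>
     (\<forall>q\<in>K - {p}. \<forall>g r. lifted_path K p q g r \<longrightarrow> Re (lifted_integral u g r) = 0)"

text \<open>Here \<open>s\<close> is the chosen trivialization near infinity.\<close>

definition is_G :: "complex set \<Rightarrow> (complex \<Rightarrow> complex) \<Rightarrow> (complex \<Rightarrow> complex \<Rightarrow> real) \<Rightarrow> bool" where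
  "is_G K s G \<longleftrightarrow>
     z2_harmonic K G \<and>
     (\<exists>c. ((\<lambda>x. G x (s x) - ln (norm x)) \<longlongrightarrow> c) at_infinity)"

definition is_U ::
    "complex set \<Rightarrow> complex \<Rightarrow> (complex \<Rightarrow> complex \<Rightarrow> real) \<Rightarrow> (complex \<Rightarrow> complex) \<Rightarrow> bool" where
  "is_U K p G U \<longleftrightarrow>
     admissible K p U \<and>
     (\<forall>x g r. x \<notin> K \<longrightarrow> lifted_path K p x g r \<longrightarrow> G x (r 1) = Re (lifted_integral U g r))"

end

theory Submission
  imports Defs
begin

text \<open>
  The differential of a \<open>Z\<^sub>2\<close> harmonic function \<open>f\<close> is the real part of \<open>u / sqrt D dz\<close> with \<open>u\<close>
  holomorphic off \<open>K\<close>, and finite energy makes \<open>u\<close> entire. The absolute value of \<open>f\<close> is then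
  continuous on the plane, zero on \<open>K\<close>, and locally the absolute value of a harmonic function elsewhere. If
  \<open>u / sqrt D\<close> tends to \<open>0\<close> at infinity, its residue there is real since \<open>f\<close> is single valued, so a real
  multiple of \<open>G\<close> can be subtracted to remove the residue; the difference extends harmonically over
  infinity and vanishes by the maximum principle.

  The hypothesis on \<open>u / sqrt D\<close> holds in each case: sublinear growth gives it by a gradient estimate; a
  compact zero locus makes \<open>f\<close> of constant sign near infinity, hence of logarithmic growth by Harnack's
  inequality; and if \<open>u\<close> is admissible, integrating \<open>u / sqrt D\<close> along paths defines a suitable \<open>f\<close>.
\<close>

section \<open>Harmonic functions and the complex gradient\<close>

text \<open>The section \<open>f\<close> lives on the double cover; only |f| lives on the plane, so
  the maximum principle is run for |f|, and its zeros on \<open>K\<close> exclude nonzero constants.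
  Finite energy constrains \<open>u\<close> because the squared gradient norm is |u|^2 / |D| and
  \<open>D\<close> has a simple zero at each point p of \<open>K\<close>: integrability of |u|^2 /
  |z - p| over the plane near p is too strong for a pole of \<open>u\<close>. Uniqueness is proved
  for \<open>z2_potential\<close>, which remembers that \<open>u\<close> is entire and forgets the
  energy; hence it also covers the \<open>f\<close> built from path integrals, for which no energy
  bound is established. For that \<open>f\<close> no free additive constant remains: paths start at
  a branch point, and the same path with the opposite root changes the sign. \<open>G\<close> can
  absorb the residue of \<open>f\<close> because its own residue is nonzero: otherwise
  \<open>G\<close> would have a finite limit at infinity. Since \<open>D\<close> has degree 2k, its
  root grows like |z|^k, which makes o(|z|^k) the right bound on \<open>u\<close> in (3).\<close>

lemma second_difference_estimate:
  fixes f :: "'a::real_inner \<Rightarrow> real" and g :: "'a \<Rightarrow> 'a"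
  assumes V: "open V" "x \<in> V"
    and f: "\<And>y. y \<in> V \<Longrightarrow> GDERIV f y :> g y"
    and g: "(g has_derivative D) (at x)"
    and e: "e > 0"
  shows "\<exists>d>0. \<forall>t. 0 < t \<longrightarrow> t < d \<longrightarrow>
    \<bar>f (x + t *\<^sub>R a + t *\<^sub>R b) - f (x + t *\<^sub>R a) - f (x + t *\<^sub>R b) + f x - t\<^sup>2 * (D b \<bullet> a)\<bar> \<le> e * t\<^sup>2"
proof -
  interpret D: bounded_linear D using g by (rule has_derivative_bounded_linear)
  define m where "m = norm a + norm b + 1"
  have m: "m > 0" "norm a \<le> m" "norm b \<le> m" by (auto simp: m_def add_nonneg_pos)
  \<comment> \<open>Two error terms, each at most c t m, are paired with the vector a of norm at
    most m; the total 2 c t m^2 is e t.\<close>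
  define c where "c = e / (2 * m * m)"
  have c: "c > 0" using e m by (simp add: c_def)
  from g c obtain d1 where d1: "d1 > 0"
    "\<And>y. norm (y - x) < d1 \<Longrightarrow> norm (g y - g x - D (y - x)) \<le> c * norm (y - x)"
    unfolding has_derivative_at_alt by blast
  from V obtain d2 where d2: "d2 > 0" "ball x d2 \<subseteq> V" by (meson open_contains_ball)
  define d where "d = min d1 d2 / m"
  have d: "d > 0" using d1 d2 m by (simp add: d_def)
  show ?thesis
  proof (intro exI[of _ d] conjI d allI impI)
    fix t :: real assume t: "0 < t" "t < d"
    have tm: "t * m < d1" "t * m < d2" using t m by (auto simp: d_def field_simps)
    have small: "norm (r *\<^sub>R a + q *\<^sub>R b) \<le> t * m" if "0 \<le> r" "r \<le> t" "0 \<le> q" "q \<le> t" for r q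
    proof -
      have "norm (r *\<^sub>R a + q *\<^sub>R b) \<le> r * norm a + q * norm b"
        using norm_triangle_ineq[of "r *\<^sub>R a" "q *\<^sub>R b"] that by simp
      also have "\<dots> \<le> t * norm a + t * norm b" using that by (intro add_mono mult_right_mono) auto
      also have "\<dots> \<le> t * m" using t by (simp add: m_def algebra_simps)
      finally show ?thesis .
    qed
    have inV: "x + r *\<^sub>R a + q *\<^sub>R b \<in> V" if "0 \<le> r" "r \<le> t" "0 \<le> q" "q \<le> t" for r q
    proof -
      have "x + r *\<^sub>R a + q *\<^sub>R b \<in> ball x d2"
        using le_less_trans[OF small[OF that] tm(2)]
        by (simp add: dist_norm norm_minus_commute[of x] del: minus_add_distrib)
      then show ?thesis using d2 by auto
    qed
    \<comment> \<open>The second difference is p t - p 0. The mean value theorem turns it into a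
      difference of values of the gradient, to which the differentiability of \<open>g\<close> at
      the single point x applies.\<close>
    define p where "p = (\<lambda>r. f (x + r *\<^sub>R a + t *\<^sub>R b) - f (x + r *\<^sub>R a))"
    define p' where "p' = (\<lambda>r. (g (x + r *\<^sub>R a + t *\<^sub>R b) - g (x + r *\<^sub>R a)) \<bullet> a)"
    have der: "(p has_real_derivative p' r) (at r)" if r: "0 \<le> r" "r \<le> t" for r
    proof -
      have "(f has_derivative (\<lambda>v. v \<bullet> g (x + r *\<^sub>R a + t *\<^sub>R b))) (at (x + r *\<^sub>R a + t *\<^sub>R b))"
        using f[OF inV[of r t]] r t by (simp add: gderiv_def)
      then have 1: "((\<lambda>r. f (x + r *\<^sub>R a + t *\<^sub>R b)) has_derivative (\<lambda>v. (v *\<^sub>R a) \<bullet> g (x + r *\<^sub>R a + t *\<^sub>R b))) (at r)"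
        by (rule has_derivative_compose[rotated]) (auto intro!: derivative_eq_intros)
      have "(f has_derivative (\<lambda>v. v \<bullet> g (x + r *\<^sub>R a))) (at (x + r *\<^sub>R a))"
        using f[OF inV[of r 0]] r t by (simp add: gderiv_def)
      then have 2: "((\<lambda>r. f (x + r *\<^sub>R a)) has_derivative (\<lambda>v. (v *\<^sub>R a) \<bullet> g (x + r *\<^sub>R a))) (at r)"
        by (rule has_derivative_compose[rotated]) (auto intro!: derivative_eq_intros)
      show ?thesis unfolding p_def p'_def has_field_derivative_def
        by (rule has_derivative_eq_rhs[OF has_derivative_diff[OF 1 2]])
           (auto simp: inner_diff_left inner_diff_right inner_commute algebra_simps)
    qed
    obtain r where r: "0 < r" "r < t" and pr: "p t - p 0 = (t - 0) * p' r"
      using MVT2[of 0 t p p'] der t by auto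
    have e0: "norm (g (x + w) - g x - D w) \<le> c * (t * m)" if w: "norm w \<le> t * m" for w
      using order_trans[OF d1(2)[of "x + w"] mult_left_mono[of _ "t * m" c]] w tm c by simp
    have e1: "norm (g (x + r *\<^sub>R a + t *\<^sub>R b) - g x - D (r *\<^sub>R a + t *\<^sub>R b)) \<le> c * (t * m)"
      using e0[OF small[of r t]] r t by (simp add: add.assoc)
    have e2: "norm (g (x + r *\<^sub>R a) - g x - D (r *\<^sub>R a)) \<le> c * (t * m)"
      using e0[OF small[of r 0]] r t by simp
    have "p' r - t * (D b \<bullet> a)
       = ((g (x + r *\<^sub>R a + t *\<^sub>R b) - g x - D (r *\<^sub>R a + t *\<^sub>R b)) - (g (x + r *\<^sub>R a) - g x - D (r *\<^sub>R a))) \<bullet> a"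
      by (simp add: p'_def D.add D.scaleR inner_diff_left inner_add_left)
    also have "\<bar>\<dots>\<bar> \<le> (c * (t * m) + c * (t * m)) * norm a"
      by (rule order_trans[OF Cauchy_Schwarz_ineq2 mult_right_mono])
         (rule order_trans[OF norm_triangle_ineq4 add_mono[OF e1 e2]], rule norm_ge_zero)
    also have "\<dots> \<le> (c * (t * m) + c * (t * m)) * m" using m c t by (intro mult_left_mono) auto
    also have "\<dots> = e * t" using m by (simp add: c_def field_simps)
    finally have *: "\<bar>p' r - t * (D b \<bullet> a)\<bar> \<le> e * t" .
    have "f (x + t *\<^sub>R a + t *\<^sub>R b) - f (x + t *\<^sub>R a) - f (x + t *\<^sub>R b) + f x - t\<^sup>2 * (D b \<bullet> a)
       = t * (p' r - t * (D b \<bullet> a))"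
      using pr by (simp add: p_def algebra_simps power2_eq_square)
    also have "\<bar>\<dots>\<bar> \<le> t * (e * t)" using * t by (simp add: abs_mult)
    finally show "\<bar>f (x + t *\<^sub>R a + t *\<^sub>R b) - f (x + t *\<^sub>R a) - f (x + t *\<^sub>R b) + f x - t\<^sup>2 * (D b \<bullet> a)\<bar> \<le> e * t\<^sup>2"
      by (simp add: power2_eq_square mult.left_commute)
  qed
qed

text \<open>The second difference of \<open>f\<close> is symmetric in a and b, and after division by
  t^2 it approximates both sides. This symmetry of the Hessian will supply one of the two
  Cauchy-Riemann equations.\<close>

lemma gradient_derivative_symmetric:
  fixes f :: "'a::real_inner \<Rightarrow> real" and g :: "'a \<Rightarrow> 'a"
  assumes V: "open V" "x \<in> V"
    and f: "\<And>y. y \<in> V \<Longrightarrow> GDERIV f y :> g y"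
    and g: "(g has_derivative D) (at x)"
  shows "D a \<bullet> b = D b \<bullet> a"
proof -
  have "\<bar>D a \<bullet> b - D b \<bullet> a\<bar> \<le> e" if e: "e > 0" for e
  proof -
    have e2: "e/2 > 0" using e by simp
    from second_difference_estimate[OF assms e2, of a b] obtain d1 where d1: "d1 > 0"
      "\<And>t. 0 < t \<Longrightarrow> t < d1 \<Longrightarrow>
    \<bar>f (x + t *\<^sub>R a + t *\<^sub>R b) - f (x + t *\<^sub>R a) - f (x + t *\<^sub>R b) + f x - t\<^sup>2 * (D b \<bullet> a)\<bar> \<le> e/2 * t\<^sup>2"
      by blast
    from second_difference_estimate[OF assms e2, of b a] obtain d2 where d2: "d2 > 0"
      "\<And>t. 0 < t \<Longrightarrow> t < d2 \<Longrightarrow>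
    \<bar>f (x + t *\<^sub>R b + t *\<^sub>R a) - f (x + t *\<^sub>R b) - f (x + t *\<^sub>R a) + f x - t\<^sup>2 * (D a \<bullet> b)\<bar> \<le> e/2 * t\<^sup>2"
      by blast
    define t where "t = min d1 d2 / 2"
    have t: "0 < t" "t < d1" "t < d2" using d1 d2 by (auto simp: t_def)
    have swap: "x + t *\<^sub>R b + t *\<^sub>R a = x + t *\<^sub>R a + t *\<^sub>R b" by (simp add: ac_simps)
    have "\<bar>t\<^sup>2 * (D a \<bullet> b) - t\<^sup>2 * (D b \<bullet> a)\<bar> \<le> e * t\<^sup>2"
      using d1(2)[OF t(1,2)] d2(2)[OF t(1,3)] unfolding swap by argo
    then have "t\<^sup>2 * \<bar>D a \<bullet> b - D b \<bullet> a\<bar> \<le> t\<^sup>2 * e"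
      by (simp only: right_diff_distrib[symmetric] abs_mult mult.commute[of e]) simp
    then show ?thesis using t by simp
  qed
  then have "D a \<bullet> b - D b \<bullet> a = 0" by (rule dense_eq0_I)
  then show ?thesis by simp
qed

text \<open>The number \<open>a\<close> is \<open>f\<^sub>x - i f\<^sub>y\<close>, so that \<open>Re (a dz)\<close> is the differential of \<open>f\<close>.\<close>

definition has_cgrad :: "(complex \<Rightarrow> real) \<Rightarrow> complex \<Rightarrow> complex \<Rightarrow> bool" where
  "has_cgrad f a x \<longleftrightarrow> (f has_derivative (\<lambda>v. Re (a * v))) (at x)"

lemma inner_eq_Re_cnj: "v \<bullet> g = Re (cnj g * v)" for v g :: complex
  by (simp add: inner_complex_def)

lemma gderiv_iff_has_cgrad: "GDERIV f x :> g \<longleftrightarrow> has_cgrad f (cnj g) x"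
  by (simp add: gderiv_def has_cgrad_def inner_eq_Re_cnj)

lemma gderiv_unique:
  assumes "GDERIV f x :> a" "GDERIV f x :> b" shows "a = b"
proof -
  have "(\<lambda>h. h \<bullet> a) = (\<lambda>h. h \<bullet> b)"
    using assms unfolding gderiv_def by (rule has_derivative_unique)
  then have "(a - b) \<bullet> a = (a - b) \<bullet> b" by meson
  then show ?thesis by (metis eq_iff_diff_eq_0 inner_diff_right inner_eq_zero_iff)
qed

lemma gradient_eqI: "GDERIV f x :> a \<Longrightarrow> gradient f x = a"
  unfolding gradient_def by (rule the_equality) (auto intro: gderiv_unique)

lemma has_cgrad_unique: "has_cgrad f a x \<Longrightarrow> has_cgrad f b x \<Longrightarrow> a = b"
  using gderiv_unique[of f x "cnj a" "cnj b"] by (simp add: gderiv_iff_has_cgrad)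

lemma gradient_eq_cnj: "has_cgrad f a x \<Longrightarrow> gradient f x = cnj a"
  by (rule gradient_eqI) (simp add: gderiv_iff_has_cgrad)

lemma harmonic_on_has_cgrad:
  assumes "harmonic_on f V" "x \<in> V" shows "has_cgrad f (cnj (gradient f x)) x"
  using assms by (auto simp: harmonic_on_def C2_on_def gderiv_iff_has_cgrad)

text \<open>For f_x - i f_y the two Cauchy-Riemann equations are the symmetry of the Hessian and the
  vanishing of its trace.\<close>

lemma harmonic_on_cnj_gradient_holomorphic:
  assumes f: "harmonic_on f V" and V: "open V"
  shows "(\<lambda>x. cnj (gradient f x)) holomorphic_on V"
  unfolding holomorphic_on_open[OF V]
proof
  fix x assume x: "x \<in> V"
  define D where "D = frechet_derivative (gradient f) (at x)"
  have g: "(gradient f has_derivative D) (at x)"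
    using f x by (auto simp: D_def harmonic_on_def C2_on_def frechet_derivative_works)
  interpret D: bounded_linear D using g by (rule has_derivative_bounded_linear)
  have sym: "D 1 \<bullet> \<i> = D \<i> \<bullet> 1"
    using gradient_derivative_symmetric[OF V x _ g, of f 1 \<i>] f by (auto simp: harmonic_on_def C2_on_def)
  have lap: "D 1 \<bullet> 1 + D \<i> \<bullet> \<i> = 0"
    using f x by (auto simp: harmonic_on_def laplacian_def D_def Basis_complex_def)
  then have Im_Di: "Im (D \<i>) = - Re (D 1)" by (simp add: inner_complex_def)
  have *: "cnj (D v) = cnj (D 1) * v" for v
  proof -
    have "Re v *\<^sub>R 1 + Im v *\<^sub>R \<i> = v" by (simp add: complex_eq_iff)
    then have "D v = Re v *\<^sub>R D 1 + Im v *\<^sub>R D \<i>"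
      using D.add[of "Re v *\<^sub>R 1" "Im v *\<^sub>R \<i>"] by (simp add: D.scaleR)
    then show ?thesis using sym Im_Di by (simp add: complex_eq_iff inner_complex_def algebra_simps)
  qed
  have "((\<lambda>x. cnj (gradient f x)) has_field_derivative cnj (D 1)) (at x)"
    unfolding has_field_derivative_def
    by (rule has_derivative_eq_rhs[OF bounded_linear.has_derivative[OF bounded_linear_cnj g]])
       (rule ext, rule *)
  then show "\<exists>f'. ((\<lambda>x. cnj (gradient f x)) has_field_derivative f') (at x)" by blast
qed

lemma has_cgrad_Re:
  assumes "(P has_field_derivative k) (at x)" shows "has_cgrad (\<lambda>y. Re (P y)) k x"
  using assms unfolding has_cgrad_def has_field_derivative_def
  by (rule has_derivative_compose[OF _ bounded_linear_imp_has_derivative[OF bounded_linear_Re]])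

lemma has_cgrad_diff: "has_cgrad f a x \<Longrightarrow> has_cgrad g b x \<Longrightarrow> has_cgrad (\<lambda>y. f y - g y) (a - b) x"
  unfolding has_cgrad_def by (drule (1) has_derivative_diff) (simp add: algebra_simps)

lemma has_cgrad_cmult: "has_cgrad f a x \<Longrightarrow> has_cgrad (\<lambda>y. c * f y) (of_real c * a) x"
  unfolding has_cgrad_def
  by (drule has_derivative_mult_right[of _ _ _ c]) (simp add: mult.assoc Re_complex_of_real algebra_simps)

lemma has_cgrad_cong:
  assumes "has_cgrad f a x" "open S" "x \<in> S" "\<And>y. y \<in> S \<Longrightarrow> f y = g y"
  shows "has_cgrad g a x"
  using assms unfolding has_cgrad_def by (rule has_derivative_transform_within_open)

lemma has_cgrad_compose:
  assumes "has_cgrad f a (g x)" "(g has_field_derivative b) (at x)"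
  shows "has_cgrad (\<lambda>y. f (g y)) (a * b) x"
  using has_derivative_compose[OF assms(2)[unfolded has_field_derivative_def] assms(1)[unfolded has_cgrad_def]]
  unfolding has_cgrad_def by (simp only: mult.assoc)

lemma has_cgrad_continuous: "has_cgrad f a x \<Longrightarrow> continuous (at x) f"
  unfolding has_cgrad_def by (rule has_derivative_continuous)

text \<open>A holomorphic function on a convex set has a primitive, and on the connected set
  \<open>T\<close> its real part differs from f by a constant. \<open>S\<close> and \<open>T\<close>
  are kept apart for isolated singularities: with \<open>T\<close> a punctured disc, the primitive
  continues f across the puncture.\<close>

lemma cgrad_convex_primitive:
  assumes S: "open S" "convex S" and k: "k holomorphic_on S"
    and T: "open T" "connected T" "T \<subseteq> S"
    and f: "\<And>x. x \<in> T \<Longrightarrow> has_cgrad f (k x) x"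
  obtains P where "P holomorphic_on S" "\<forall>x\<in>S. (P has_field_derivative k x) (at x)"
    "\<forall>x\<in>T. f x = Re (P x)"
proof -
  from holomorphic_convex_primitive'[OF S(2,1) k] obtain Q
    where Q: "\<And>x. x \<in> S \<Longrightarrow> (Q has_field_derivative k x) (at x within S)" by blast
  then have Q': "(Q has_field_derivative k x) (at x)" if "x \<in> S" for x
    using that S at_within_open by metis
  obtain c where c: "f x - Re (Q x) = c" if "x \<in> T" for x
  proof (cases "T = {}")
    case False
    then obtain a where a: "a \<in> T" by blast
    have "f x - Re (Q x) = f a - Re (Q a)" if "x \<in> T" for x
    proof (rule has_derivative_zero_unique_connected[OF T(1,2) _ that a])
      fix y assume "y \<in> T"
      then show "((\<lambda>x. f x - Re (Q x)) has_derivative (\<lambda>h. 0)) (at y)"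
        using has_cgrad_diff[OF f has_cgrad_Re[OF Q']] T(3) by (auto simp: has_cgrad_def)
    qed
    then show ?thesis using that by blast
  qed (use that in auto)
  show ?thesis
  proof (rule that[of "\<lambda>x. Q x + of_real c"])
    show *: "\<forall>x\<in>S. ((\<lambda>x. Q x + of_real c) has_field_derivative k x) (at x)"
      using Q' by (auto intro!: derivative_eq_intros)
    then show "(\<lambda>x. Q x + of_real c) holomorphic_on S"
      using S holomorphic_on_open by blast
    show "\<forall>x\<in>T. f x = Re (Q x + of_real c)" using c by fastforce
  qed
qed

section \<open>Maximum principle and Harnack's inequality for real parts of holomorphic
  functions\<close>

lemma Re_maximum_constant:
  assumes P: "P holomorphic_on ball a r" and b: "b \<in> ball a r" and y: "y \<in> ball a r"
    and le: "\<And>y. y \<in> ball a r \<Longrightarrow> Re (P y) \<le> Re (P b)"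
  shows "Re (P y) = Re (P b)"
proof -
  \<comment> \<open>The modulus of exp (P y) is exp (Re (P y)), so a maximum of the real part is a
    maximum of a modulus.\<close>
  have "(\<lambda>y. exp (P y)) constant_on ball a r"
    by (rule maximum_modulus_principle[of _ _ "ball a r" b])
       (use P b le in \<open>auto intro!: holomorphic_intros\<close>)
  then have "exp (P y) = exp (P b)" using b y unfolding constant_on_def by metis
  then have "norm (exp (P y)) = norm (exp (P b))" by simp
  then show ?thesis by simp
qed

lemma abs_Re_maximum_constant:
  assumes P: "P holomorphic_on ball a r" and b: "b \<in> ball a r" and y: "y \<in> ball a r"
    and le: "\<And>y. y \<in> ball a r \<Longrightarrow> \<bar>Re (P y)\<bar> \<le> \<bar>Re (P b)\<bar>"
  shows "\<bar>Re (P y)\<bar> = \<bar>Re (P b)\<bar>"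
proof (cases "Re (P b) \<ge> 0")
  case True
  then have "Re (P y) = Re (P b)"
    using Re_maximum_constant[OF P b y] le by (simp add: abs_le_iff)
  then show ?thesis by simp
next
  case False
  have "Re (- P y) = Re (- P b)"
    by (rule Re_maximum_constant[OF holomorphic_on_minus[OF P] b y])
       (use le False in \<open>force simp: abs_if split: if_splits\<close>)
  then show ?thesis by simp
qed

text \<open>Both estimates are the Schwarz lemma for the Cayley transform of \<open>P\<close>.\<close>

lemma Harnack_Schwarz:
  assumes P: "P holomorphic_on ball c r" and r: "r > 0"
    and pos: "\<And>y. y \<in> ball c r \<Longrightarrow> Re (P y) > 0"
  shows "\<And>D. (P has_field_derivative D) (at c) \<Longrightarrow> norm D \<le> 2 * Re (P c) / r"
    and "\<And>y. y \<in> ball c r \<Longrightarrow> Re (P c) * (r - dist c y) \<le> Re (P y) * (r + dist c y)"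
proof -
  define A where "A = Re (P c)"
  have A: "A > 0" using pos[of c] r by (simp add: A_def)
  \<comment> \<open>Rescaling to the unit disc and removing the imaginary part at the centre make Q
    0 equal to the real number A, so that the Cayley transform M fixes 0.\<close>
  define Q where "Q = (\<lambda>t. P (c + of_real r * t) - \<i> * of_real (Im (P c)))"
  define M where "M = (\<lambda>t. (Q t - of_real A) / (Q t + of_real A))"
  have inb: "c + of_real r * t \<in> ball c r" if "norm t < 1" for t
    using that r by (simp add: dist_norm norm_mult)
  have Qpos: "Re (Q t) > 0" if "norm t < 1" for t
    using pos[OF inb[OF that]] by (simp add: Q_def)
  have Qne: "Q t + of_real A \<noteq> 0" if "norm t < 1" for t
    using Qpos[OF that] A by (auto simp: complex_eq_iff)
  have Q0: "Q 0 = of_real A" by (simp add: Q_def A_def complex_eq_iff)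
  have "(P \<circ> (\<lambda>t. c + of_real r * t)) holomorphic_on ball 0 1"
    by (rule holomorphic_on_compose_gen[OF _ P])
       (use inb in \<open>auto intro!: holomorphic_intros\<close>)
  then have holQ: "Q holomorphic_on ball 0 1"
    unfolding Q_def o_def by (intro holomorphic_intros)
  have holM: "M holomorphic_on ball 0 1"
    unfolding M_def by (intro holomorphic_intros holQ) (use Qne in auto)
  have M0: "M 0 = 0" by (simp add: M_def Q0)
  have Mlt: "norm (M t) < 1" if "norm t < 1" for t
  proof -
    have "(norm (Q t - of_real A))\<^sup>2 < (norm (Q t + of_real A))\<^sup>2"
      using Qpos[OF that] A unfolding cmod_power2 by (simp add: power2_eq_square algebra_simps)
    then have "norm (Q t - of_real A) < norm (Q t + of_real A)"
      by (rule power_less_imp_less_base) simp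
    then show ?thesis using Qne[OF that] by (simp add: M_def norm_divide)
  qed
  show "norm D \<le> 2 * Re (P c) / r" if D: "(P has_field_derivative D) (at c)" for D
  proof -
    have "(Q has_field_derivative (D * of_real r)) (at 0)"
    proof -
      have "((\<lambda>t. c + of_real r * t) has_field_derivative of_real r) (at 0)"
        by (auto intro!: derivative_eq_intros)
      from DERIV_chain2[of P D "\<lambda>t. c + of_real r * t", OF _ this] D
      have "((\<lambda>t. P (c + of_real r * t)) has_field_derivative (D * of_real r)) (at 0)" by simp
      from DERIV_diff[OF this DERIV_const] show ?thesis unfolding Q_def by simp
    qed
    then have "(M has_field_derivative (D * of_real r / (2 * of_real A))) (at 0)"
      unfolding M_def
      by (auto intro!: derivative_eq_intros simp: Q0) (use A in \<open>auto simp: field_simps\<close>)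
    then have "deriv M 0 = D * of_real r / (2 * of_real A)" by (rule DERIV_imp_deriv)
    moreover have "norm (deriv M 0) \<le> 1"
      by (rule Schwarz_Lemma(2)[OF holM M0 Mlt, of 0]) auto
    ultimately show ?thesis using A r by (simp add: norm_mult norm_divide field_simps A_def)
  qed
  show "Re (P c) * (r - dist c y) \<le> Re (P y) * (r + dist c y)" if y: "y \<in> ball c r" for y
  proof -
    define t where "t = (y - c) / of_real r"
    have yt: "y = c + of_real r * t" using r by (simp add: t_def)
    have nt: "norm t = dist c y / r" using r by (simp add: t_def norm_divide dist_norm norm_minus_commute)
    have t1: "norm t < 1" using y r by (simp add: nt)
    define m where "m = norm (M t)"
    have m: "m \<le> norm t" "m < 1" "m \<ge> 0"
      using Schwarz_Lemma(1)[OF holM M0 Mlt t1] Mlt[OF t1] by (auto simp: m_def)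
    \<comment> \<open>In these coordinates m = |M t| says (X - A)^2 + Y^2 = m^2 ((X + A)^2 + Y^2).
      As m < 1, dropping the terms in Y leaves |X - A| <= m (X + A), and m <= |t| turns this into
      Harnack's inequality.\<close>
    define X where "X = Re (Q t)"
    define Y where "Y = Im (Q t)"
    have X: "X > 0" using Qpos[OF t1] by (simp add: X_def)
    have "norm (Q t - of_real A) = m * norm (Q t + of_real A)"
      using Qne[OF t1] by (simp add: m_def M_def norm_divide)
    then have "(norm (Q t - of_real A))\<^sup>2 = m\<^sup>2 * (norm (Q t + of_real A))\<^sup>2"
      by (simp add: power_mult_distrib)
    then have e: "(X - A)\<^sup>2 + Y\<^sup>2 = m\<^sup>2 * ((X + A)\<^sup>2 + Y\<^sup>2)"
      unfolding cmod_power2 by (simp add: X_def Y_def)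
    have "m\<^sup>2 \<le> 1" using m by (simp add: power_le_one)
    then have "m\<^sup>2 * Y\<^sup>2 \<le> Y\<^sup>2" by (simp add: mult_left_le_one_le)
    moreover from e have "(X - A)\<^sup>2 + Y\<^sup>2 = m\<^sup>2 * (X + A)\<^sup>2 + m\<^sup>2 * Y\<^sup>2" by (simp only: distrib_left)
    ultimately have "(X - A)\<^sup>2 \<le> (m * (X + A))\<^sup>2" by (simp add: power_mult_distrib)
    then have "\<bar>X - A\<bar> \<le> m * (X + A)"
      using A X m by (simp add: abs_le_square_iff[symmetric])
    then have "A - X \<le> m * (X + A)" by simp
    also have "\<dots> \<le> norm t * (X + A)" using m A X by (intro mult_right_mono) auto
    finally have "(A - X) * r \<le> dist c y * (X + A)" using r by (simp add: nt field_simps)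
    then have "A * (r - dist c y) \<le> X * (r + dist c y)" by (simp add: algebra_simps)
    then show ?thesis by (simp add: A_def X_def Q_def yt)
  qed
qed

section \<open>Removable singularities in a weighted L2 space\<close>

text \<open>Both measures give every box its area. The identification makes Tonelli's theorem
  available in the coordinates Re and Im.\<close>

lemma lborel_complex_eq_distr: "(lborel :: complex measure) = distr (lborel \<Otimes>\<^sub>M lborel) borel (\<lambda>(x, y). Complex x y)"
proof (rule lborel_eqI)
  have [measurable]: "(\<lambda>(x, y). Complex x y) \<in> borel_measurable (lborel \<Otimes>\<^sub>M lborel)"
    unfolding Complex_eq by measurable
  show "emeasure (distr (lborel \<Otimes>\<^sub>M lborel) borel (\<lambda>(x, y). Complex x y)) (box l u) = ennreal (\<Prod>b\<in>Basis. (u - l) \<bullet> b)"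
    if le: "\<And>b. b \<in> Basis \<Longrightarrow> l \<bullet> b \<le> u \<bullet> b" for l u :: complex
  proof -
    have "Re l \<le> Re u" "Im l \<le> Im u"
      using le[of 1] le[of \<i>] by (auto simp: Basis_complex_def inner_complex_def)
    moreover have "((\<lambda>(x, y). Complex x y) -` box l u \<inter> space (lborel \<Otimes>\<^sub>M lborel)) = box (Re l) (Re u) \<times> box (Im l) (Im u)"
      by (auto simp: space_pair_measure in_box_complex_iff)
    ultimately show ?thesis
      by (subst emeasure_distr)
         (auto simp: lborel.emeasure_pair_measure_Times Basis_complex_def ennreal_mult inner_complex_def)
  qed
qed simp

lemma measurable_Complex [measurable]: "(\<lambda>p. Complex (fst p) (snd p)) \<in> borel_measurable (lborel \<Otimes>\<^sub>M lborel)"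
  unfolding Complex_eq by measurable

lemma nn_integral_complex:
  assumes [measurable]: "g \<in> borel_measurable borel"
  shows "(\<integral>\<^sup>+ x. \<integral>\<^sup>+ y. g (Complex x y) \<partial>lborel \<partial>lborel) = (\<integral>\<^sup>+ w. g w \<partial>lborel)"
    and "(\<integral>\<^sup>+ y. \<integral>\<^sup>+ x. g (Complex x y) \<partial>lborel \<partial>lborel) = (\<integral>\<^sup>+ w. g w \<partial>lborel)"
proof -
  have [measurable]: "(\<lambda>(x, y). Complex x y) \<in> borel_measurable (lborel \<Otimes>\<^sub>M lborel)"
    unfolding Complex_eq by measurable
  have "(\<integral>\<^sup>+ w. g w \<partial>lborel) = (\<integral>\<^sup>+ p. g (Complex (fst p) (snd p)) \<partial>(lborel \<Otimes>\<^sub>M lborel))"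
    by (subst lborel_complex_eq_distr, subst nn_integral_distr) (auto simp: case_prod_beta)
  also have "\<dots> = (\<integral>\<^sup>+ x. \<integral>\<^sup>+ y. g (Complex x y) \<partial>lborel \<partial>lborel)"
    by (subst lborel.nn_integral_fst[symmetric]) auto
  finally show 1: "(\<integral>\<^sup>+ x. \<integral>\<^sup>+ y. g (Complex x y) \<partial>lborel \<partial>lborel) = (\<integral>\<^sup>+ w. g w \<partial>lborel)" ..
  have "(\<integral>\<^sup>+ y. \<integral>\<^sup>+ x. g (Complex x y) \<partial>lborel \<partial>lborel) = (\<integral>\<^sup>+ x. \<integral>\<^sup>+ y. g (Complex x y) \<partial>lborel \<partial>lborel)"
    by (rule lborel_pair.Fubini') (simp add: case_prod_beta)
  with 1 show "(\<integral>\<^sup>+ y. \<integral>\<^sup>+ x. g (Complex x y) \<partial>lborel \<partial>lborel) = (\<integral>\<^sup>+ w. g w \<partial>lborel)" by simp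
qed

lemma nn_integral_reflect:
  assumes [measurable]: "f \<in> borel_measurable borel"
  shows "(\<integral>\<^sup>+ x. f (- x :: real) \<partial>lborel) = (\<integral>\<^sup>+ x. f x \<partial>lborel)"
  using nn_integral_real_affine[of f "-1" 0] by simp

text \<open>The sides of a square centred at 0 are the quarter turns of its right side. Reflections
  and the exchange of coordinates preserve area, so integrating over lines in any of the four
  positions gives the same plane integral.\<close>

lemma nn_integral_complex_quarter_turns:
  assumes [measurable]: "g \<in> borel_measurable borel"
    and c: "c \<in> {1, \<i>, -1, -\<i>}"
  shows "(\<integral>\<^sup>+ a. \<integral>\<^sup>+ y. g (c * Complex a y) \<partial>lborel \<partial>lborel) = (\<integral>\<^sup>+ w. g w \<partial>lborel)"
proof -
  have eqs: "\<i> * Complex a y = Complex (- y) a" "- 1 * Complex a y = Complex (- a) (- y)"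
    "- \<i> * Complex a y = Complex y (- a)" for a y
    by (auto simp: complex_eq_iff)
  have [measurable]: "(\<lambda>x. Complex x b) \<in> borel_measurable borel" "(\<lambda>x. Complex b x) \<in> borel_measurable borel" for b
    unfolding Complex_eq by measurable
  have [measurable]: "(\<lambda>a. \<integral>\<^sup>+ y. g (Complex a y) \<partial>lborel) \<in> borel_measurable borel"
     "(\<lambda>a. \<integral>\<^sup>+ y. g (Complex y a) \<partial>lborel) \<in> borel_measurable borel"
    unfolding Complex_eq by measurable
  have r1: "(\<integral>\<^sup>+ y. g (Complex (- y) a) \<partial>lborel) = (\<integral>\<^sup>+ y. g (Complex y a) \<partial>lborel)" for a
    by (rule nn_integral_reflect[of "\<lambda>y. g (Complex y a)"]) simp
  have r2: "(\<integral>\<^sup>+ y. g (Complex a (- y)) \<partial>lborel) = (\<integral>\<^sup>+ y. g (Complex a y) \<partial>lborel)" for a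
    by (rule nn_integral_reflect[of "\<lambda>y. g (Complex a y)"]) simp
  have r3: "(\<integral>\<^sup>+ a. \<integral>\<^sup>+ y. g (Complex (- a) y) \<partial>lborel \<partial>lborel) = (\<integral>\<^sup>+ a. \<integral>\<^sup>+ y. g (Complex a y) \<partial>lborel \<partial>lborel)"
    by (rule nn_integral_reflect[of "\<lambda>a. \<integral>\<^sup>+ y. g (Complex a y) \<partial>lborel"]) simp
  have r4: "(\<integral>\<^sup>+ a. \<integral>\<^sup>+ y. g (Complex y (- a)) \<partial>lborel \<partial>lborel) = (\<integral>\<^sup>+ a. \<integral>\<^sup>+ y. g (Complex y a) \<partial>lborel \<partial>lborel)"
    by (rule nn_integral_reflect[of "\<lambda>a. \<integral>\<^sup>+ y. g (Complex y a) \<partial>lborel"]) simp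
  from c show ?thesis
    by (elim insertE emptyE; simp only: eqs r1 r2 r3 r4 mult_1_left nn_integral_complex[OF assms(1)])
qed

text \<open>Every point w of the side has |w| >= a, so the kernel 1/w costs at most 1/a, which the
  factor a on the left absorbs. The right side is an integral over the Cartesian coordinate y, ready
  to be integrated over a as well.\<close>

lemma contour_integral_side_bound:
  assumes a: "a > 0" and c: "norm c = 1"
    and v: "continuous_on (closed_segment (c * Complex a (-a)) (c * Complex a a)) v"
  shows "ennreal (a * norm (contour_integral (linepath (c * Complex a (-a)) (c * Complex a a)) (\<lambda>w. v w / w)))
     \<le> (\<integral>\<^sup>+ y. ennreal (norm (v (c * Complex a y))) * indicator {-a..a} y \<partial>lborel)"
proof -
  define l where "l = linepath (c * Complex a (-a)) (c * Complex a a)"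
  have l: "l t = c * Complex a (2 * a * t - a)" for t
    by (simp add: l_def linepath_def complex_eq_iff algebra_simps)
  have nl: "norm (l t) \<ge> a" for t
    using abs_Re_le_cmod[of "Complex a (2 * a * t - a)"] a c by (simp add: l norm_mult)
  have lne: "l t \<noteq> 0" for t using nl[of t] a by auto
  have cl: "continuous_on {0..1} l" unfolding l_def by (rule continuous_on_linepath)
  have cv: "continuous_on {0..1} (\<lambda>t. v (l t))"
    by (rule continuous_on_compose2[OF v cl]) (auto simp: l_def linepath_in_path)
  have diff: "c * Complex a a - c * Complex a (-a) = c * (2 * a * \<i>)"
    by (simp add: complex_eq_iff algebra_simps)
  have "contour_integral l (\<lambda>w. v w / w) = integral {0..1} (\<lambda>t. v (l t) / l t * (c * (2 * a * \<i>)))"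
    unfolding l_def contour_integral_integral diff[symmetric] by simp
  also have "norm \<dots> \<le> integral {0..1} (\<lambda>t. 2 * norm (v (l t)))"
  proof (rule integral_norm_bound_integral)
    show "(\<lambda>t. v (l t) / l t * (c * (2 * a * \<i>))) integrable_on {0..1}"
      by (intro integrable_continuous_real continuous_intros cv cl) (use lne in auto)
    show "(\<lambda>t. 2 * norm (v (l t))) integrable_on {0..1}"
      by (intro integrable_continuous_real continuous_intros cv)
    fix t :: real
    have "a / norm (l t) \<le> 1" using nl[of t] a lne[of t] by (simp add: field_simps)
    then have "norm (v (l t)) * 2 * (a / norm (l t)) \<le> norm (v (l t)) * 2 * 1"
      by (intro mult_left_mono) auto
    then show "norm (v (l t) / l t * (c * (2 * a * \<i>))) \<le> 2 * norm (v (l t))"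
      using a c by (simp add: norm_mult norm_divide field_simps)
  qed
  also have "integral {0..1} (\<lambda>t. 2 * norm (v (l t))) = (LINT t:{0..1}|lborel. 2 * norm (v (l t)))"
    by (intro set_borel_integral_eq_integral(2)[symmetric] borel_integrable_atLeastAtMost' continuous_intros cv)
  finally have *: "norm (contour_integral l (\<lambda>w. v w / w)) \<le> (LINT t:{0..1}|lborel. 2 * norm (v (l t)))" .
  have int: "set_integrable lborel {0..1} (\<lambda>t. 2 * norm (v (l t)))"
    by (intro borel_integrable_atLeastAtMost' continuous_intros cv)
  have "ennreal (a * norm (contour_integral l (\<lambda>w. v w / w))) \<le> ennreal (a * (LINT t:{0..1}|lborel. 2 * norm (v (l t))))"
    using * a by (intro ennreal_leI mult_left_mono) auto
  also have "\<dots> = ennreal a * (\<integral>\<^sup>+ t. ennreal (indicator {0..1} t * (2 * norm (v (l t)))) \<partial>lborel)"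
    using a int unfolding set_lebesgue_integral_def set_integrable_def real_scaleR_def
    by (subst nn_integral_eq_integral) (auto simp: ennreal_mult')
  \<comment> \<open>The factor 2 of the integrand and the a in front form 2 a, the Jacobian of y = -
    a + 2 a t.\<close>
  also have "\<dots> = ennreal (2 * a) * (\<integral>\<^sup>+ t. ennreal (norm (v (c * Complex a (- a + 2 * a * t)))) * indicator {-a..a} (- a + 2 * a * t) \<partial>lborel)"
  proof -
    have iff: "- a + 2 * a * t \<in> {-a..a} \<longleftrightarrow> t \<in> {0..1}" for t
      using a by (auto simp: zero_le_mult_iff)
    have m: "(\<lambda>t. ennreal (norm (v (c * Complex a (- a + 2 * a * t)))) * indicator {-a..a} (- a + 2 * a * t)) \<in> borel_measurable lborel"
    proof -
      have "(\<lambda>t. norm (v (l t)) * indicator {0..1} t) \<in> borel_measurable borel"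
        using borel_measurable_continuous_on_indicator[of "{0..1}" "\<lambda>t. norm (v (l t))"] cv
        by (simp add: mult.commute[of "indicat_real _ _"] continuous_on_norm)
      then have "(\<lambda>t. ennreal (norm (v (l t)) * indicator {0..1} t)) \<in> borel_measurable lborel" by simp
      also have "(\<lambda>t. ennreal (norm (v (l t)) * indicator {0..1} t)) = (\<lambda>t. ennreal (norm (v (c * Complex a (- a + 2 * a * t)))) * indicator {-a..a} (- a + 2 * a * t))"
        unfolding indicator_def iff by (auto simp: fun_eq_iff l algebra_simps)
      finally show ?thesis .
    qed
    have "(\<integral>\<^sup>+ t. ennreal (indicator {0..1} t * (2 * norm (v (l t)))) \<partial>lborel) =
       (\<integral>\<^sup>+ t. 2 * (ennreal (norm (v (c * Complex a (- a + 2 * a * t)))) * indicator {-a..a} (- a + 2 * a * t)) \<partial>lborel)"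
      unfolding indicator_def iff by (intro nn_integral_cong) (auto simp: l algebra_simps ennreal_mult')
    also have "\<dots> = 2 * (\<integral>\<^sup>+ t. (ennreal (norm (v (c * Complex a (- a + 2 * a * t)))) * indicator {-a..a} (- a + 2 * a * t)) \<partial>lborel)"
      by (rule nn_integral_cmult[OF m])
    finally show ?thesis using a by (simp add: ennreal_mult' mult_ac)
  qed
  also have "\<dots> = (\<integral>\<^sup>+ y. ennreal (norm (v (c * Complex a y))) * indicator {-a..a} y \<partial>lborel)"
  proof -
    have "continuous_on {-a..a} (\<lambda>y. norm (v (c * Complex a y)))"
    proof (rule continuous_on_norm, rule continuous_on_compose2[OF v])
      show "continuous_on {-a..a} (\<lambda>y. c * Complex a y)" unfolding Complex_eq by (intro continuous_intros)
      show "(\<lambda>y. c * Complex a y) ` {- a..a} \<subseteq> closed_segment (c * Complex a (-a)) (c * Complex a a)"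
      proof clarify
        fix y assume "y \<in> {-a..a}"
        then have "c * Complex a y = l ((y + a) / (2 * a))" "(y + a) / (2 * a) \<in> {0..1}"
          using a by (auto simp: l field_simps)
        then show "c * Complex a y \<in> closed_segment (c * Complex a (-a)) (c * Complex a a)"
          unfolding l_def by (metis linepath_in_path)
      qed
    qed
    then have "(\<lambda>y. norm (v (c * Complex a y)) * indicator {-a..a} y) \<in> borel_measurable borel"
      using borel_measurable_continuous_on_indicator[of "{-a..a}" "\<lambda>y. norm (v (c * Complex a y))"] by (simp add: mult.commute)
    then have "(\<lambda>y. ennreal (norm (v (c * Complex a y)) * indicator {-a..a} y)) \<in> borel_measurable borel" by simp
    also have "(\<lambda>y. ennreal (norm (v (c * Complex a y)) * indicator {-a..a} y)) = (\<lambda>y. ennreal (norm (v (c * Complex a y))) * indicator {-a..a} y)"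
      by (auto simp: fun_eq_iff indicator_def)
    finally show ?thesis
      using a by (subst (2) nn_integral_real_affine[where c="2*a" and t="-a"]) auto
  qed
  finally show ?thesis unfolding l_def .
qed

text \<open>Cauchy's formula on the square contours of half side \<open>a\<close>, averaged over \<open>a\<close>: square contours
  allow Fubini's theorem in Cartesian coordinates.\<close>

lemma holomorphic_square_mean_bound:
  assumes S: "open S" and v: "v holomorphic_on S"
    and r: "r > 0" and Q: "cbox (Complex (-r) (-r)) (Complex r r) \<subseteq> S"
  shows "ennreal (pi * r\<^sup>2 / 2 * norm (v 0)) \<le> 4 * (\<integral>\<^sup>+ w \<in> cbox (Complex (-r) (-r)) (Complex r r). ennreal (norm (v w)) \<partial>lborel)"
proof -
  define Q where "Q = cbox (Complex (-r) (-r)) (Complex r r)"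
  define g where "g = (\<lambda>w. ennreal (norm (v w)) * indicator Q w)"
  have cv: "continuous_on S v" using v by (rule holomorphic_on_imp_continuous_on)
  have "(\<lambda>w. indicator Q w *\<^sub>R norm (v w)) \<in> borel_measurable borel"
    by (intro borel_measurable_continuous_on_indicator continuous_intros continuous_on_subset[OF cv])
       (use Q in \<open>auto simp: Q_def\<close>)
  then have "(\<lambda>w. ennreal (indicator Q w *\<^sub>R norm (v w))) \<in> borel_measurable borel" by simp
  also have "(\<lambda>w. ennreal (indicator Q w *\<^sub>R norm (v w))) = g"
    by (auto simp: g_def fun_eq_iff indicator_def)
  finally have g[measurable]: "g \<in> borel_measurable borel" .
  have inQ: "c * Complex a y \<in> Q" if "c \<in> {1, \<i>, -1, -\<i>}" "0 < a" "a \<le> r" "y \<in> {-a..a}" for c a y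
    using that by (auto simp: Q_def in_cbox_complex_iff)
  define h where "h = (\<lambda>c a. \<integral>\<^sup>+ y. g (c * Complex a y) \<partial>lborel)"
  have hm[measurable]: "h c \<in> borel_measurable borel" for c
    unfolding h_def Complex_eq by measurable
  have hint: "(\<integral>\<^sup>+ a. h c a \<partial>lborel) = (\<integral>\<^sup>+ w. g w \<partial>lborel)" if "c \<in> {1, \<i>, -1, -\<i>}" for c
    unfolding h_def by (rule nn_integral_complex_quarter_turns[OF g that])
  have key: "ennreal (2 * pi * a * norm (v 0)) \<le> h 1 a + h \<i> a + h (-1) a + h (-\<i>) a"
    if a: "0 < a" "a \<le> r" for a
  proof -
    define I where "I = (\<lambda>c. contour_integral (linepath (c * Complex a (-a)) (c * Complex a a)) (\<lambda>w. v w / w))"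
    have seg: "closed_segment (c * Complex a (-a)) (c * Complex a a) \<subseteq> S - {0}" if c: "c \<in> {1, \<i>, -1, -\<i>}" for c
    proof
      fix w assume "w \<in> closed_segment (c * Complex a (-a)) (c * Complex a a)"
      then obtain t where t: "0 \<le> t" "t \<le> 1" "w = (1 - t) *\<^sub>R (c * Complex a (-a)) + t *\<^sub>R (c * Complex a a)"
        by (auto simp: closed_segment_def)
      have w: "w = c * Complex a (2 * a * t - a)" unfolding t(3) by (simp add: complex_eq_iff algebra_simps)
      have "2 * a * t \<le> 2 * a * 1" using t a by (intro mult_left_mono) auto
      then have "w \<in> Q" unfolding w using t a by (intro inQ[OF c]) auto
      moreover have "w \<noteq> 0" using a c by (auto simp: w complex_eq_iff)
      ultimately show "w \<in> S - {0}" using Q by (auto simp: Q_def)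
    qed
    have hasI: "((\<lambda>w. v w / w) has_contour_integral I c) (linepath (c * Complex a (-a)) (c * Complex a a))"
      if c: "c \<in> {1, \<i>, -1, -\<i>}" for c
      unfolding I_def
      by (intro has_contour_integral_integral contour_integrable_continuous_linepath continuous_intros
            continuous_on_subset[OF cv]) (use seg[OF c] in auto)
    \<comment> \<open>\<open>rectpath\<close> starts with the bottom side, which is the right side
      turned by -\<i>; all four sides thus have the form of the side estimate.\<close>
    have rp: "rectpath (Complex (-a) (-a)) (Complex a a) =
       linepath (-\<i> * Complex a (-a)) (-\<i> * Complex a a) +++ linepath (1 * Complex a (-a)) (1 * Complex a a)
       +++ linepath (\<i> * Complex a (-a)) (\<i> * Complex a a) +++ linepath (-1 * Complex a (-a)) (-1 * Complex a a)"
    proof -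
      have "-\<i> * Complex a (-a) = Complex (-a) (-a)" "-\<i> * Complex a a = Complex a (-a)"
        "1 * Complex a (-a) = Complex a (-a)" "1 * Complex a a = Complex a a"
        "\<i> * Complex a (-a) = Complex a a" "\<i> * Complex a a = Complex (-a) a"
        "-1 * Complex a (-a) = Complex (-a) a" "-1 * Complex a a = Complex (-a) (-a)"
        by (auto simp: complex_eq_iff)
      then show ?thesis by (simp only: rectpath_def Let_def complex.sel)
    qed
    have vp: "valid_path (linepath a b)" for a b :: complex by simp
    have "((\<lambda>w. v w / w) has_contour_integral (I (-\<i>) + (I 1 + (I \<i> + I (-1))))) (rectpath (Complex (-a) (-a)) (Complex a a))"
      unfolding rp
      by (intro has_contour_integral_join hasI valid_path_join vp) (auto simp: complex_eq_iff)
    moreover have "((\<lambda>w. v w / (w - 0)) has_contour_integral (2*pi * \<i> * winding_number (rectpath (Complex (-a) (-a)) (Complex a a)) 0 * v 0))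
        (rectpath (Complex (-a) (-a)) (Complex a a))"
    proof (rule Cauchy_integral_formula_convex_simple[of Q])
      show "v holomorphic_on Q" using v Q holomorphic_on_subset unfolding Q_def by blast
      show "path_image (rectpath (Complex (- a) (- a)) (Complex a a)) \<subseteq> Q - {0}"
        using a by (subst path_image_rectpath_cbox_minus_box) (auto simp: Q_def in_cbox_complex_iff in_box_complex_iff)
    qed (use r in \<open>auto simp: Q_def in_box_complex_iff\<close>)
    moreover have "winding_number (rectpath (Complex (-a) (-a)) (Complex a a)) 0 = 1"
      by (rule winding_number_rectpath) (use a in \<open>auto simp: in_box_complex_iff\<close>)
    ultimately have "I (-\<i>) + (I 1 + (I \<i> + I (-1))) = 2 * pi * \<i> * v 0"
      using has_contour_integral_unique[of "\<lambda>w. v w / w"] by simp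
    then have "2 * pi * norm (v 0) = norm (I (-\<i>) + (I 1 + (I \<i> + I (-1))))"
      by (simp add: norm_mult)
    also have "\<dots> \<le> norm (I 1) + norm (I \<i>) + norm (I (-1)) + norm (I (-\<i>))"
      using norm_triangle_ineq[of "I (-\<i>)" "I 1 + (I \<i> + I (-1))"] norm_triangle_ineq[of "I 1" "I \<i> + I (-1)"]
        norm_triangle_ineq[of "I \<i>" "I (-1)"] by simp
    finally have "a * (2 * pi * norm (v 0)) \<le> a * (norm (I 1) + norm (I \<i>) + norm (I (-1)) + norm (I (-\<i>)))"
      using a by (intro mult_left_mono) auto
    then have "ennreal (2 * pi * a * norm (v 0)) \<le> ennreal (a * norm (I 1) + a * norm (I \<i>) + a * norm (I (-1)) + a * norm (I (-\<i>)))"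
      by (intro ennreal_leI) (simp add: algebra_simps)
    also have "\<dots> = ennreal (a * norm (I 1)) + ennreal (a * norm (I \<i>)) + ennreal (a * norm (I (-1))) + ennreal (a * norm (I (-\<i>)))"
      using a by simp
    also have "\<dots> \<le> h 1 a + h \<i> a + h (-1) a + h (-\<i>) a"
    proof -
      have "ennreal (a * norm (I c)) \<le> h c a" if c: "c \<in> {1, \<i>, -1, -\<i>}" for c
      proof -
        have "ennreal (a * norm (I c)) \<le> (\<integral>\<^sup>+ y. ennreal (norm (v (c * Complex a y))) * indicator {-a..a} y \<partial>lborel)"
          unfolding I_def using c seg[OF c]
          by (intro contour_integral_side_bound a continuous_on_subset[OF cv]) auto
        also have "\<dots> \<le> h c a"
          unfolding h_def g_def using inQ[OF c a]
          by (intro nn_integral_mono) (auto simp: indicator_def)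
        finally show ?thesis .
      qed
      then show ?thesis by (intro add_mono) auto
    qed
    finally show ?thesis .
  qed
  \<comment> \<open>Only half sides a in [r/2, r] are averaged: there 2 pi a >= pi r, and the length
    r/2 of the interval produces pi r^2 / 2. Each of the four sides sweeps out at most the integral
    of \<open>g\<close> over the plane, whence the factor 4 on the right.\<close>
  have "ennreal (pi * r\<^sup>2 / 2 * norm (v 0)) = ennreal (pi * r * norm (v 0)) * emeasure lborel {r/2..r}"
    using r by (simp add: ennreal_mult'[symmetric] power2_eq_square field_simps)
  also have "\<dots> = (\<integral>\<^sup>+ a. ennreal (pi * r * norm (v 0)) * indicator {r/2..r} a \<partial>lborel)"
    by (rule nn_integral_cmult_indicator[symmetric]) simp
  also have "\<dots> \<le> (\<integral>\<^sup>+ a. h 1 a + h \<i> a + h (-1) a + h (-\<i>) a \<partial>lborel)"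
  proof (rule nn_integral_mono)
    fix a
    show "ennreal (pi * r * norm (v 0)) * indicator {r/2..r} a \<le> h 1 a + h \<i> a + h (-1) a + h (-\<i>) a"
    proof (cases "a \<in> {r/2..r}")
      case True
      then have "ennreal (pi * r * norm (v 0)) \<le> ennreal (2 * pi * a * norm (v 0))"
        by (intro ennreal_leI mult_right_mono) auto
      also note key[of a]
      finally show ?thesis using True r by simp
    qed simp
  qed
  also have "\<dots> = 4 * (\<integral>\<^sup>+ w. g w \<partial>lborel)"
  proof -
    have "x + x + x + x = 4 * x" for x :: ennreal
    proof -
      have "(4 :: ennreal) = 1 + 1 + 1 + 1" by simp
      then show ?thesis by (simp only: distrib_right mult_1_left)
    qed
    then show ?thesis by (simp add: nn_integral_add hint)
  qed
  finally show ?thesis by (simp add: g_def Q_def)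
qed

text \<open>The mean value bound for u^2 on a square whose size is proportional to |x - p| gives |u
  x|^2 <= C / |x - p|. Hence (x - p) u x tends to 0, which is enough for a removable
  singularity.\<close>

lemma removable_singularity_weighted_L2:
  assumes d: "d > 0" and u: "u holomorphic_on ball p d - {p}"
    and int: "(\<integral>\<^sup>+ x \<in> ball p d - {p}. ennreal ((norm (u x))\<^sup>2 / norm (x - p)) \<partial>lborel) < \<infinity>"
  shows "\<exists>g. g holomorphic_on ball p d \<and> (\<forall>x\<in>ball p d - {p}. g x = u x)"
proof -
  obtain E where E: "E \<ge> 0" "(\<integral>\<^sup>+ x \<in> ball p d - {p}. ennreal ((norm (u x))\<^sup>2 / norm (x - p)) \<partial>lborel) = ennreal E"
    using int that
    by (cases "\<integral>\<^sup>+ x \<in> ball p d - {p}. ennreal ((norm (u x))\<^sup>2 / norm (x - p)) \<partial>lborel" rule: ennreal_cases) auto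
  have bound: "(norm ((x - p) * u x))\<^sup>2 \<le> 192 * E * norm (x - p)" if x: "x \<noteq> p" "norm (x - p) < d / 2" for x
  proof -
    \<comment> \<open>The square of half side r lies in the disc of radius 2 r, so around x the
      distance to p stays between 2 r and 6 r: the square avoids p, and |x - p| < d/2 keeps it
      inside the ball.\<close>
    define r where "r = norm (x - p) / 4"
    define Q where "Q = cbox (Complex (-r) (-r)) (Complex r r)"
    have r: "r > 0" using x by (simp add: r_def)
    have Qn: "norm w \<le> 2 * r" if "w \<in> Q" for w
      using cmod_le[of w] that by (auto simp: Q_def in_cbox_complex_iff)
    define S where "S = (\<lambda>w. x + w) -` (ball p d - {p})"
    have oS: "open S" unfolding S_def
      by (intro continuous_open_vimage) (auto intro!: continuous_intros)
    have QS: "x + w \<in> ball p d - {p}" "norm (x + w - p) \<le> 6 * r" if "w \<in> Q" for w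
    proof -
      have "norm (x + w - p) \<le> norm (x - p) + norm w" "norm (x - p) \<le> norm (x + w - p) + norm w"
        using norm_triangle_ineq[of "x - p" w] norm_triangle_ineq4[of "x + w - p" w] by (simp_all add: algebra_simps)
      moreover note Qn[OF that]
      ultimately have *: "norm (x + w - p) \<le> 6 * r" "norm (x + w - p) \<ge> 2 * r" by (auto simp: r_def)
      then have "x + w \<noteq> p" "norm (x + w - p) < d" using r x by (auto simp: r_def)
      then show "x + w \<in> ball p d - {p}" by (auto simp: dist_norm norm_minus_commute)
      show "norm (x + w - p) \<le> 6 * r" by fact
    qed
    \<comment> \<open>Squaring keeps the function holomorphic and turns the L1 mean bound into an L2
      bound for u.\<close>
    have hv: "(\<lambda>w. (u (x + w))\<^sup>2) holomorphic_on S"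
      by (intro holomorphic_intros holomorphic_on_compose_gen[OF _ u, unfolded o_def])
         (auto simp: S_def)
    have "ennreal (pi * r\<^sup>2 / 2 * norm ((u (x + 0))\<^sup>2)) \<le> 4 * (\<integral>\<^sup>+ w \<in> Q. ennreal (norm ((u (x + w))\<^sup>2)) \<partial>lborel)"
      unfolding Q_def by (rule holomorphic_square_mean_bound[OF oS hv r]) (use QS in \<open>auto simp: S_def Q_def\<close>)
    also have "(\<integral>\<^sup>+ w \<in> Q. ennreal (norm ((u (x + w))\<^sup>2)) \<partial>lborel)
       \<le> (\<integral>\<^sup>+ w. ennreal (6 * r) * (ennreal ((norm (u (x + w)))\<^sup>2 / norm (x + w - p)) * indicator (ball p d - {p}) (x + w)) \<partial>lborel)"
    proof (rule nn_integral_mono)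
      fix w
      show "ennreal (norm ((u (x + w))\<^sup>2)) * indicator Q w \<le>
         ennreal (6 * r) * (ennreal ((norm (u (x + w)))\<^sup>2 / norm (x + w - p)) * indicator (ball p d - {p}) (x + w))"
      proof (cases "w \<in> Q")
        case True
        have n: "norm (x + w - p) > 0" using QS(1)[OF True] by auto
        have "(norm (u (x + w)))\<^sup>2 * norm (x + w - p) \<le> (norm (u (x + w)))\<^sup>2 * (6 * r)"
          by (intro mult_left_mono QS(2)[OF True]) simp
        then have "norm ((u (x + w))\<^sup>2) \<le> (6 * r) * ((norm (u (x + w)))\<^sup>2 / norm (x + w - p))"
          using n by (simp add: norm_power field_simps)
        then have "ennreal (norm ((u (x + w))\<^sup>2)) \<le> ennreal ((6 * r) * ((norm (u (x + w)))\<^sup>2 / norm (x + w - p)))"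
          by (rule ennreal_leI)
        also have "\<dots> = ennreal (6 * r) * ennreal ((norm (u (x + w)))\<^sup>2 / norm (x + w - p))"
          using r by (intro ennreal_mult) auto
        finally show ?thesis using True QS(1)[OF True] by simp
      qed simp
    qed
    also have "\<dots> = ennreal (6 * r) * ennreal E"
    proof -
      define f where "f = (\<lambda>y. ennreal ((norm (u y))\<^sup>2 / norm (y - p)) * indicator (ball p d - {p}) y)"
      have "(\<lambda>y. indicator (ball p d - {p}) y *\<^sub>R ((norm (u y))\<^sup>2 / norm (y - p))) \<in> borel_measurable borel"
        by (intro borel_measurable_continuous_on_indicator continuous_intros
              holomorphic_on_imp_continuous_on[OF u]) auto
      then have "(\<lambda>y. ennreal (indicator (ball p d - {p}) y *\<^sub>R ((norm (u y))\<^sup>2 / norm (y - p)))) \<in> borel_measurable borel" by simp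
      also have "(\<lambda>y. ennreal (indicator (ball p d - {p}) y *\<^sub>R ((norm (u y))\<^sup>2 / norm (y - p)))) = f"
        by (auto simp: f_def fun_eq_iff indicator_def)
      finally have [measurable]: "f \<in> borel_measurable borel" .
      have "(\<integral>\<^sup>+ w. f (x + w) \<partial>lborel) = (\<integral>\<^sup>+ w. f w \<partial>distr lborel borel ((+) x))"
        by (subst nn_integral_distr) auto
      also have "\<dots> = ennreal E"
        unfolding lborel_distr_plus using E(2) by (simp add: f_def)
      finally have fE: "(\<integral>\<^sup>+ w. f (x + w) \<partial>lborel) = ennreal E" .
      have fx: "ennreal ((norm (u (x + w)))\<^sup>2 / norm (x + w - p)) * indicator (ball p d - {p}) (x + w) = f (x + w)" for w
        by (simp add: f_def)
      show ?thesis unfolding fx by (subst nn_integral_cmult) (auto simp: fE)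
    qed
    finally have "ennreal (pi * r\<^sup>2 / 2 * (norm (u x))\<^sup>2) \<le> 4 * (ennreal (6 * r) * ennreal E)"
      by (simp add: norm_power mult_left_mono)
    also have "\<dots> = ennreal (24 * r * E)" using r E
      by (simp add: ennreal_mult'[symmetric] flip: ennreal_numeral)
    finally have "pi * r\<^sup>2 / 2 * (norm (u x))\<^sup>2 \<le> 24 * r * E"
      using r E by (simp add: ennreal_le_iff)
    then have "pi * r / 2 * (norm (u x))\<^sup>2 \<le> 24 * E" using r by (simp add: power2_eq_square field_simps)
    \<comment> \<open>Here pi is rounded down to 1. The resulting 48, with r = |x - p| / 4, becomes
      the 192 of the bound.\<close>
    moreover have "1 * (r / 2 * (norm (u x))\<^sup>2) \<le> pi * (r / 2 * (norm (u x))\<^sup>2)"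
      using pi_gt3 r by (intro mult_right_mono) auto
    ultimately have "r * (norm (u x))\<^sup>2 \<le> 48 * E" by simp
    then have "norm (x - p) * (norm (u x))\<^sup>2 \<le> 192 * E" by (simp add: r_def)
    then have "norm (x - p) * (norm (x - p) * (norm (u x))\<^sup>2) \<le> norm (x - p) * (192 * E)"
      by (rule mult_left_mono) simp
    then show ?thesis by (simp add: norm_mult power_mult_distrib power2_eq_square mult_ac)
  qed
  have "((\<lambda>x. (norm ((x - p) * u x))\<^sup>2) \<longlongrightarrow> 0) (at p)"
  proof (rule tendsto_sandwich[where f="\<lambda>_. 0" and h="\<lambda>x. 192 * E * norm (x - p)"])
    show "\<forall>\<^sub>F x in at p. (norm ((x - p) * u x))\<^sup>2 \<le> 192 * E * norm (x - p)"
      unfolding eventually_at using bound d by (intro exI[of _ "d/2"]) (auto simp: dist_norm)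
    have "((\<lambda>x. 192 * E * norm (x - p)) \<longlongrightarrow> 192 * E * norm (p - p)) (at p)"
      by (intro tendsto_intros)
    then show "((\<lambda>x. 192 * E * norm (x - p)) \<longlongrightarrow> 0) (at p)" by simp
  qed auto
  then have "((\<lambda>x. sqrt ((norm ((x - p) * u x))\<^sup>2)) \<longlongrightarrow> sqrt 0) (at p)" by (rule tendsto_real_sqrt)
  then have "((\<lambda>x. (x - p) * u x) \<longlongrightarrow> 0) (at p)" by (simp add: tendsto_norm_zero_iff del: norm_mult)
  then show ?thesis
    using holomorphic_on_extend_lim[OF u] d by simp
qed

section \<open>Z2 harmonic functions and their entire functions\<close>

text \<open>In a trivialization \<open>s\<close> the section \<open>f\<close> is locally the real part of a primitive of \<open>u / s\<close>.\<close>

definition z2_potential :: "complex set \<Rightarrow> (complex \<Rightarrow> complex \<Rightarrow> real) \<Rightarrow> (complex \<Rightarrow> complex) \<Rightarrow> bool" where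
  "z2_potential K f u \<longleftrightarrow> z2_function K f \<and> u holomorphic_on UNIV \<and>
     (\<forall>V s x. trivialization K V s \<longrightarrow> x \<in> V \<longrightarrow> has_cgrad (\<lambda>y. f y (s y)) (u x / s x) x)"

section \<open>Trivializations as local holomorphic square roots of D\<close>

lemma z2_functionD: "z2_function K f \<Longrightarrow> x \<notin> K \<Longrightarrow> w\<^sup>2 = monic_poly K x \<Longrightarrow> f x (- w) = - f x w"
  by (simp add: z2_function_def)

lemma monic_poly_eq_0_iff: "finite K \<Longrightarrow> monic_poly K x = 0 \<longleftrightarrow> x \<in> K"
  by (auto simp: monic_poly_def)

lemma monic_poly_holomorphic [holomorphic_intros]: "monic_poly K holomorphic_on S"
  unfolding monic_poly_def by (intro holomorphic_intros)

lemma monic_poly_split: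
  "finite K \<Longrightarrow> p \<in> K \<Longrightarrow> monic_poly K x = (x - p) * monic_poly (K - {p}) x"
  unfolding monic_poly_def by (subst prod.remove[of _ p]) auto

lemma trivializationD:
  assumes "trivialization K V s" "x \<in> V"
  shows "x \<notin> K" "(s x)\<^sup>2 = monic_poly K x"
  using assms by (auto simp: trivialization_def)

lemma trivialization_nonzero:
  assumes "finite K" "trivialization K V s" "x \<in> V" shows "s x \<noteq> 0"
  using trivializationD[OF assms(2,3)] monic_poly_eq_0_iff[OF assms(1), of x] by auto

lemma trivialization_uminus: "trivialization K V s \<Longrightarrow> trivialization K V (\<lambda>x. - s x)"
  by (auto simp: trivialization_def intro!: continuous_intros)

lemma trivialization_subset: "trivialization K V s \<Longrightarrow> open W \<Longrightarrow> W \<subseteq> V \<Longrightarrow> trivialization K W s"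
  by (auto simp: trivialization_def intro: continuous_on_subset)

text \<open>Division by the value at x moves the argument of the root to 1, and where the quotient
  has positive real part the principal root is holomorphic. The explicit formula in the conclusion
  is what identifies \<open>trivialization_at\<close> as such a root.\<close>

lemma trivialization_local:
  assumes K: "finite K" and x: "x \<notin> K" and w: "w\<^sup>2 = monic_poly K x"
  obtains W s where "trivialization K W s" "x \<in> W" "s x = w" "s holomorphic_on W"
    "s = (\<lambda>y. w * csqrt (monic_poly K y / monic_poly K x))"
proof -
  define D where "D = monic_poly K"
  have D0: "D x \<noteq> 0" using K x by (simp add: D_def monic_poly_eq_0_iff)
  define W where "W = {y. Re (D y / D x) > 0}"
  have cD: "continuous_on UNIV D"
    unfolding D_def by (intro holomorphic_on_imp_continuous_on holomorphic_intros)
  have oW: "open W"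
    unfolding W_def by (intro open_Collect_less continuous_intros cD) (use D0 in auto)
  define s where "s = (\<lambda>y. w * csqrt (D y / D x))"
  have hs: "s holomorphic_on W"
  proof -
    have "(\<lambda>y. csqrt (D y / D x)) holomorphic_on W"
    proof (rule holomorphic_on_compose_gen[OF _ holomorphic_on_csqrt, unfolded o_def])
      show "(\<lambda>y. D y / D x) holomorphic_on W"
        unfolding D_def by (intro holomorphic_intros) (use D0 in \<open>auto simp: D_def\<close>)
      show "(\<lambda>y. D y / D x) ` W \<subseteq> - \<real>\<^sub>\<le>\<^sub>0"
        by (auto simp: W_def complex_nonpos_Reals_iff)
    qed
    then show ?thesis unfolding s_def by (intro holomorphic_on_mult holomorphic_on_const)
  qed
  have "trivialization K W s"
    unfolding trivialization_def
  proof (intro conjI ballI oW)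
    show "W \<inter> K = {}"
      by (auto simp: W_def D_def monic_poly_eq_0_iff[OF K, THEN iffD2])
    show "continuous_on W s" using hs by (rule holomorphic_on_imp_continuous_on)
    show "(s y)\<^sup>2 = monic_poly K y" for y
      using D0 by (simp add: s_def power_mult_distrib w D_def)
  qed
  moreover have "x \<in> W" "s x = w" using D0 by (auto simp: W_def s_def)
  ultimately show ?thesis using that hs unfolding s_def D_def by blast
qed

text \<open>Two roots of the same number differ at most by sign, so they agree wherever their sum is
  nonzero. At x the sum is 2 s x, and nonvanishing is an open condition.\<close>

lemma trivialization_agree:
  assumes K: "finite K" and s: "trivialization K V s" "x \<in> V" and s': "trivialization K V' s'" "x \<in> V'"
    and eq: "s x = s' x"
  obtains N where "open N" "x \<in> N" "N \<subseteq> V \<inter> V'" "\<forall>y\<in>N. s y = s' y"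
proof -
  define N where "N = (V \<inter> V') \<inter> (\<lambda>y. s y + s' y) -` (- {0})"
  have "open N" unfolding N_def
    using s(1) s'(1)
    by (intro continuous_open_preimage continuous_intros) (auto simp: trivialization_def intro: continuous_on_subset)
  moreover have "x \<in> N"
    using s s' eq trivialization_nonzero[OF K s] by (auto simp: N_def)
  moreover have "\<forall>y\<in>N. s y = s' y"
  proof
    fix y assume that: "y \<in> N"
    have "(s y)\<^sup>2 = (s' y)\<^sup>2" using that trivializationD(2)[OF s(1), of y] trivializationD(2)[OF s'(1), of y]
      by (simp add: N_def)
    then show "s y = s' y" using that by (auto simp: N_def power2_eq_iff)
  qed
  ultimately show ?thesis using that[of N] unfolding N_def by blast
qed

lemma trivialization_holomorphic:
  assumes K: "finite K" and s: "trivialization K V s"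
  shows "s holomorphic_on V"
proof -
  have V: "open V" using s by (simp add: trivialization_def)
  show ?thesis unfolding holomorphic_on_open[OF V]
  proof
    fix x assume x: "x \<in> V"
    obtain W t where t: "trivialization K W t" "x \<in> W" "t x = s x" "t holomorphic_on W"
      using trivialization_local[OF K trivializationD[OF s x]] by blast
    obtain N where N: "open N" "x \<in> N" "N \<subseteq> W \<inter> V" "\<forall>y\<in>N. t y = s y"
      using trivialization_agree[OF K t(1,2) s x t(3)] .
    have "s holomorphic_on N"
      by (rule holomorphic_transform[of t]) (use t N in \<open>auto intro: holomorphic_on_subset\<close>)
    then show "\<exists>f'. (s has_field_derivative f') (at x)"
      using N holomorphic_on_open by blast
  qed
qed

text \<open>Passing to the other root changes the sign of both the section and s, so the numerator a
  is independent of the trivialization. This is why \<open>u\<close> is an ordinary function on the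
  plane although f is not.\<close>

lemma has_cgrad_change_trivialization:
  assumes K: "finite K" and f: "z2_function K f"
    and s: "trivialization K V s" "x \<in> V" and s': "trivialization K V' s'" "x \<in> V'"
    and h: "has_cgrad (\<lambda>y. f y (s y)) (a / s x) x"
  shows "has_cgrad (\<lambda>y. f y (s' y)) (a / s' x) x"
proof -
  have "(s x)\<^sup>2 = (s' x)\<^sup>2" using trivializationD(2)[OF s] trivializationD(2)[OF s'] by simp
  then have "s x = s' x \<or> s x = - s' x" by (rule iffD1[OF power2_eq_iff])
  then show ?thesis
  proof (elim disjE)
    assume 1: "s x = s' x"
    obtain N where N: "open N" "x \<in> N" "N \<subseteq> V \<inter> V'" "\<forall>y\<in>N. s y = s' y"
      using trivialization_agree[OF K s s' 1] .
    show ?thesis using has_cgrad_cong[OF h N(1,2)] N(4) 1 by simp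
  next
    assume 2: "s x = - s' x"
    obtain N where N: "open N" "x \<in> N" "N \<subseteq> V \<inter> V'" "\<forall>y\<in>N. s y = - s' y"
      using trivialization_agree[OF K s trivialization_uminus[OF s'(1)] s'(2) 2] .
    have "has_cgrad (\<lambda>y. - 1 * f y (s y)) (of_real (- 1) * (a / s x)) x"
      by (rule has_cgrad_cmult[OF h])
    then have "has_cgrad (\<lambda>y. - f y (s y)) (a / s' x) x" using 2 by simp
    then show ?thesis
    proof (rule has_cgrad_cong[OF _ N(1,2)])
      fix y assume y: "y \<in> N"
      then show "- f y (s y) = f y (s' y)"
        using z2_functionD[OF f trivializationD[OF s'(1)], of y] N by auto
    qed
  qed
qed

lemma trivialization_at_props:
  assumes K: "finite K" and x: "x \<notin> K"
  obtains W where "trivialization K W (trivialization_at K x)" "x \<in> W"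
proof -
  have "trivialization_at K x = (\<lambda>y. csqrt (monic_poly K x) * csqrt (monic_poly K y / monic_poly K x))"
    by (simp add: fun_eq_iff trivialization_at_def)
  then show ?thesis using trivialization_local[OF K x power2_csqrt] that by metis
qed

lemma z2_harmonic_imp_potential_off:
  assumes K: "finite K" and f: "z2_harmonic K f"
  obtains u where "u holomorphic_on - K"
    "\<And>V s x. trivialization K V s \<Longrightarrow> x \<in> V \<Longrightarrow> has_cgrad (\<lambda>y. f y (s y)) (u x / s x) x"
    "\<And>x. x \<notin> K \<Longrightarrow> (z2_grad_norm K f x)\<^sup>2 = (norm (u x))\<^sup>2 / norm (monic_poly K x)"
proof -
  have fz: "z2_function K f" using f by (simp add: z2_harmonic_def)
  have fh: "harmonic_on (\<lambda>x. f x (s x)) V" if "trivialization K V s" for V s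
    using f that by (simp add: z2_harmonic_def)
  \<comment> \<open>The trivialization used at x takes the value csqrt (D x) at x, so u x is the
    complex gradient times the root. A sign jump of \<open>csqrt\<close> cancels against that of the
    gradient; holomorphy is then checked in one fixed trivialization near each point.\<close>
  define u where "u = (\<lambda>x. cnj (gradient (\<lambda>y. f y (trivialization_at K x y)) x) * csqrt (monic_poly K x))"
  have at_x: "trivialization_at K x x = csqrt (monic_poly K x)" if "x \<notin> K" for x
    using that monic_poly_eq_0_iff[OF K, of x] by (simp add: trivialization_at_def)
  have cg: "has_cgrad (\<lambda>y. f y (s y)) (u x / s x) x" if s: "trivialization K V s" "x \<in> V" for V s x
  proof -
    have x: "x \<notin> K" using trivializationD[OF s] by simp
    obtain W where W: "trivialization K W (trivialization_at K x)" "x \<in> W"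
      using trivialization_at_props[OF K x] .
    have "has_cgrad (\<lambda>y. f y (trivialization_at K x y)) (u x / trivialization_at K x x) x"
      using harmonic_on_has_cgrad[OF fh[OF W(1)] W(2)] trivialization_nonzero[OF K W]
      by (simp add: u_def at_x[OF x])
    then show ?thesis by (rule has_cgrad_change_trivialization[OF K fz W s])
  qed
  have oK: "open (- K)" using K by (simp add: finite_imp_closed open_Compl)
  have "u holomorphic_on - K" unfolding holomorphic_on_open[OF oK]
  proof
    fix x assume "x \<in> - K"
    then have x: "x \<notin> K" by simp
    obtain W s where s: "trivialization K W s" "x \<in> W" "s holomorphic_on W"
      using trivialization_local[OF K x power2_csqrt] by blast
    have oW: "open W" using s by (simp add: trivialization_def)
    have "(\<lambda>y. cnj (gradient (\<lambda>y. f y (s y)) y) * s y) holomorphic_on W"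
      by (intro holomorphic_intros harmonic_on_cnj_gradient_holomorphic fh s oW)
    then have "u holomorphic_on W"
    proof (rule holomorphic_transform)
      fix y assume y: "y \<in> W"
      show "cnj (gradient (\<lambda>y. f y (s y)) y) * s y = u y"
        using gradient_eq_cnj[OF cg[OF s(1) y]] trivialization_nonzero[OF K s(1) y] by simp
    qed
    then show "\<exists>f'. (u has_field_derivative f') (at x)"
      using oW s(2) holomorphic_on_open by blast
  qed
  moreover have "(z2_grad_norm K f x)\<^sup>2 = (norm (u x))\<^sup>2 / norm (monic_poly K x)" if x: "x \<notin> K" for x
  proof -
    have "(norm (csqrt (monic_poly K x)))\<^sup>2 = norm (monic_poly K x)"
      by (metis norm_power power2_csqrt)
    then show ?thesis
      using monic_poly_eq_0_iff[OF K, of x] x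
      by (simp add: u_def z2_grad_norm_def norm_mult power_mult_distrib)
  qed
  ultimately show ?thesis using that cg by blast
qed

section \<open>Extension of u over the branch points\<close>

lemma finite_isolated_ball:
  fixes K :: "complex set"
  assumes "finite K" "p \<in> K"
  obtains d where "d > 0" "ball p d \<inter> K = {p}"
proof -
  have "open (- (K - {p}))" using finite_imp_closed[of "K - {p}"] assms(1) by (intro open_Compl) simp
  then obtain d where "d > 0" "ball p d \<subseteq> - (K - {p})"
    by (metis Compl_iff DiffD2 insertI1 open_contains_ball)
  then have "ball p d \<inter> K = {p}" using assms(2) by auto
  with \<open>d > 0\<close> show ?thesis by (rule that)
qed

text \<open>Near p the cofactor D / (x - p) is bounded by some C, so |u|^2 / |x - p| is at most C
  times the energy density, which is integrable over the punctured ball.\<close>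

lemma z2_harmonic_imp_potential:
  assumes K: "finite K" and f: "z2_harmonic K f"
  obtains u where "z2_potential K f u"
proof -
  obtain u where u: "u holomorphic_on - K"
    and cg: "\<And>V s x. trivialization K V s \<Longrightarrow> x \<in> V \<Longrightarrow> has_cgrad (\<lambda>y. f y (s y)) (u x / s x) x"
    and gn: "\<And>x. x \<notin> K \<Longrightarrow> (z2_grad_norm K f x)\<^sup>2 = (norm (u x))\<^sup>2 / norm (monic_poly K x)"
    using z2_harmonic_imp_potential_off[OF assms] by blast
  \<comment> \<open>The local extension g only serves to give u a limit at p; boundedness at each
    point then removes all of \<open>K\<close> at once.\<close>
  have bounded_at: "u \<in> O[at p](\<lambda>_. 1)" if p: "p \<in> K" for p
  proof -
    obtain d where d: "d > 0" "ball p d \<inter> K = {p}" using finite_isolated_ball[OF K p] .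
    define B where "B = ball p d - {p}"
    have B: "open B" "bounded B" "B \<inter> K = {}" using d by (auto simp: B_def)
    have uB: "u holomorphic_on B" by (rule holomorphic_on_subset[OF u]) (use B in auto)
    have int: "set_integrable lborel B (\<lambda>x. (z2_grad_norm K f x)\<^sup>2)"
      using f B by (simp add: z2_harmonic_def)
    have "continuous_on (cball p d) (monic_poly (K - {p}))"
      by (intro holomorphic_on_imp_continuous_on holomorphic_intros)
    then have "bounded (monic_poly (K - {p}) ` cball p d)"
      by (intro compact_imp_bounded compact_continuous_image) auto
    then obtain C where C: "C > 0" "\<And>x. x \<in> cball p d \<Longrightarrow> norm (monic_poly (K - {p}) x) \<le> C"
      unfolding bounded_pos by blast
    have le: "(norm (u x))\<^sup>2 / norm (x - p) \<le> C * (z2_grad_norm K f x)\<^sup>2" if x: "x \<in> B" for x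
    proof -
      have xK: "x \<notin> K" using x B by auto
      have n: "norm (monic_poly K x) = norm (x - p) * norm (monic_poly (K - {p}) x)"
        using monic_poly_split[OF K p] by (simp add: norm_mult)
      have "monic_poly K x \<noteq> 0" using xK K by (simp add: monic_poly_eq_0_iff)
      then have pos: "norm (x - p) > 0" "norm (monic_poly (K - {p}) x) > 0"
        using monic_poly_split[OF K p, of x] by auto
      have "(norm (u x))\<^sup>2 * norm (monic_poly (K - {p}) x) \<le> (norm (u x))\<^sup>2 * C"
        using C(2)[of x] x by (intro mult_left_mono) (auto simp: B_def)
      then show ?thesis unfolding gn[OF xK] n using pos by (simp add: field_simps)
    qed
    have "(\<integral>\<^sup>+ x \<in> B. ennreal ((norm (u x))\<^sup>2 / norm (x - p)) \<partial>lborel)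
        \<le> (\<integral>\<^sup>+ x. ennreal (norm (indicator B x *\<^sub>R (C * (z2_grad_norm K f x)\<^sup>2))) \<partial>lborel)"
      using le by (intro nn_integral_mono) (auto simp: indicator_def intro!: ennreal_leI order_trans[OF le abs_ge_self])
    also have "\<dots> < \<infinity>"
    proof -
      have "integrable lborel (\<lambda>x. C * (indicator B x *\<^sub>R (z2_grad_norm K f x)\<^sup>2))"
        using int unfolding set_integrable_def by (rule integrable_mult_right)
      then have "integrable lborel (\<lambda>x. indicator B x *\<^sub>R (C * (z2_grad_norm K f x)\<^sup>2))"
        by (simp add: mult.left_commute)
      then show ?thesis unfolding integrable_iff_bounded by simp
    qed
    finally obtain g where g: "g holomorphic_on ball p d" "\<And>x. x \<in> B \<Longrightarrow> g x = u x"
      using removable_singularity_weighted_L2[OF d(1), of u p] uB unfolding B_def by blast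
    have "isCont g p"
      using holomorphic_on_imp_continuous_on[OF g(1)] d(1) continuous_on_interior by fastforce
    then have "(g \<longlongrightarrow> g p) (at p)" by (simp add: isCont_def)
    then have "(u \<longlongrightarrow> g p) (at p)"
    proof (rule Lim_transform_eventually)
      show "\<forall>\<^sub>F x in at p. g x = u x"
        unfolding eventually_at using d(1) g(2) by (intro exI[of _ d]) (auto simp: B_def dist_commute)
    qed
    then show ?thesis by (intro bigoI_tendsto[of _ _ "g p"]) auto
  qed
  have "\<exists>g. g holomorphic_on UNIV \<and> (\<forall>z\<in>UNIV-K. g z = u z)"
    by (rule removable_singularities[OF K]) (use u bounded_at in \<open>auto simp: Compl_eq_Diff_UNIV\<close>)
  then obtain g where g: "g holomorphic_on UNIV" "\<And>z. z \<notin> K \<Longrightarrow> g z = u z" by auto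
  have "z2_potential K f g"
    unfolding z2_potential_def
  proof (intro conjI allI impI)
    show "z2_function K f" using f by (simp add: z2_harmonic_def)
    fix V s x assume "trivialization K V s" "x \<in> V"
    then show "has_cgrad (\<lambda>y. f y (s y)) (g x / s x) x"
      using cg[of V s x] g(2)[of x] trivializationD(1)[of K V s x] by simp
  qed (rule g)
  then show ?thesis using that by blast
qed

lemma z2_potential_linear:
  assumes f: "z2_potential K f u" and g: "z2_potential K g v"
  shows "z2_potential K (\<lambda>x w. f x w - c * g x w) (\<lambda>x. u x - of_real c * v x)"
  unfolding z2_potential_def
proof (intro conjI allI impI)
  show "z2_function K (\<lambda>x w. f x w - c * g x w)"
    using f g by (simp add: z2_potential_def z2_function_def)
  show "(\<lambda>x. u x - of_real c * v x) holomorphic_on UNIV"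
    using f g by (auto simp: z2_potential_def intro!: holomorphic_intros)
  fix V s x assume s: "trivialization K V s" "x \<in> V"
  have "has_cgrad (\<lambda>y. f y (s y) - c * g y (s y)) (u x / s x - of_real c * (v x / s x)) x"
    using f g s by (intro has_cgrad_diff has_cgrad_cmult) (auto simp: z2_potential_def)
  then show "has_cgrad (\<lambda>y. f y (s y) - c * g y (s y)) ((u x - of_real c * v x) / s x) x"
    by (simp add: diff_divide_distrib)
qed

lemma z2_potentialD:
  assumes "z2_potential K f u"
  shows "z2_function K f" "u holomorphic_on S"
    "trivialization K V s \<Longrightarrow> x \<in> V \<Longrightarrow> has_cgrad (\<lambda>y. f y (s y)) (u x / s x) x"
  using assms holomorphic_on_subset by (auto simp: z2_potential_def)

section \<open>Local charts and the maximum principle\<close>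

text \<open>Any root would do in place of \<open>csqrt\<close>, since a \<open>Z\<^sub>2\<close>
  function is odd in the root. On \<open>K\<close> the value 0 is imposed; that it is the continuous
  extension is a theorem about potentials.\<close>

definition z2_abs :: "complex set \<Rightarrow> (complex \<Rightarrow> complex \<Rightarrow> real) \<Rightarrow> complex \<Rightarrow> real" where
  "z2_abs K f x = (if x \<in> K then 0 else \<bar>f x (csqrt (monic_poly K x))\<bar>)"

lemma z2_abs_eq:
  assumes "z2_function K f" "x \<notin> K" "w\<^sup>2 = monic_poly K x"
  shows "\<bar>f x w\<bar> = z2_abs K f x"
proof -
  have "w\<^sup>2 = (csqrt (monic_poly K x))\<^sup>2" using assms by simp
  then have "w = csqrt (monic_poly K x) \<or> w = - csqrt (monic_poly K x)" by (simp only: power2_eq_iff)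
  then show ?thesis using z2_functionD[OF assms(1,2), of "csqrt (monic_poly K x)"] assms(2)
    by (auto simp: z2_abs_def)
qed

lemma z2_abs_local:
  assumes K: "finite K" and f: "z2_potential K f u" and x: "x \<notin> K"
  obtains r P where "r > 0" "P holomorphic_on ball x r" "ball x r \<inter> K = {}"
    "\<forall>y\<in>ball x r. z2_abs K f y = \<bar>Re (P y)\<bar>"
proof -
  obtain W s where s: "trivialization K W s" "x \<in> W" "s holomorphic_on W"
    using trivialization_local[OF K x power2_csqrt] by metis
  have W: "open W" "W \<inter> K = {}" using s by (auto simp: trivialization_def)
  then obtain r where r: "r > 0" "ball x r \<subseteq> W" using s(2) open_contains_ball by blast
  have k: "(\<lambda>y. u y / s y) holomorphic_on ball x r"
    using r trivialization_nonzero[OF K s(1)]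
    by (intro holomorphic_intros z2_potentialD(2)[OF f] holomorphic_on_subset[OF s(3)]) auto
  have cg: "has_cgrad (\<lambda>y. f y (s y)) (u y / s y) y" if "y \<in> ball x r" for y
    using z2_potentialD(3)[OF f s(1)] that r by auto
  obtain P where P: "P holomorphic_on ball x r" "\<forall>y\<in>ball x r. f y (s y) = Re (P y)"
    using cgrad_convex_primitive[OF open_ball convex_ball k open_ball connected_ball order_refl cg] .
  have "\<forall>y\<in>ball x r. z2_abs K f y = \<bar>Re (P y)\<bar>"
  proof
    fix y assume y: "y \<in> ball x r"
    then have "y \<in> W" using r by auto
    from z2_abs_eq[OF z2_potentialD(1)[OF f] trivializationD[OF s(1) this]] P(2) y
    show "z2_abs K f y = \<bar>Re (P y)\<bar>" by simp
  qed
  then show ?thesis using that[OF r(1) P(1)] r W by auto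
qed

text \<open>As p is no zero of the cofactor, the cofactor has a holomorphic root e near p. With x =
  p + t^2 the product t e x is then a root of D, so t is a coordinate on the double cover at the
  branch point.\<close>

lemma sqrt_cofactor:
  assumes K: "finite K" and p: "p \<in> K"
  obtains d e where "d > 0" "ball p d \<inter> K = {p}" "e holomorphic_on ball p d"
    "\<forall>x\<in>ball p d. (e x)\<^sup>2 = monic_poly (K - {p}) x" "\<forall>x\<in>ball p d. e x \<noteq> 0"
proof -
  obtain W e where e: "trivialization (K - {p}) W e" "p \<in> W" "e holomorphic_on W"
  proof -
    have "finite (K - {p})" "p \<notin> K - {p}" using K by auto
    from trivialization_local[OF this power2_csqrt] show ?thesis using that by metis
  qed
  have W: "open W" "W \<inter> (K - {p}) = {}" using e by (auto simp: trivialization_def)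
  then obtain d where d: "d > 0" "ball p d \<subseteq> W" using e(2) open_contains_ball by blast
  have K': "finite (K - {p})" using K by simp
  show ?thesis
  proof (rule that[OF d(1)])
    show "ball p d \<inter> K = {p}" using d p W by auto
    show "e holomorphic_on ball p d" using e d holomorphic_on_subset by blast
    show "\<forall>x\<in>ball p d. (e x)\<^sup>2 = monic_poly (K - {p}) x"
      using trivializationD(2)[OF e(1)] d by auto
    show "\<forall>x\<in>ball p d. e x \<noteq> 0"
      using trivialization_nonzero[OF K' e(1)] d by auto
  qed
qed

text \<open>In u / (t e) dx the factor t of the root cancels against dx = 2 t dt. The coefficient 2
  u / e is therefore regular even at t = 0, where the section itself is not yet controlled.\<close>

lemma z2_potential_branch_chart:
  assumes K: "finite K" and f: "z2_potential K f u" and p: "p \<in> K"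
    and d: "d > 0" "ball p d \<inter> K = {p}" and e: "e holomorphic_on ball p d"
      "\<forall>x\<in>ball p d. (e x)\<^sup>2 = monic_poly (K - {p}) x" "\<forall>x\<in>ball p d. e x \<noteq> 0"
    and t: "t \<noteq> 0" "norm t < sqrt d"
  shows "has_cgrad (\<lambda>t. f (p + t\<^sup>2) (t * e (p + t\<^sup>2))) (2 * u (p + t\<^sup>2) / e (p + t\<^sup>2)) t"
proof -
  have inb: "p + t\<^sup>2 \<in> ball p d" if "norm t < sqrt d" for t
  proof -
    have "(norm t)\<^sup>2 < (sqrt d)\<^sup>2" using that by (intro power_strict_mono) auto
    then show ?thesis using d by (simp add: dist_norm norm_power)
  qed
  have sq: "(t * e (p + t\<^sup>2))\<^sup>2 = monic_poly K (p + t\<^sup>2)" if "norm t < sqrt d" for t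
    using e(2) inb[OF that] monic_poly_split[OF K p, of "p + t\<^sup>2"] by (simp add: power_mult_distrib)
  have "p + t\<^sup>2 \<noteq> p" using t by simp
  then have nK: "p + t\<^sup>2 \<notin> K" using inb[OF t(2)] d(2) by blast
  obtain W s where s: "trivialization K W s" "p + t\<^sup>2 \<in> W" "s (p + t\<^sup>2) = t * e (p + t\<^sup>2)"
    using trivialization_local[OF K nK sq[OF t(2)]] by metis
  have W: "open W" "continuous_on W s" using s by (auto simp: trivialization_def)
  define B where "B = ball 0 (sqrt d) \<inter> (\<lambda>t. p + t\<^sup>2) -` W"
  have oB: "open B" unfolding B_def
    by (intro open_Int open_ball continuous_open_vimage W) (auto intro!: continuous_intros)
  \<comment> \<open>On \<open>N\<close> the local root s and the uniformized root have nonzero sum,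
    so they coincide there.\<close>
  define N where "N = B \<inter> (\<lambda>t. s (p + t\<^sup>2) + t * e (p + t\<^sup>2)) -` (- {0})"
  have oN: "open N" unfolding N_def
  proof (rule continuous_open_preimage[OF _ oB])
    show "continuous_on B (\<lambda>t. s (p + t\<^sup>2) + t * e (p + t\<^sup>2))"
      by (intro continuous_intros continuous_on_compose2[OF W(2)]
           continuous_on_compose2[OF holomorphic_on_imp_continuous_on[OF e(1)]])
         (use inb in \<open>auto simp: B_def\<close>)
  qed auto
  have e0: "e (p + t\<^sup>2) \<noteq> 0" using e(3) inb[OF t(2)] by blast
  have tN: "t \<in> N" using t s e0 by (simp add: N_def B_def)
  have "has_cgrad (\<lambda>t. f (p + t\<^sup>2) (s (p + t\<^sup>2))) (u (p + t\<^sup>2) / s (p + t\<^sup>2) * (2 * t)) t"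
  proof (rule has_cgrad_compose[of "\<lambda>y. f y (s y)"])
    show "has_cgrad (\<lambda>y. f y (s y)) (u (p + t\<^sup>2) / s (p + t\<^sup>2)) (p + t\<^sup>2)"
      by (rule z2_potentialD(3)[OF f s(1,2)])
    show "((\<lambda>t. p + t\<^sup>2) has_field_derivative 2 * t) (at t)"
      by (auto intro!: derivative_eq_intros)
  qed
  then have "has_cgrad (\<lambda>t. f (p + t\<^sup>2) (s (p + t\<^sup>2))) (2 * u (p + t\<^sup>2) / e (p + t\<^sup>2)) t"
    using s(3) t e0 by (simp add: field_simps)
  then show ?thesis
  proof (rule has_cgrad_cong[OF _ oN tN])
    fix y assume y: "y \<in> N"
    then have "(s (p + y\<^sup>2))\<^sup>2 = (y * e (p + y\<^sup>2))\<^sup>2"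
      using trivializationD(2)[OF s(1), of "p + y\<^sup>2"] sq[of y] by (auto simp: N_def B_def)
    then have "s (p + y\<^sup>2) = y * e (p + y\<^sup>2) \<or> s (p + y\<^sup>2) = - (y * e (p + y\<^sup>2))"
      by (simp only: power2_eq_iff)
    then have "s (p + y\<^sup>2) = y * e (p + y\<^sup>2)" using y by (auto simp: N_def)
    then show "f (p + y\<^sup>2) (s (p + y\<^sup>2)) = f (p + y\<^sup>2) (y * e (p + y\<^sup>2))" by simp
  qed
qed

text \<open>In the coordinate \<open>x = p + t\<^sup>2\<close> the section is the real part of a function holomorphic at \<open>0\<close>,
  and its limit at \<open>0\<close> vanishes because the section is odd in \<open>t\<close>.\<close>

lemma z2_abs_isCont_branch:
  assumes K: "finite K" and f: "z2_potential K f u" and p: "p \<in> K"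
  shows "isCont (z2_abs K f) p"
proof -
  obtain d e where d: "d > 0" "ball p d \<inter> K = {p}" and e: "e holomorphic_on ball p d"
    "\<forall>x\<in>ball p d. (e x)\<^sup>2 = monic_poly (K - {p}) x" "\<forall>x\<in>ball p d. e x \<noteq> 0"
    using sqrt_cofactor[OF K p] .
  define B where "B = ball (0::complex) (sqrt d)"
  have inb: "p + t\<^sup>2 \<in> ball p d" if "t \<in> B" for t
  proof -
    have "(norm t)\<^sup>2 < (sqrt d)\<^sup>2" using that by (intro power_strict_mono) (auto simp: B_def)
    then show ?thesis using d by (simp add: dist_norm norm_power)
  qed
  define k where "k = (\<lambda>t. 2 * u (p + t\<^sup>2) / e (p + t\<^sup>2))"
  define \<phi> where "\<phi> = (\<lambda>t. f (p + t\<^sup>2) (t * e (p + t\<^sup>2)))"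
  have hk: "k holomorphic_on B" unfolding k_def
    by (intro holomorphic_intros holomorphic_on_compose_gen[OF _ z2_potentialD(2)[OF f, of UNIV], unfolded o_def]
          holomorphic_on_compose_gen[OF _ e(1), unfolded o_def])
       (use inb e(3) in auto)
  have T: "open (B - {0})" "connected (B - {0})"
    unfolding B_def by (auto intro: connected_punctured_ball)
  have cg: "has_cgrad \<phi> (k t) t" if "t \<in> B - {0}" for t
    unfolding \<phi>_def k_def using that
    by (intro z2_potential_branch_chart[OF K f p d e]) (auto simp: B_def)
  have oB: "open B" "convex B" by (auto simp: B_def)
  obtain P where P: "P holomorphic_on B" "\<forall>t\<in>B - {0}. \<phi> t = Re (P t)"
    using cgrad_convex_primitive[OF oB hk T Diff_subset cg] .
  have B0: "0 \<in> B" "open B" using d by (auto simp: B_def)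
  have contP: "isCont P 0"
    using P(1) B0 holomorphic_on_imp_continuous_on continuous_on_eq_continuous_at by blast
  have odd: "\<phi> (- t) = - \<phi> t" if "t \<in> B - {0}" for t
  proof -
    have "p + t\<^sup>2 \<noteq> p" using that by simp
    then have "p + t\<^sup>2 \<notin> K" using inb[of t] that d(2) by blast
    moreover have "(t * e (p + t\<^sup>2))\<^sup>2 = monic_poly K (p + t\<^sup>2)"
      using e(2) inb[of t] that monic_poly_split[OF K p, of "p + t\<^sup>2"] by (simp add: power_mult_distrib)
    ultimately show ?thesis
      using z2_functionD[OF z2_potentialD(1)[OF f], of "p + t\<^sup>2" "t * e (p + t\<^sup>2)"] by (simp add: \<phi>_def)
  qed
  have lim1: "((\<lambda>t. Re (P t) + Re (P (- t))) \<longlongrightarrow> Re (P 0) + Re (P 0)) (at 0)"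
  proof -
    have 1: "(P \<longlongrightarrow> P 0) (at 0)" using contP by (simp add: isCont_def)
    have "isCont (\<lambda>t. P (- t)) 0"
      by (rule isCont_o2[of 0 uminus P]) (use contP in auto)
    then have 2: "((\<lambda>t. P (- t)) \<longlongrightarrow> P 0) (at 0)" by (simp add: isCont_def)
    show ?thesis by (intro tendsto_intros 1 2)
  qed
  have "\<forall>\<^sub>F t in at 0. Re (P t) + Re (P (- t)) = 0"
  proof -
    have "\<forall>\<^sub>F t in at 0. t \<in> B - {0}"
      using eventually_at_in_open[OF B0(2,1)] .
    then show ?thesis
    proof eventually_elim
      case (elim t)
      then have "- t \<in> B - {0}" by (auto simp: B_def)
      then show ?case using P(2) elim odd[OF elim] by (metis add.right_inverse)
    qed
  qed
  then have "((\<lambda>t. Re (P t) + Re (P (- t))) \<longlongrightarrow> 0) (at 0)" by (rule tendsto_eventually)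
  with lim1 have P0: "Re (P 0) = 0" using tendsto_unique[of "at (0::complex)"] by fastforce
  \<comment> \<open>The jump of \<open>csqrt\<close> along its cut is harmless: the formula holds at
    each x separately, and only the limit at p is taken, where |csqrt (x - p)| = sqrt |x - p| tends
    to 0.\<close>
  have eq: "z2_abs K f x = \<bar>Re (P (csqrt (x - p)))\<bar>" if x: "x \<in> ball p d" "x \<noteq> p" for x
  proof -
    define t where "t = csqrt (x - p)"
    have t2: "p + t\<^sup>2 = x" by (simp add: t_def)
    have tB: "t \<in> B - {0}"
      using x by (simp add: t_def B_def dist_norm norm_minus_commute)
    have "x \<notin> K" using x d(2) by blast
    moreover have "(t * e x)\<^sup>2 = monic_poly K x"
      using e(2) x monic_poly_split[OF K p, of x] by (simp add: power_mult_distrib t_def)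
    ultimately have "z2_abs K f x = \<bar>f x (t * e x)\<bar>"
      using z2_abs_eq[OF z2_potentialD(1)[OF f]] by simp
    also have "f x (t * e x) = \<phi> t" by (simp add: \<phi>_def t2)
    also have "\<phi> t = Re (P t)" using P(2) tB by blast
    finally show ?thesis by (simp add: t_def)
  qed
  have "((\<lambda>x. norm (csqrt (x - p))) \<longlongrightarrow> 0) (at p)"
  proof -
    have "((\<lambda>x. sqrt (norm (x - p))) \<longlongrightarrow> sqrt (norm (p - p))) (at p)" by (intro tendsto_intros)
    then show ?thesis by simp
  qed
  then have "((\<lambda>x. csqrt (x - p)) \<longlongrightarrow> 0) (at p)" by (simp only: tendsto_norm_zero_iff)
  then have "((\<lambda>x. P (csqrt (x - p))) \<longlongrightarrow> P 0) (at p)" by (rule isCont_tendsto_compose[OF contP])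
  then have "((\<lambda>x. \<bar>Re (P (csqrt (x - p)))\<bar>) \<longlongrightarrow> \<bar>Re (P 0)\<bar>) (at p)" by (intro tendsto_intros)
  then have "(z2_abs K f \<longlongrightarrow> \<bar>Re (P 0)\<bar>) (at p)"
  proof (rule Lim_transform_eventually)
    show "\<forall>\<^sub>F x in at p. \<bar>Re (P (csqrt (x - p)))\<bar> = z2_abs K f x"
      unfolding eventually_at using d(1) eq by (intro exI[of _ d]) (auto simp: dist_commute)
  qed
  then show ?thesis using P0 p by (simp add: isCont_def z2_abs_def)
qed

lemma z2_abs_continuous:
  assumes K: "finite K" and f: "z2_potential K f u"
  shows "continuous_on UNIV (z2_abs K f)"
  unfolding continuous_on_eq_continuous_at[OF open_UNIV]
proof
  fix x
  show "isCont (z2_abs K f) x"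
  proof (cases "x \<in> K")
    case False
    then obtain r P where r: "r > 0" "P holomorphic_on ball x r" "ball x r \<inter> K = {}"
      "\<forall>y\<in>ball x r. z2_abs K f y = \<bar>Re (P y)\<bar>"
      using z2_abs_local[OF K f] by blast
    have "continuous_on (ball x r) (\<lambda>y. \<bar>Re (P y)\<bar>)"
      by (intro continuous_intros holomorphic_on_imp_continuous_on r)
    then have "continuous_on (ball x r) (z2_abs K f)"
      by (rule continuous_on_eq) (use r in auto)
    then show ?thesis using r(1) continuous_on_eq_continuous_at[OF open_ball, of x r "z2_abs K f"] centre_in_ball by blast
  qed (rule z2_abs_isCont_branch[OF K f])
qed

section \<open>Periods, the chart at infinity and the vanishing of bounded potentials\<close>

lemma Re_contour_integral_has_cgrad:
  assumes cg: "\<And>x. x \<in> path_image g \<Longrightarrow> has_cgrad f (k x) x"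
    and g: "\<And>t. t \<in> {0..1} \<Longrightarrow> (g has_vector_derivative g' t) (at t within {0..1})"
    and I: "(k has_contour_integral I) g"
  shows "Re I = f (pathfinish g) - f (pathstart g)"
proof -
  have "((\<lambda>t. Re (k (g t) * vector_derivative g (at t within {0..1}))) has_integral Re I) {0..1}"
    using I unfolding has_contour_integral_def by (rule has_integral_Re)
  moreover have "((\<lambda>t. Re (k (g t) * vector_derivative g (at t within {0..1}))) has_integral f (g 1) - f (g 0)) {0..1}"
  proof (rule fundamental_theorem_of_calculus)
    fix t :: real assume t: "t \<in> {0..1}"
    have "vector_derivative g (at t within {0..1}) = g' t"
      using g[OF t] t by (intro vector_derivative_within_closed_interval) auto
    moreover have "((\<lambda>t. f (g t)) has_derivative (\<lambda>h. Re (k (g t) * (h *\<^sub>R g' t)))) (at t within {0..1})"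
    proof (rule has_derivative_compose[OF g[OF t, unfolded has_vector_derivative_def]])
      show "(f has_derivative (\<lambda>v. Re (k (g t) * v))) (at (g t))"
        using cg[of "g t"] t by (simp add: has_cgrad_def path_image_def)
    qed
    ultimately show "((\<lambda>t. f (g t)) has_vector_derivative Re (k (g t) * vector_derivative g (at t within {0..1}))) (at t within {0..1})"
      by (simp add: has_vector_derivative_def algebra_simps)
  qed simp
  ultimately show ?thesis by (simp add: has_integral_unique pathfinish_def pathstart_def)
qed

text \<open>In the coordinate \<open>t = 1 / x\<close> the differential has at most a simple pole at \<open>0\<close>; the real part of
  its period around \<open>0\<close> vanishes, so the residue is real.\<close>

lemma z2_infinity_chart:
  assumes K: "finite K" and f: "z2_potential K f u"
    and s: "trivialization K {x. R < norm x} s"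
    and lim: "((\<lambda>x. u x / s x) \<longlongrightarrow> 0) at_infinity"
    and r: "r > 0" "\<And>t::complex. t \<noteq> 0 \<Longrightarrow> norm t < r \<Longrightarrow> R < norm (1 / t)"
  obtains n where "n holomorphic_on ball 0 r" "Im (n 0) = 0"
    "\<forall>t\<in>ball 0 r - {0}. has_cgrad (\<lambda>t. f (1 / t) (s (1 / t))) (- n t / t) t"
proof -
  \<comment> \<open>The value 0 at t = 0 is the limit of u / s at infinity; with it the singularity
    at t = 0 is removable.\<close>
  define m where "m = (\<lambda>t. if t = 0 then 0 else u (1 / t) / s (1 / t))"
  have hm: "m holomorphic_on ball 0 r"
  proof (rule no_isolated_singularity'[where K="{0}"])
    have "(\<lambda>t. u (1 / t) / s (1 / t)) holomorphic_on ball 0 r - {0}"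
    proof (intro holomorphic_on_divide)
      show "(\<lambda>t. u (1 / t)) holomorphic_on ball 0 r - {0}"
        by (rule holomorphic_on_compose_gen[OF _ z2_potentialD(2)[OF f, of UNIV], unfolded o_def])
           (auto intro!: holomorphic_intros)
      show "(\<lambda>t. s (1 / t)) holomorphic_on ball 0 r - {0}"
        by (rule holomorphic_on_compose_gen[OF _ trivialization_holomorphic[OF K s], unfolded o_def])
           (use r in \<open>auto intro!: holomorphic_intros\<close>)
      show "s (1 / t) \<noteq> 0" if "t \<in> ball 0 r - {0}" for t
        using that r by (intro trivialization_nonzero[OF K s]) auto
    qed
    then show "m holomorphic_on ball 0 r - {0}"
      by (rule holomorphic_transform) (auto simp: m_def)
    show "(m \<longlongrightarrow> m z) (at z within ball 0 r)" if "z \<in> {0}" for z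
    proof -
      have "((\<lambda>t. u (inverse t) / s (inverse t)) \<longlongrightarrow> 0) (at 0)"
        using lim unfolding lim_at_infinity_0 by (simp add: o_def)
      then have "((\<lambda>t. u (1 / t) / s (1 / t)) \<longlongrightarrow> 0) (at 0)" by (simp add: inverse_eq_divide)
      then have "(m \<longlongrightarrow> 0) (at 0)"
        by (rule Lim_transform_eventually) (auto simp: m_def eventually_at_filter)
      then show ?thesis using that r(1) by (simp add: m_def at_within_open[of 0 "ball 0 r"])
    qed
  qed auto
  \<comment> \<open>Since m vanishes at 0, n is m / t extended over 0. With dx = - dt / t^2 the
    differential becomes - n / t dt, so n 0 is minus its residue.\<close>
  define n where "n = (\<lambda>z. if z = 0 then deriv m 0 else (m z - m 0) / (z - 0))"
  have hn: "n holomorphic_on ball 0 r"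
    unfolding n_def by (rule pole_lemma_open[OF hm]) simp
  have cg: "has_cgrad (\<lambda>t. f (1 / t) (s (1 / t))) (- n t / t) t" if t: "t \<in> ball 0 r - {0}" for t
  proof -
    have "has_cgrad (\<lambda>t. f (1 / t) (s (1 / t))) (u (1 / t) / s (1 / t) * (- 1 / t\<^sup>2)) t"
    proof (rule has_cgrad_compose[of "\<lambda>y. f y (s y)" _ "\<lambda>t. 1 / t"])
      show "has_cgrad (\<lambda>y. f y (s y)) (u (1 / t) / s (1 / t)) (1 / t)"
        by (rule z2_potentialD(3)[OF f s]) (use r(2)[of t] t in auto)
      show "((\<lambda>t. 1 / t) has_field_derivative - 1 / t\<^sup>2) (at t)"
        using t by (auto intro!: derivative_eq_intros simp: power2_eq_square)
    qed
    moreover have "u (1 / t) / s (1 / t) * (- 1 / t\<^sup>2) = - n t / t"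
      using t by (simp add: n_def m_def power2_eq_square)
    ultimately show ?thesis by simp
  qed
  define q where "q = r / 2"
  have q: "q > 0" "q < r" using r by (auto simp: q_def)
  have pim: "path_image (circlepath 0 q) \<subseteq> ball 0 r - {0}"
    using q by auto
  have I1: "((\<lambda>t. n t / (t - 0)) has_contour_integral 2 * of_real pi * \<i> * n 0) (circlepath 0 q)"
  proof (rule Cauchy_integral_circlepath)
    show "continuous_on (cball 0 q) n"
      by (rule holomorphic_on_imp_continuous_on, rule holomorphic_on_subset[OF hn]) (use q in auto)
    show "n holomorphic_on ball 0 q"
      by (rule holomorphic_on_subset[OF hn]) (use q in auto)
  qed (use q in auto)
  have "((\<lambda>t. - n t / t) has_contour_integral - (2 * of_real pi * \<i> * n 0)) (circlepath 0 q)"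
    using has_contour_integral_neg[OF I1] by simp
  then have "Re (- (2 * of_real pi * \<i> * n 0)) = f (1 / pathfinish (circlepath 0 q)) (s (1 / pathfinish (circlepath 0 q)))
      - f (1 / pathstart (circlepath 0 q)) (s (1 / pathstart (circlepath 0 q)))"
  proof (rule Re_contour_integral_has_cgrad[rotated -1])
    show "has_cgrad (\<lambda>t. f (1 / t) (s (1 / t))) (- n x / x) x" if "x \<in> path_image (circlepath 0 q)" for x
      using that pim cg by blast
    show "(circlepath 0 q has_vector_derivative 2 * pi * \<i> * q * exp (2 * of_real pi * \<i> * of_real t)) (at t within {0..1})" for t
      by (rule has_vector_derivative_circlepath)
  qed
  then have "Im (n 0) = 0" by simp
  then show ?thesis using that[OF hn] cg by blast
qed

text \<open>The hypothesis continues |f| over infinity as |Re P|, so |f| attains a maximum on the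
  sphere. If it is positive, the points of the plane where it is attained form a nonempty open and
  closed set, hence the whole plane, against |f| = 0 on \<open>K\<close>.\<close>

lemma z2_bounded_at_infinity_imp_zero:
  assumes K: "finite K" "K \<noteq> {}" and f: "z2_potential K f u"
    and r: "r > 0" and P: "P holomorphic_on ball 0 r"
    and eq: "\<And>t. t \<in> ball 0 r - {0} \<Longrightarrow> z2_abs K f (1 / t) = \<bar>Re (P t)\<bar>"
  shows "z2_abs K f x = 0"
proof (rule ccontr)
  assume x: "z2_abs K f x \<noteq> 0"
  define A where "A = z2_abs K f"
  have A0: "A y \<ge> 0" for y by (simp add: A_def z2_abs_def)
  have cA: "continuous_on S A" for S
    using z2_abs_continuous[OF K(1) f] continuous_on_subset unfolding A_def by blast
  \<comment> \<open>The circle |x| = b is the circle |t| = r/2; along it the closed disc and the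
    neighbourhood of infinity meet.\<close>
  define b where "b = 2 / r"
  have b: "b > 0" using r by (simp add: b_def)
  obtain x1 where x1: "x1 \<in> cball 0 b" "\<And>y. y \<in> cball 0 b \<Longrightarrow> A y \<le> A x1"
    using continuous_attains_sup[OF compact_cball _ cA, of 0 b] b by auto
  have cP: "continuous_on (cball 0 (r/2)) (\<lambda>t. \<bar>Re (P t)\<bar>)"
    by (intro continuous_intros holomorphic_on_imp_continuous_on holomorphic_on_subset[OF P]) (use r in auto)
  obtain t1 where t1: "t1 \<in> cball 0 (r/2)" "\<And>t. t \<in> cball 0 (r/2) \<Longrightarrow> \<bar>Re (P t)\<bar> \<le> \<bar>Re (P t1)\<bar>"
    using continuous_attains_sup[OF compact_cball _ cP] r by auto
  have circ: "\<bar>Re (P t)\<bar> \<le> A x1" if "norm t = r / 2" for t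
  proof -
    have "t \<in> ball 0 r - {0}" using that r by auto
    then have "\<bar>Re (P t)\<bar> = A (1 / t)" using eq by (simp add: A_def)
    moreover have "norm (1 / t) = b" unfolding norm_divide that b_def by simp
    then have "A (1 / t) \<le> A x1" by (intro x1(2)) simp
    ultimately show ?thesis by simp
  qed
  \<comment> \<open>An interior maximum on the side of infinity forces |Re P| to be constant, and by
    continuity the constant is a value on the common circle.\<close>
  have M2: "\<bar>Re (P t1)\<bar> \<le> A x1"
  proof (cases "norm t1 = r / 2")
    case False
    then have b1: "t1 \<in> ball 0 (r/2)" using t1(1) by auto
    have const: "\<bar>Re (P t)\<bar> = \<bar>Re (P t1)\<bar>" if "t \<in> ball 0 (r/2)" for t
      by (rule abs_Re_maximum_constant[OF _ b1 that])
         (use t1 r P in \<open>auto intro: holomorphic_on_subset\<close>)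
    have "closure (ball (0::complex) (r/2)) = cball 0 (r/2)" using r by simp
    then have "\<bar>Re (P (of_real (r/2)))\<bar> = \<bar>Re (P t1)\<bar>"
      using continuous_constant_on_closure[of "ball 0 (r/2)" "\<lambda>t. \<bar>Re (P t)\<bar>" "\<bar>Re (P t1)\<bar>" "of_real (r/2)"] const cP r
      by simp
    then show ?thesis using circ[of "of_real (r/2)"] r by simp
  qed (rule circ)
  have Amax: "A y \<le> A x1" for y
  proof (cases "norm y \<le> b")
    case False
    then have y: "norm y > b" "y \<noteq> 0" using b by auto
    then have "norm (1 / y) < r / 2" using r by (simp add: norm_divide b_def field_simps)
    then have "A y = \<bar>Re (P (1 / y))\<bar>" using eq[of "1 / y"] y r by (simp add: A_def)
    also have "\<dots> \<le> \<bar>Re (P t1)\<bar>" using \<open>norm (1 / y) < r / 2\<close> by (intro t1(2)) simp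
    finally show ?thesis using M2 by simp
  qed (use x1 in auto)
  define S where "S = {y. A y = A x1}"
  have "closed S" unfolding S_def by (intro closed_Collect_eq cA continuous_on_const)
  moreover have "open S" unfolding open_contains_ball
  proof
    fix y assume y: "y \<in> S"
    have "A y > 0" using y Amax[of x] A0[of x] x by (auto simp: S_def A_def)
    then have "y \<notin> K" by (auto simp: A_def z2_abs_def)
    then obtain q Q where q: "q > 0" "Q holomorphic_on ball y q" "ball y q \<inter> K = {}"
      "\<forall>w\<in>ball y q. z2_abs K f w = \<bar>Re (Q w)\<bar>"
      using z2_abs_local[OF K(1) f] by blast
    have "ball y q \<subseteq> S"
    proof
      fix w assume w: "w \<in> ball y q"
      have yb: "y \<in> ball y q" using q by simp
      have "\<bar>Re (Q w)\<bar> = \<bar>Re (Q y)\<bar>"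
      proof (rule abs_Re_maximum_constant[OF q(2) yb w])
        fix v assume v: "v \<in> ball y q"
        show "\<bar>Re (Q v)\<bar> \<le> \<bar>Re (Q y)\<bar>"
          using bspec[OF q(4) v] bspec[OF q(4) yb] Amax[of v] y unfolding S_def A_def by simp
      qed
      then show "w \<in> S" using q(4) w yb y by (auto simp: S_def A_def)
    qed
    then show "\<exists>e>0. ball y e \<subseteq> S" using q(1) by blast
  qed
  moreover have "x1 \<in> S" by (simp add: S_def)
  ultimately have "S = UNIV" using clopen[of S] by blast
  obtain p where "p \<in> K" using K(2) by blast
  moreover have "p \<in> S" using \<open>S = UNIV\<close> by simp
  ultimately have "A x1 = 0" by (simp add: S_def A_def z2_abs_def[of K f p])
  then show False using Amax[of x] A0[of x] x by (simp add: A_def)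
qed

section \<open>Growth at infinity\<close>

text \<open>With n 0 = 0 the quotient - n t / t has no pole, so a primitive exists on the whole disc
  and no logarithm remains.\<close>

lemma Re_primitive_of_zero_residue:
  assumes n: "n holomorphic_on ball 0 r" "n 0 = 0"
    and cg: "\<forall>t\<in>ball 0 r - {0}. has_cgrad \<phi> (- n t / t) t"
  obtains P where "P holomorphic_on ball 0 r" "\<forall>t\<in>ball 0 r - {0}. \<phi> t = Re (P t)"
proof -
  define k where "k = (\<lambda>z. - (if z = 0 then deriv n 0 else (n z - n 0) / (z - 0)))"
  have hk: "k holomorphic_on ball 0 r"
    unfolding k_def by (intro holomorphic_on_minus pole_lemma_open n) simp
  have T: "open (ball (0::complex) r - {0})" "connected (ball (0::complex) r - {0})"
    by (auto intro: connected_punctured_ball)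
  have cg': "has_cgrad \<phi> (k t) t" if "t \<in> ball 0 r - {0}" for t
    using cg that n(2) by (simp add: k_def)
  obtain P where "P holomorphic_on ball 0 r" "\<forall>x\<in>ball 0 r. (P has_field_derivative k x) (at x)"
    "\<forall>t\<in>ball 0 r - {0}. \<phi> t = Re (P t)"
    using cgrad_convex_primitive[OF open_ball convex_ball hk T Diff_subset cg'] .
  then show ?thesis using that by blast
qed

lemma z2_potential_proportional:
  assumes K: "finite K" "K \<noteq> {}"
    and f: "z2_potential K f u" and G: "z2_potential K G v"
    and s: "trivialization K {x. R < norm x} s"
    and lim_f: "((\<lambda>x. u x / s x) \<longlongrightarrow> 0) at_infinity"
    and lim_G: "((\<lambda>x. v x / s x) \<longlongrightarrow> 0) at_infinity"
    and G_top: "filterlim (\<lambda>x. G x (s x)) at_top at_infinity"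
  shows "z2_real_multiple K f G"
proof -
  \<comment> \<open>The maximum with 1 keeps the radius positive and finite for every real
    R.\<close>
  define r where "r = 1 / max R 1"
  have r: "r > 0" by (simp add: r_def)
  have big: "R < norm (1 / t)" if "t \<noteq> 0" "norm t < r" for t :: complex
  proof -
    have "M < 1 / norm t" if "norm t < 1 / M" "M > 0" for M :: real
      using that \<open>t \<noteq> 0\<close> by (simp add: field_simps)
    from this[of "max R 1"] have "max R 1 < 1 / norm t" using \<open>norm t < r\<close> by (simp add: r_def)
    then show ?thesis by (simp add: norm_divide)
  qed
  obtain n where n: "n holomorphic_on ball 0 r" "Im (n 0) = 0"
    "\<forall>t\<in>ball 0 r - {0}. has_cgrad (\<lambda>t. f (1 / t) (s (1 / t))) (- n t / t) t"
    using z2_infinity_chart[OF K(1) f s lim_f r big] .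
  obtain m where m: "m holomorphic_on ball 0 r" "Im (m 0) = 0"
    "\<forall>t\<in>ball 0 r - {0}. has_cgrad (\<lambda>t. G (1 / t) (s (1 / t))) (- m t / t) t"
    using z2_infinity_chart[OF K(1) G s lim_G r big] .
  have m0: "m 0 \<noteq> 0"
  proof
    assume "m 0 = 0"
    then obtain P where P: "P holomorphic_on ball 0 r" "\<forall>t\<in>ball 0 r - {0}. G (1 / t) (s (1 / t)) = Re (P t)"
      using Re_primitive_of_zero_residue[OF m(1) _ m(3)] by metis
    have "isCont P 0"
      using P(1) r holomorphic_on_imp_continuous_on continuous_on_eq_continuous_at centre_in_ball open_ball by blast
    then have "((\<lambda>t. Re (P t)) \<longlongrightarrow> Re (P 0)) (at 0)" by (intro tendsto_intros) (simp add: isCont_def)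
    then have 1: "((\<lambda>t. G (1 / t) (s (1 / t))) \<longlongrightarrow> Re (P 0)) (at 0)"
    proof (rule Lim_transform_eventually)
      show "\<forall>\<^sub>F t in at 0. Re (P t) = G (1 / t) (s (1 / t))"
        unfolding eventually_at using r P(2) by (intro exI[of _ r]) auto
    qed
    have "filterlim (\<lambda>t. G (inverse t) (s (inverse t))) at_top (at 0)"
      by (rule filterlim_compose[OF G_top filterlim_inverse_at_infinity])
    then have 2: "filterlim (\<lambda>t. G (1 / t) (s (1 / t))) at_infinity (at 0)"
      by (simp add: inverse_eq_divide filterlim_at_top_imp_at_infinity)
    show False using not_tendsto_and_filterlim_at_infinity[OF _ 1 2] by simp
  qed
  \<comment> \<open>Both residues are real and that of G is nonzero, so a real c cancels the residue
    of f.\<close>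
  define c where "c = Re (n 0) / Re (m 0)"
  have Rm: "Re (m 0) \<noteq> 0" using m0 m(2) by (simp add: complex_eq_iff)
  define g where "g = (\<lambda>x w. f x w - c * G x w)"
  have g: "z2_potential K g (\<lambda>x. u x - of_real c * v x)"
    unfolding g_def by (rule z2_potential_linear[OF f G])
  define l where "l = (\<lambda>t. n t - of_real c * m t)"
  have l: "l holomorphic_on ball 0 r" "l 0 = 0"
    unfolding l_def using Rm n(2) m(2)
    by (auto intro!: holomorphic_intros n m simp: c_def complex_eq_iff)
  have "\<forall>t\<in>ball 0 r - {0}. has_cgrad (\<lambda>t. g (1 / t) (s (1 / t))) (- l t / t) t"
  proof
    fix t :: complex assume t: "t \<in> ball 0 r - {0}"
    have "has_cgrad (\<lambda>t. f (1 / t) (s (1 / t)) - c * G (1 / t) (s (1 / t))) (- n t / t - of_real c * (- m t / t)) t"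
      by (intro has_cgrad_diff has_cgrad_cmult) (use n m t in auto)
    moreover have "- n t / t - of_real c * (- m t / t) = - l t / t"
      by (simp add: l_def diff_divide_distrib)
    ultimately show "has_cgrad (\<lambda>t. g (1 / t) (s (1 / t))) (- l t / t) t" by (simp add: g_def)
  qed
  then obtain P where P: "P holomorphic_on ball 0 r" "\<forall>t\<in>ball 0 r - {0}. g (1 / t) (s (1 / t)) = Re (P t)"
    using Re_primitive_of_zero_residue[OF l] by blast
  have "z2_abs K g (1 / t) = \<bar>Re (P t)\<bar>" if t: "t \<in> ball 0 r - {0}" for t
  proof -
    have "1 / t \<in> {x. R < norm x}" using big[of t] t by simp
    from z2_abs_eq[OF z2_potentialD(1)[OF g] trivializationD[OF s this]] P(2) t
    show ?thesis by simp
  qed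
  then have zero: "z2_abs K g x = 0" for x
    by (rule z2_bounded_at_infinity_imp_zero[OF K g r P(1)])
  have "f x w = c * G x w" if "x \<notin> K" "w\<^sup>2 = monic_poly K x" for x w
    using z2_abs_eq[OF z2_potentialD(1)[OF g] that] zero[of x] by (simp add: g_def)
  then show ?thesis unfolding z2_real_multiple_def by blast
qed

text \<open>On the ball of radius |x|/2 about x the function is o(|x|). Adding a constant of that
  order makes it positive, and the derivative estimate for positive real parts divides by the
  radius.\<close>

lemma z2_gradient_decay:
  assumes K: "finite K" and f: "z2_potential K f u"
    and s: "trivialization K {x. R < norm x} s"
    and small: "(\<lambda>x. f x (s x)) \<in> o[at_infinity](\<lambda>x. norm x)"
  shows "((\<lambda>x. u x / s x) \<longlongrightarrow> 0) at_infinity"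
proof (rule tendstoI)
  fix e :: real assume e: "e > 0"
  \<comment> \<open>Below, |f| < M = 4 c q on the ball of radius q, so the derivative is at most 2 *
    2 M / q = 16 c = e / 2.\<close>
  define c where "c = e / 32"
  have c: "c > 0" using e by (simp add: c_def)
  have "\<forall>\<^sub>F x in at_infinity. norm (f x (s x)) \<le> c * norm (norm x)"
    using landau_o.smallD[OF small c] .
  then obtain b where b: "\<And>x. norm x \<ge> b \<Longrightarrow> \<bar>f x (s x)\<bar> \<le> c * norm x"
    unfolding eventually_at_infinity by auto
  show "\<forall>\<^sub>F x in at_infinity. dist (u x / s x) 0 < e"
    unfolding eventually_at_infinity
  proof (intro exI[of _ "2 * \<bar>b\<bar> + 2 * \<bar>R\<bar> + 1"] allI impI)
    fix x :: complex assume x: "2 * \<bar>b\<bar> + 2 * \<bar>R\<bar> + 1 \<le> norm x"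
    define q where "q = norm x / 2"
    have "norm x > 0" using x by linarith
    then have q: "q > 0" by (simp add: q_def)
    have inb: "norm y \<ge> b" "norm y > R" "norm y \<le> 3 * q" if "y \<in> ball x q" for y
    proof -
      have "norm (x - y) < q" using that by (simp add: dist_norm)
      moreover have "norm x \<le> norm (x - y) + norm y" using norm_triangle_ineq[of "x - y" y] by simp
      moreover have "norm y \<le> norm x + norm (x - y)"
        using norm_triangle_ineq4[of x "x - y"] by simp
      ultimately show "norm y \<ge> b" "norm y > R" "norm y \<le> 3 * q"
        using x by (auto simp: q_def)
    qed
    have "ball x q \<subseteq> {x. R < norm x}" using inb(2) by auto
    then have s': "trivialization K (ball x q) s" by (intro trivialization_subset[OF s] open_ball)
    have k: "(\<lambda>y. u y / s y) holomorphic_on ball x q"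
      using trivialization_nonzero[OF K s']
      by (intro holomorphic_on_divide z2_potentialD(2)[OF f] trivialization_holomorphic[OF K s']) auto
    have cg: "has_cgrad (\<lambda>y. f y (s y)) (u y / s y) y" if "y \<in> ball x q" for y
      using z2_potentialD(3)[OF f s' that] .
    obtain P where P: "P holomorphic_on ball x q" "\<forall>y\<in>ball x q. (P has_field_derivative u y / s y) (at y)"
      "\<forall>y\<in>ball x q. f y (s y) = Re (P y)"
      using cgrad_convex_primitive[OF open_ball convex_ball k open_ball connected_ball order_refl cg] .
    define M where "M = 4 * c * q"
    have M: "M > 0" using c q by (simp add: M_def)
    have fb: "\<bar>f y (s y)\<bar> < M" if "y \<in> ball x q" for y
    proof -
      have "\<bar>f y (s y)\<bar> \<le> c * norm y" by (rule b[OF inb(1)[OF that]])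
      also have "\<dots> \<le> c * (3 * q)" using inb(3)[OF that] c by (intro mult_left_mono) auto
      also have "\<dots> < M" using c q by (simp add: M_def)
      finally show ?thesis .
    qed
    have xb: "x \<in> ball x q" using q by simp
    have "norm (u x / s x) \<le> 2 * Re (P x + of_real M) / q"
    proof (rule Harnack_Schwarz(1)[of "\<lambda>y. P y + of_real M", OF _ q])
      show "(\<lambda>y. P y + of_real M) holomorphic_on ball x q" by (intro holomorphic_intros P)
      show "Re (P y + of_real M) > 0" if "y \<in> ball x q" for y
        using fb[OF that] P(3) that by auto
      show "((\<lambda>y. P y + of_real M) has_field_derivative u x / s x) (at x)"
        using P(2) xb by (auto intro!: derivative_eq_intros)
    qed
    also have "\<dots> \<le> 2 * (2 * M) / q"
      using fb[OF xb] P(3) xb q by (intro divide_right_mono) auto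
    also have "\<dots> = e / 2" using q by (simp add: M_def c_def)
    finally show "dist (u x / s x) 0 < e" using e by simp
  qed
qed

text \<open>Pull back by \<open>exp\<close> to a half plane and compare two points on a horizontal line by Harnack's
  inequality: the growth is at most logarithmic.\<close>

lemma z2_positive_imp_sublinear:
  assumes K: "finite K" and f: "z2_potential K f u"
    and s: "trivialization K {x. R < norm x} s"
    and R: "R > 0" and pos: "\<And>x. norm x > R \<Longrightarrow> f x (s x) > 0"
  shows "(\<lambda>x. f x (s x)) \<in> o[at_infinity](\<lambda>x. norm x)"
proof -
  define L where "L = ln R"
  define H where "H = {\<zeta>. Re \<zeta> > L}"
  have H: "open H" "convex H"
    unfolding H_def by (auto intro: open_halfspace_Re_gt convex_halfspace_Re_gt)
  have expH: "norm (exp \<zeta>) > R" if "\<zeta> \<in> H" for \<zeta>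
  proof -
    have "exp L < exp (Re \<zeta>)" using that by (simp add: H_def)
    then show ?thesis using R by (simp add: L_def)
  qed
  define k where "k = (\<lambda>\<zeta>. u (exp \<zeta>) / s (exp \<zeta>) * exp \<zeta>)"
  have hk: "k holomorphic_on H"
    unfolding k_def
  proof (intro holomorphic_on_mult holomorphic_on_divide)
    show "(\<lambda>\<zeta>. u (exp \<zeta>)) holomorphic_on H"
      by (rule holomorphic_on_compose_gen[OF _ z2_potentialD(2)[OF f, of UNIV], unfolded o_def])
         (auto intro!: holomorphic_intros)
    show "(\<lambda>\<zeta>. s (exp \<zeta>)) holomorphic_on H"
      by (rule holomorphic_on_compose_gen[OF _ trivialization_holomorphic[OF K s], unfolded o_def])
         (use expH in \<open>auto intro!: holomorphic_intros\<close>)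
    show "s (exp \<zeta>) \<noteq> 0" if "\<zeta> \<in> H" for \<zeta>
      using expH[OF that] by (intro trivialization_nonzero[OF K s]) auto
  qed (rule holomorphic_on_exp)
  have cg: "has_cgrad (\<lambda>\<zeta>. f (exp \<zeta>) (s (exp \<zeta>))) (k \<zeta>) \<zeta>" if "\<zeta> \<in> H" for \<zeta>
    unfolding k_def
  proof (rule has_cgrad_compose[of "\<lambda>y. f y (s y)"])
    show "has_cgrad (\<lambda>y. f y (s y)) (u (exp \<zeta>) / s (exp \<zeta>)) (exp \<zeta>)"
      by (rule z2_potentialD(3)[OF f s]) (use expH[OF that] in auto)
  qed (rule DERIV_exp)
  obtain P where P: "P holomorphic_on H" "\<forall>\<zeta>\<in>H. (P has_field_derivative k \<zeta>) (at \<zeta>)"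
    "\<forall>\<zeta>\<in>H. f (exp \<zeta>) (s (exp \<zeta>)) = Re (P \<zeta>)"
    using cgrad_convex_primitive[OF H hk H(1) convex_connected[OF H(2)] order_refl cg] .
  define b where "b = exp (L + 1)"
  have b: "b > R" using R by (simp add: b_def exp_add L_def)
  have "continuous_on (sphere 0 b) (\<lambda>x. f x (s x))"
  proof (intro continuous_at_imp_continuous_on ballI has_cgrad_continuous)
    fix x assume "x \<in> sphere (0::complex) b"
    then show "has_cgrad (\<lambda>x. f x (s x)) (u x / s x) x"
      using b by (intro z2_potentialD(3)[OF f s]) auto
  qed
  then have "bounded ((\<lambda>x. f x (s x)) ` sphere 0 b)"
    by (intro compact_imp_bounded compact_continuous_image) auto
  then obtain M where M: "M > 0" "\<And>x. x \<in> sphere 0 b \<Longrightarrow> norm (f x (s x)) \<le> M"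
    unfolding bounded_pos by blast
  have bound: "norm (f x (s x)) \<le> 2 * M * (ln (norm x) - L)" if x: "norm x > b" for x
  proof -
    have x0: "x \<noteq> 0" using x b R by auto
    define \<zeta> where "\<zeta> = Ln x"
    have e: "exp \<zeta> = x" using x0 by (simp add: \<zeta>_def)
    have Re\<zeta>: "Re \<zeta> = ln (norm x)" using x0 by (simp add: \<zeta>_def)
    have "ln b < ln (norm x)" using x b R by (intro ln_less_cancel_iff[THEN iffD2]) auto
    then have gt: "Re \<zeta> > L + 1" by (simp add: Re\<zeta> b_def)
    \<comment> \<open>The comparison point has the same imaginary part and lies over the fixed
      circle of radius b, where f is bounded by M. With q the distance of \<zeta> from the edge of
      the half plane, the two points are q - 1 apart; the factor q - (q - 1) = 1 leaves the bound M
      (2 q - 1), linear in ln |x|.\<close>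
    define \<omega> where "\<omega> = Complex (L + 1) (Im \<zeta>)"
    define q where "q = Re \<zeta> - L"
    have q: "q > 1" using gt by (simp add: q_def)
    have bH: "ball \<zeta> q \<subseteq> H"
    proof
      fix y assume "y \<in> ball \<zeta> q"
      then have "norm (\<zeta> - y) < q" by (simp add: dist_norm)
      then have "Re \<zeta> - Re y < q" using complex_Re_le_cmod[of "\<zeta> - y"] by simp
      then show "y \<in> H" by (simp add: H_def q_def)
    qed
    have d: "dist \<zeta> \<omega> = q - 1"
    proof -
      have "\<zeta> - \<omega> = of_real (q - 1)" by (simp add: \<omega>_def q_def complex_eq_iff)
      then show ?thesis using q by (simp add: dist_norm del: of_real_diff)
    qed
    have "Re (P \<zeta>) * (q - dist \<zeta> \<omega>) \<le> Re (P \<omega>) * (q + dist \<zeta> \<omega>)"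
    proof (rule Harnack_Schwarz(2))
      show "P holomorphic_on ball \<zeta> q" using P(1) bH holomorphic_on_subset by blast
      show "Re (P y) > 0" if "y \<in> ball \<zeta> q" for y
      proof -
        have "y \<in> H" using that bH by blast
        then show ?thesis using pos[OF expH[of y]] P(3) by auto
      qed
    qed (use q d in auto)
    then have 1: "Re (P \<zeta>) \<le> Re (P \<omega>) * (2 * q - 1)" by (simp add: d)
    have \<omega>H: "\<omega> \<in> H" by (simp add: H_def \<omega>_def)
    have "Re (P \<omega>) = f (exp \<omega>) (s (exp \<omega>))" using P(3) \<omega>H by simp
    moreover have "exp \<omega> \<in> sphere 0 b" by (simp add: \<omega>_def b_def)
    ultimately have "Re (P \<omega>) \<le> M" using M(2)[of "exp \<omega>"] by simp
    then have "Re (P \<omega>) * (2 * q - 1) \<le> M * (2 * q - 1)" using q by (intro mult_right_mono) auto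
    also have "\<dots> \<le> M * (2 * q)" using M by (intro mult_left_mono) auto
    finally have "Re (P \<zeta>) \<le> 2 * M * q" using 1 by simp
    moreover have "\<zeta> \<in> H" using gt by (simp add: H_def)
    ultimately have "f x (s x) \<le> 2 * M * q" using P(3) e by auto
    then show ?thesis using pos[of x] x b by (simp add: q_def Re\<zeta>)
  qed
  have lim: "((\<lambda>x::complex. 2 * M * (ln (norm x) / norm x) - 2 * M * L / norm x) \<longlongrightarrow> 2 * M * 0 - 0) at_infinity"
  proof (intro tendsto_intros)
    show "((\<lambda>x::complex. ln (norm x) / norm x) \<longlongrightarrow> 0) at_infinity"
      by (rule filterlim_compose[OF ln_x_over_x_tendsto_0 filterlim_norm_at_top])
    show "((\<lambda>x::complex. 2 * M * L / norm x) \<longlongrightarrow> 0) at_infinity"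
      by (rule tendsto_divide_0[OF tendsto_const])
         (rule filterlim_at_top_imp_at_infinity[OF filterlim_norm_at_top])
  qed
  have "((\<lambda>x. f x (s x) / norm x) \<longlongrightarrow> 0) at_infinity"
  proof (rule Lim_null_comparison)
    show "((\<lambda>x::complex. 2 * M * (ln (norm x) / norm x) - 2 * M * L / norm x) \<longlongrightarrow> 0) at_infinity"
      using lim by simp
    show "\<forall>\<^sub>F x in at_infinity. norm (f x (s x) / norm x) \<le> 2 * M * (ln (norm x) / norm x) - 2 * M * L / norm x"
      unfolding eventually_at_infinity
    proof (intro exI[of _ "b + 1"] allI impI)
      fix x :: complex assume "b + 1 \<le> norm x"
      then have x: "norm x > b" "norm x > 0" using b R by auto
      have "norm (f x (s x)) / norm x \<le> 2 * M * (ln (norm x) - L) / norm x"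
        using bound[OF x(1)] x(2) by (intro divide_right_mono) auto
      then show "norm (f x (s x) / norm x) \<le> 2 * M * (ln (norm x) / norm x) - 2 * M * L / norm x"
        by (simp add: diff_divide_distrib algebra_simps)
    qed
  qed
  moreover have "\<forall>\<^sub>F x::complex in at_infinity. norm x \<noteq> 0"
    unfolding eventually_at_infinity by (intro exI[of _ 1]) auto
  ultimately show ?thesis by (intro smalloI_tendsto) auto
qed

section \<open>Lifted paths\<close>

text \<open>A primitive of the integrand along a lifted path. The lifted integral is a gauge integral, so a
  primitive which is continuous at the end points computes it even if the integrand is unbounded there.\<close>

definition lifted_primitive ::
    "(complex \<Rightarrow> complex) \<Rightarrow> (real \<Rightarrow> complex) \<Rightarrow> (real \<Rightarrow> complex) \<Rightarrow> (real \<Rightarrow> complex) \<Rightarrow> bool" where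
  "lifted_primitive u g r \<Phi> \<longleftrightarrow> continuous_on {0..1} \<Phi> \<and>
     (\<exists>S. finite S \<and> (\<forall>t\<in>{0<..<1} - S. \<exists>g'. (g has_vector_derivative g') (at t) \<and>
        (\<Phi> has_vector_derivative u (g t) / r t * g') (at t)))"

lemma lifted_integral_eq_primitive:
  assumes "lifted_primitive u g r \<Phi>"
  shows "lifted_integral u g r = \<Phi> 1 - \<Phi> 0"
proof -
  obtain S where S: "finite S" and c: "continuous_on {0..1} \<Phi>"
    and d: "\<And>t. t \<in> {0<..<1} - S \<Longrightarrow> \<exists>g'. (g has_vector_derivative g') (at t) \<and> (\<Phi> has_vector_derivative u (g t) / r t * g') (at t)"
    using assms unfolding lifted_primitive_def by metis
  have "((\<lambda>t. u (g t) / r t * vector_derivative g (at t within {0..1})) has_integral (\<Phi> 1 - \<Phi> 0)) {0..1}"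
  proof (rule fundamental_theorem_of_calculus_interior_strong[OF S _ _ c])
    fix t assume t: "t \<in> {0<..<1} - S"
    then obtain g' where g': "(g has_vector_derivative g') (at t)" "(\<Phi> has_vector_derivative u (g t) / r t * g') (at t)"
      using d by blast
    have "vector_derivative g (at t within {0..1}) = g'"
      using g'(1) t by (intro vector_derivative_at_within_ivl) auto
    then show "(\<Phi> has_vector_derivative u (g t) / r t * vector_derivative g (at t within {0..1})) (at t)"
      using g'(2) by simp
  qed simp
  then show ?thesis unfolding lifted_integral_def by (rule integral_unique)
qed

lemma lifted_path_uminus: "lifted_path K p q g r \<Longrightarrow> lifted_path K p q g (\<lambda>t. - r t)"
  unfolding lifted_path_def by (auto intro!: continuous_intros)

lemma lifted_primitive_uminus:
  assumes "lifted_primitive u g r \<Phi>" shows "lifted_primitive u g (\<lambda>t. - r t) (\<lambda>t. - \<Phi> t)"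
proof -
  obtain S where S: "finite S" and c: "continuous_on {0..1} \<Phi>"
    and d: "\<forall>t\<in>{0<..<1} - S. \<exists>g'. (g has_vector_derivative g') (at t) \<and> (\<Phi> has_vector_derivative u (g t) / r t * g') (at t)"
    using assms unfolding lifted_primitive_def by metis
  have "\<exists>g'. (g has_vector_derivative g') (at t) \<and> ((\<lambda>t. - \<Phi> t) has_vector_derivative u (g t) / - r t * g') (at t)"
    if "t \<in> {0<..<1} - S" for t
  proof -
    obtain g' where g': "(g has_vector_derivative g') (at t)" "(\<Phi> has_vector_derivative u (g t) / r t * g') (at t)"
      using d \<open>t \<in> _\<close> by blast
    then show ?thesis using has_vector_derivative_minus[OF g'(2)] by auto
  qed
  then show ?thesis unfolding lifted_primitive_def using S c by (auto intro!: continuous_intros)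
qed

lemma lifted_path_reverse:
  assumes "lifted_path K p q g r" shows "lifted_path K q p (reversepath g) (reversepath r)"
proof -
  have "path r" using assms by (simp add: lifted_path_def path_def)
  then have "path (reversepath r)" by simp
  moreover have "reversepath g ` {0<..<1} \<subseteq> g ` {0<..<1}"
  proof clarify
    fix t :: real assume "t \<in> {0<..<1}"
    then show "reversepath g t \<in> g ` {0<..<1}" by (intro image_eqI[of _ _ "1 - t"]) (auto simp: reversepath_def)
  qed
  moreover have "(reversepath r t)\<^sup>2 = monic_poly K (reversepath g t)" if "t \<in> {0..1}" for t
    using assms that by (auto simp: lifted_path_def reversepath_def)
  ultimately show ?thesis using assms unfolding lifted_path_def path_def by auto
qed

lemma lifted_primitive_reverse:
  assumes "lifted_primitive u g r \<Phi>"
  shows "lifted_primitive u (reversepath g) (reversepath r) (reversepath \<Phi>)"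
proof -
  obtain S where S: "finite S" and c: "continuous_on {0..1} \<Phi>"
    and d: "\<forall>t\<in>{0<..<1} - S. \<exists>g'. (g has_vector_derivative g') (at t) \<and> (\<Phi> has_vector_derivative u (g t) / r t * g') (at t)"
    using assms unfolding lifted_primitive_def by metis
  have rev: "(reversepath h has_vector_derivative - h') (at t)"
    if "(h has_vector_derivative h') (at (1 - t))" for h :: "real \<Rightarrow> complex" and h' t
  proof -
    have "((\<lambda>t. 1 - t) has_vector_derivative - 1) (at t)"
      by (auto intro!: derivative_eq_intros)
    from vector_diff_chain_at[OF this that] show ?thesis by (simp add: reversepath_def o_def)
  qed
  have "\<exists>g'. (reversepath g has_vector_derivative g') (at t) \<and>
      (reversepath \<Phi> has_vector_derivative u (reversepath g t) / reversepath r t * g') (at t)"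
    if "t \<in> {0<..<1} - (\<lambda>t. 1 - t) ` S" for t
  proof -
    have "1 - t \<in> {0<..<1} - S" using that by force
    then obtain g' where g': "(g has_vector_derivative g') (at (1 - t))"
       "(\<Phi> has_vector_derivative u (g (1 - t)) / r (1 - t) * g') (at (1 - t))"
      using d by blast
    from rev[OF g'(1)] rev[OF g'(2)] show ?thesis by (auto simp: reversepath_def)
  qed
  moreover have "continuous_on {0..1} (reversepath \<Phi>)"
    using path_reversepath[of \<Phi>] c by (simp add: path_def)
  ultimately show ?thesis unfolding lifted_primitive_def using S by blast
qed

lemma lifted_path_join:
  assumes 1: "lifted_path K p x g1 r1" and 2: "lifted_path K x q g2 r2"
    and x: "x \<notin> K" and r: "r1 1 = r2 0"
  shows "lifted_path K p q (g1 +++ g2) (r1 +++ r2)"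
  unfolding lifted_path_def
proof (intro conjI)
  show "valid_path (g1 +++ g2)"
    using 1 2 by (intro valid_path_join) (auto simp: lifted_path_def)
  show "pathstart (g1 +++ g2) = p" "pathfinish (g1 +++ g2) = q"
    using 1 2 by (auto simp: lifted_path_def)
  show "(g1 +++ g2) ` {0<..<1} \<inter> K = {}"
  proof -
    have a: "g1 s \<notin> K" "g2 s \<notin> K" if "s \<in> {0<..<1}" for s
      using 1 2 that unfolding lifted_path_def by blast+
    have "(g1 +++ g2) t \<notin> K" if t: "0 < t" "t < 1" for t
    proof -
      consider "t < 1/2" | "t = 1/2" | "t > 1/2" by linarith
      then show ?thesis
      proof cases
        case 1
        then have "2 * t \<in> {0<..<1}" using t by simp
        then show ?thesis using a(1)[of "2 * t"] 1 by (simp add: joinpaths_def)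
      next
        case 2
        have "g1 1 = x" using assms(1) by (simp add: lifted_path_def pathfinish_def)
        then show ?thesis using x by (simp add: 2 joinpaths_def)
      next
        case 3
        then have "2 * t - 1 \<in> {0<..<1}" using t by simp
        then show ?thesis using a(2)[of "2 * t - 1"] 3 by (simp add: joinpaths_def)
      qed
    qed
    then show ?thesis by auto
  qed
  have "path (r1 +++ r2)"
    using 1 2 r by (intro path_join_imp) (auto simp: lifted_path_def path_def pathstart_def pathfinish_def)
  then show "continuous_on {0..1} (r1 +++ r2)" by (simp add: path_def)
  show "\<forall>t\<in>{0..1}. ((r1 +++ r2) t)\<^sup>2 = monic_poly K ((g1 +++ g2) t)"
    using 1 2 by (auto simp: lifted_path_def joinpaths_def)
qed

text \<open>The added constant makes the two primitives agree at the junction. The junction time 1/2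
  may carry a corner and joins the exceptional set.\<close>

lemma lifted_primitive_join:
  assumes 1: "lifted_primitive u g1 r1 \<Phi>1" and 2: "lifted_primitive u g2 r2 \<Phi>2"
  shows "lifted_primitive u (g1 +++ g2) (r1 +++ r2) (\<Phi>1 +++ (\<lambda>t. \<Phi>2 t + (\<Phi>1 1 - \<Phi>2 0)))"
proof -
  define \<Psi> where "\<Psi> = (\<lambda>t. \<Phi>2 t + (\<Phi>1 1 - \<Phi>2 0))"
  obtain S where S: "finite S" and c: "continuous_on {0..1} \<Phi>1"
    and d: "\<forall>t\<in>{0<..<1} - S. \<exists>g'. (g1 has_vector_derivative g') (at t) \<and> (\<Phi>1 has_vector_derivative u (g1 t) / r1 t * g') (at t)"
    using 1 unfolding lifted_primitive_def by metis
  obtain T where T: "finite T" and c2: "continuous_on {0..1} \<Phi>2"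
    and d2: "\<forall>t\<in>{0<..<1} - T. \<exists>g'. (g2 has_vector_derivative g') (at t) \<and> (\<Phi>2 has_vector_derivative u (g2 t) / r2 t * g') (at t)"
    using 2 unfolding lifted_primitive_def by metis
  have left: "(h1 +++ h2 has_vector_derivative 2 * h') (at t)"
    if "(h1 has_vector_derivative h') (at (2 * t))" "t < 1/2" for h1 h2 :: "real \<Rightarrow> complex" and h' t
  proof -
    have "((\<lambda>t. 2 * t) has_vector_derivative 2) (at t)"
      by (auto intro!: derivative_eq_intros)
    from vector_diff_chain_at[OF this that(1)]
    have "(h1 \<circ> (\<lambda>t. 2 * t) has_vector_derivative 2 * h') (at t)" by (simp add: scaleR_conv_of_real)
    then show ?thesis
      by (rule has_vector_derivative_transform_within_open[of _ _ _ "{..<1/2}"])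
         (use that in \<open>auto simp: joinpaths_def\<close>)
  qed
  have right: "(h1 +++ h2 has_vector_derivative 2 * h') (at t)"
    if "(h2 has_vector_derivative h') (at (2 * t - 1))" "t > 1/2" for h1 h2 :: "real \<Rightarrow> complex" and h' t
  proof -
    have "((\<lambda>t. 2 * t - 1) has_vector_derivative 2) (at t)"
      by (auto intro!: derivative_eq_intros)
    from vector_diff_chain_at[OF this that(1)]
    have "(h2 \<circ> (\<lambda>t. 2 * t - 1) has_vector_derivative 2 * h') (at t)" by (simp add: scaleR_conv_of_real)
    then show ?thesis
      by (rule has_vector_derivative_transform_within_open[of _ _ _ "{1/2<..}"])
         (use that in \<open>auto simp: joinpaths_def\<close>)
  qed
  define N where "N = insert (1/2) ((\<lambda>t. t / 2) ` S \<union> (\<lambda>t. (t + 1) / 2) ` T)"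
  have "finite N" using S T by (simp add: N_def)
  moreover have "\<exists>g'. (g1 +++ g2 has_vector_derivative g') (at t) \<and>
      (\<Phi>1 +++ \<Psi> has_vector_derivative u ((g1 +++ g2) t) / (r1 +++ r2) t * g') (at t)"
    if t: "t \<in> {0<..<1} - N" for t
  proof (cases "t < 1/2")
    case True
    have "2 * t \<notin> S"
    proof
      assume "2 * t \<in> S"
      then have "(2 * t) / 2 \<in> N" unfolding N_def by blast
      then show False using t by simp
    qed
    then have "2 * t \<in> {0<..<1} - S" using t True by auto
    then obtain g' where g': "(g1 has_vector_derivative g') (at (2 * t))"
      "(\<Phi>1 has_vector_derivative u (g1 (2 * t)) / r1 (2 * t) * g') (at (2 * t))"
      using d by blast
    from left[OF g'(1) True, of g2] left[OF g'(2) True, of \<Psi>] True show ?thesis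
      by (intro exI[of _ "2 * g'"]) (simp add: joinpaths_def mult.left_commute)
  next
    case False
    then have t2: "t > 1/2" using t by (auto simp: N_def)
    have "2 * t - 1 \<notin> T"
    proof
      assume "2 * t - 1 \<in> T"
      then have "((2 * t - 1) + 1) / 2 \<in> N" unfolding N_def by blast
      then show False using t by simp
    qed
    then have "2 * t - 1 \<in> {0<..<1} - T" using t t2 by auto
    then obtain g' where g': "(g2 has_vector_derivative g') (at (2 * t - 1))"
      "(\<Phi>2 has_vector_derivative u (g2 (2 * t - 1)) / r2 (2 * t - 1) * g') (at (2 * t - 1))"
      using d2 by blast
    have "(\<Psi> has_vector_derivative u (g2 (2 * t - 1)) / r2 (2 * t - 1) * g') (at (2 * t - 1))"
      unfolding \<Psi>_def using g'(2) by (simp add: has_vector_derivative_add_const)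
    from right[OF g'(1) t2, of g1] right[OF this t2, of \<Phi>1] t2 show ?thesis
      by (intro exI[of _ "2 * g'"]) (simp add: joinpaths_def mult.left_commute)
  qed
  moreover have "continuous_on {0..1} (\<Phi>1 +++ \<Psi>)"
  proof -
    have "path (\<Phi>1 +++ \<Psi>)"
      by (intro path_join_imp) (use c c2 in \<open>auto simp: path_def \<Psi>_def pathstart_def pathfinish_def intro!: continuous_intros\<close>)
    then show ?thesis by (simp add: path_def)
  qed
  ultimately show ?thesis unfolding lifted_primitive_def \<Psi>_def by blast
qed

text \<open>The path p + (t a)^2 leaves the branch point quadratically: in the coordinate t the
  singular factor 1 / r cancels against the derivative of the path, so the primitive is holomorphic
  in t a.\<close>

lemma lifted_path_branch_start:
  assumes K: "finite K" and p: "p \<in> K" and u: "u holomorphic_on UNIV"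
  obtains y g r \<Phi> where "y \<notin> K" "lifted_path K p y g r" "lifted_primitive u g r \<Phi>"
proof -
  obtain d e where d: "d > 0" "ball p d \<inter> K = {p}" and e: "e holomorphic_on ball p d"
    "\<forall>x\<in>ball p d. (e x)\<^sup>2 = monic_poly (K - {p}) x" "\<forall>x\<in>ball p d. e x \<noteq> 0"
    using sqrt_cofactor[OF K p] .
  define B where "B = ball (0::complex) (sqrt d)"
  have inb: "p + t\<^sup>2 \<in> ball p d" if "t \<in> B" for t
  proof -
    have "(norm t)\<^sup>2 < (sqrt d)\<^sup>2" using that by (intro power_strict_mono) (auto simp: B_def)
    then show ?thesis using d by (simp add: dist_norm norm_power)
  qed
  have nK: "p + t\<^sup>2 \<notin> K" if "t \<in> B" "t \<noteq> 0" for t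
  proof -
    have "p + t\<^sup>2 \<noteq> p" using that by simp
    then show ?thesis using inb[OF that(1)] d(2) by blast
  qed
  define k where "k = (\<lambda>t. 2 * u (p + t\<^sup>2) / e (p + t\<^sup>2))"
  have hk: "k holomorphic_on B" unfolding k_def
    by (intro holomorphic_intros holomorphic_on_compose_gen[OF _ u, unfolded o_def]
          holomorphic_on_compose_gen[OF _ e(1), unfolded o_def])
       (use inb e(3) in auto)
  have oB: "open B" "convex B" by (auto simp: B_def)
  obtain F where "\<And>t. t \<in> B \<Longrightarrow> (F has_field_derivative k t) (at t within B)"
    using holomorphic_convex_primitive'[OF oB(2,1) hk] by blast
  then have F: "(F has_field_derivative k t) (at t)" if "t \<in> B" for t
    using that oB(1) at_within_open by metis
  define a where "a = complex_of_real (sqrt d / 2)"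
  have a0: "a \<noteq> 0" using d by (simp add: a_def)
  have aB: "of_real t * a \<in> B" if "t \<in> {0..1}" for t
  proof -
    have "t * (sqrt d / 2) \<le> 1 * (sqrt d / 2)" using that d by (intro mult_right_mono) auto
    also have "\<dots> < sqrt d" using d by simp
    finally show ?thesis using that d by (simp add: B_def a_def norm_mult)
  qed
  define g where "g = (\<lambda>t. p + (of_real t * a)\<^sup>2)"
  define r where "r = (\<lambda>t. of_real t * a * e (p + (of_real t * a)\<^sup>2))"
  define \<Phi> where "\<Phi> = (\<lambda>t. F (of_real t * a))"
  have c1: "continuous_on {0..1} (\<lambda>t::real. of_real t * a)" by (intro continuous_intros)
  have "lifted_path K p (p + a\<^sup>2) g r"
    unfolding lifted_path_def
  proof (intro conjI ballI)
    have "g = (\<lambda>t. p + t *\<^sub>R (t *\<^sub>R a\<^sup>2))"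
      by (simp add: g_def fun_eq_iff scaleR_conv_of_real power2_eq_square mult_ac)
    moreover have "polynomial_function (\<lambda>t. p + t *\<^sub>R (t *\<^sub>R a\<^sup>2))"
      by (intro polynomial_function_add polynomial_function_mult polynomial_function_const polynomial_function_id)
    ultimately have "polynomial_function g" by (simp only:)
    then show "valid_path g" by (rule valid_path_polynomial_function)
    show "pathstart g = p" "pathfinish g = p + a\<^sup>2" by (auto simp: g_def pathstart_def pathfinish_def)
    show "g ` {0<..<1} \<inter> K = {}" using nK[OF aB] a0 by (auto simp: g_def)
    show "continuous_on {0..1} r"
      unfolding r_def
      by (intro continuous_intros continuous_on_compose2[OF holomorphic_on_imp_continuous_on[OF e(1)]])
         (use inb[OF aB] in auto)
    fix t :: real assume t: "t \<in> {0..1}"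
    show "(r t)\<^sup>2 = monic_poly K (g t)"
      using e(2) inb[OF aB[OF t]] monic_poly_split[OF K p, of "g t"] by (simp add: r_def g_def power_mult_distrib)
  qed
  moreover have "lifted_primitive u g r \<Phi>"
    unfolding lifted_primitive_def
  proof (intro conjI exI[of _ "{}"] ballI)
    show "continuous_on {0..1} \<Phi>" unfolding \<Phi>_def
    proof (rule continuous_on_compose2[OF _ c1])
      show "continuous_on B F" using F DERIV_isCont continuous_at_imp_continuous_on by blast
    qed (use aB in auto)
    fix t :: real assume "t \<in> {0<..<1} - {}"
    then have t: "t \<in> {0..1}" "t \<noteq> 0" by auto
    have e0: "e (g t) \<noteq> 0" using e(3) inb[OF aB[OF t(1)]] by (auto simp: g_def)
    have lin: "((\<lambda>t. of_real t * a) has_vector_derivative a) (at t)"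
      by (auto intro!: derivative_eq_intros)
    have "((\<lambda>t. t\<^sup>2) has_field_derivative 2 * (of_real t * a)) (at (of_real t * a))"
      by (auto intro!: derivative_eq_intros)
    from field_vector_diff_chain_at[OF lin this]
    have g': "(g has_vector_derivative 2 * (of_real t * a) * a) (at t)"
      unfolding g_def using has_vector_derivative_const[of p]
      by (auto simp: o_def mult.commute intro!: derivative_eq_intros)
    have "(F \<circ> (\<lambda>t. of_real t * a) has_vector_derivative a * k (of_real t * a)) (at t)"
      by (rule field_vector_diff_chain_at[OF lin F[OF aB[OF t(1)]]])
    moreover have "a * k (of_real t * a) = u (g t) / r t * (2 * (of_real t * a) * a)"
      using t a0 e0 by (simp add: k_def g_def r_def field_simps)
    ultimately show "\<exists>g'. (g has_vector_derivative g') (at t) \<and> (\<Phi> has_vector_derivative u (g t) / r t * g') (at t)"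
      using g' by (auto simp: \<Phi>_def o_def)
  qed simp
  moreover have "p + a\<^sup>2 \<notin> K" using nK[of a] aB[of 1] a0 by simp
  ultimately show ?thesis using that by blast
qed

text \<open>The complement of a finite set is connected by polynomial paths. D has no zero along
  such a path and an interval is contractible, so a continuous root exists; its sign is chosen by
  the prescribed end value w.\<close>

lemma lifted_path_off_branch:
  assumes K: "finite K" and u: "u holomorphic_on UNIV" and y: "y \<notin> K" and x: "x \<notin> K"
    and w: "w\<^sup>2 = monic_poly K x"
  obtains g r \<Phi> where "lifted_path K y x g r" "lifted_primitive u g r \<Phi>" "r 1 = w"
proof -
  have oK: "open (- K)" using K by (simp add: finite_imp_closed open_Compl)
  have cK: "connected (- K)"
    using connected_open_delete_finite[OF open_UNIV connected_UNIV _ K] by (simp add: Compl_eq_Diff_UNIV)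
  obtain g where g: "polynomial_function g" "path_image g \<subseteq> - K" "pathstart g = y" "pathfinish g = x"
    using connected_open_polynomial_connected[OF oK cK, of y x] x y by auto
  obtain g' where g': "polynomial_function g'" "\<And>t. (g has_vector_derivative g' t) (at t)"
    using has_vector_derivative_polynomial_function[OF g(1)] by blast
  have gK: "g t \<notin> K" if "t \<in> {0..1}" for t using g(2) that unfolding path_image_def by blast
  have cg: "continuous_on {0..1} g" "continuous_on {0..1} g'"
    using g(1) g'(1) by (auto intro: continuous_on_polymonial_function)
  have "continuous_on {0..1} (\<lambda>t. monic_poly K (g t))"
    by (rule continuous_on_compose2[OF holomorphic_on_imp_continuous_on[OF monic_poly_holomorphic[of K UNIV]] cg(1)]) simp
  moreover have "contractible {0..1::real}" by (intro convex_imp_contractible) simp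
  moreover have "monic_poly K (g t) \<noteq> 0" if "t \<in> {0..1}" for t
    using gK[OF that] K by (simp add: monic_poly_eq_0_iff)
  ultimately have "\<exists>r0. continuous_on {0..1} r0 \<and> (\<forall>t\<in>{0..1}. monic_poly K (g t) = (r0 t)\<^sup>2)"
    by (metis continuous_sqrt_on_contractible)
  then obtain r0 where r0: "continuous_on {0..1} r0" "\<And>t. t \<in> {0..1} \<Longrightarrow> monic_poly K (g t) = (r0 t)\<^sup>2"
    by blast
  have "g 1 = x" using g(4) by (simp add: pathfinish_def)
  then have "w\<^sup>2 = (r0 1)\<^sup>2" using w r0(2)[of 1] by simp
  then have "w = r0 1 \<or> w = - r0 1" by (simp only: power2_eq_iff)
  then obtain r where r: "continuous_on {0..1} r" "\<And>t. t \<in> {0..1} \<Longrightarrow> (r t)\<^sup>2 = monic_poly K (g t)" "r 1 = w"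
  proof
    assume "w = r0 1" then show ?thesis using that[of r0] r0 by simp
  next
    assume "w = - r0 1" then show ?thesis using that[of "\<lambda>t. - r0 t"] r0 by (simp add: continuous_on_minus)
  qed
  define h where "h = (\<lambda>t. u (g t) / r t * g' t)"
  have ch: "continuous_on {0..1} h" unfolding h_def
  proof (intro continuous_intros r cg)
    show "continuous_on {0..1} (\<lambda>t. u (g t))"
      by (rule continuous_on_compose2[OF holomorphic_on_imp_continuous_on[OF u] cg(1)]) simp
    show "\<forall>t\<in>{0..1}. r t \<noteq> 0" using r(2) gK K monic_poly_eq_0_iff by fastforce
  qed
  define \<Phi> where "\<Phi> = (\<lambda>t. integral {0..t} h)"
  have \<Phi>': "(\<Phi> has_vector_derivative h t) (at t within {0..1})" if "t \<in> {0..1}" for t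
    unfolding \<Phi>_def by (rule integral_has_vector_derivative[OF ch that])
  have "lifted_primitive u g r \<Phi>"
    unfolding lifted_primitive_def
  proof (intro conjI exI[of _ "{}"] ballI)
    show "continuous_on {0..1} \<Phi>"
      using \<Phi>' by (meson continuous_on_eq_continuous_within has_vector_derivative_continuous)
    fix t :: real assume t: "t \<in> {0<..<1} - {}"
    then have "(\<Phi> has_vector_derivative h t) (at t)"
      using \<Phi>'[of t] at_within_interior[of t "{0..1}"] by (auto simp: interior_atLeastAtMost_real)
    then show "\<exists>g'. (g has_vector_derivative g') (at t) \<and> (\<Phi> has_vector_derivative u (g t) / r t * g') (at t)"
      using g'(2) by (auto simp: h_def)
  qed simp
  moreover have "lifted_path K y x g r"
    unfolding lifted_path_def using g r gK valid_path_polynomial_function by auto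
  ultimately show ?thesis using that r(3) by blast
qed

text \<open>Both sheets over x are reached, since the root on the initial piece may be negated to
  match the second piece, which ends at w.\<close>

lemma lifted_path_exists:
  assumes K: "finite K" and p: "p \<in> K" and u: "u holomorphic_on UNIV" and x: "x \<notin> K"
    and w: "w\<^sup>2 = monic_poly K x"
  obtains g r \<Phi> where "lifted_path K p x g r" "lifted_primitive u g r \<Phi>" "r 1 = w"
proof -
  obtain y g1 r1 \<Phi>1 where 1: "y \<notin> K" "lifted_path K p y g1 r1" "lifted_primitive u g1 r1 \<Phi>1"
    using lifted_path_branch_start[OF K p u] .
  obtain g2 r2 \<Phi>2 where 2: "lifted_path K y x g2 r2" "lifted_primitive u g2 r2 \<Phi>2" "r2 1 = w"
    using lifted_path_off_branch[OF K u 1(1) x w] .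
  have "(r1 1)\<^sup>2 = (r2 0)\<^sup>2"
    using 1(2) 2(1) by (auto simp: lifted_path_def pathstart_def pathfinish_def)
  then have "r1 1 = r2 0 \<or> r1 1 = - r2 0" by (simp only: power2_eq_iff)
  then obtain r3 \<Phi>3 where 3: "lifted_path K p y g1 r3" "lifted_primitive u g1 r3 \<Phi>3" "r3 1 = r2 0"
  proof
    assume "r1 1 = r2 0" then show ?thesis using that[OF 1(2,3)] by simp
  next
    assume "r1 1 = - r2 0"
    then show ?thesis using that[OF lifted_path_uminus[OF 1(2)] lifted_primitive_uminus[OF 1(3)]] by simp
  qed
  show ?thesis
    using that[OF lifted_path_join[OF 3(1) 2(1) 1(1) 3(3)] lifted_primitive_join[OF 3(2) 2(2)]] 2(3)
    by (simp add: joinpaths_def)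
qed

text \<open>Prolonging one fixed path to x by a segment to y adds P y - P x for a local primitive P
  of u / s, so f differs from Re P by a constant near x. This serves both for a section built from u
  and for recognizing \<open>U\<close> as the entire function of \<open>G\<close>.\<close>

lemma z2_potential_of_path_integrals:
  assumes K: "finite K" and p: "p \<in> K" and u: "u holomorphic_on UNIV" and f: "z2_function K f"
    and int: "\<And>x g r \<Phi>. x \<notin> K \<Longrightarrow> lifted_path K p x g r \<Longrightarrow> lifted_primitive u g r \<Phi> \<Longrightarrow> f x (r 1) = Re (\<Phi> 1 - \<Phi> 0)"
  shows "z2_potential K f u"
  unfolding z2_potential_def
proof (intro conjI allI impI f u)
  fix V s x assume s: "trivialization K V s" and x: "x \<in> V"
  have V: "open V" using s by (simp add: trivialization_def)
  obtain d where d: "d > 0" "ball x d \<subseteq> V" using V x open_contains_ball by blast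
  have s': "trivialization K (ball x d) s" by (rule trivialization_subset[OF s open_ball d(2)])
  have "(\<lambda>y. u y / s y) holomorphic_on ball x d"
    using trivialization_nonzero[OF K s']
    by (intro holomorphic_on_divide holomorphic_on_subset[OF u] trivialization_holomorphic[OF K s']) auto
  from holomorphic_convex_primitive'[OF convex_ball open_ball this]
  obtain P where "\<And>y. y \<in> ball x d \<Longrightarrow> (P has_field_derivative u y / s y) (at y within ball x d)" by blast
  then have P: "(P has_field_derivative u y / s y) (at y)" if "y \<in> ball x d" for y
    using that at_within_open open_ball by metis
  note xK = trivializationD[OF s x]
  obtain g r \<Phi> where g: "lifted_path K p x g r" "lifted_primitive u g r \<Phi>" "r 1 = s x"
    using lifted_path_exists[OF K p u xK] .
  have eq: "Re (\<Phi> 1 - \<Phi> 0) + Re (P y - P x) = f y (s y)" if y: "y \<in> ball x d" for y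
  proof -
    define l where "l = linepath x y"
    have l: "l t \<in> ball x d" if "t \<in> {0..1}" for t
    proof -
      have "closed_segment x y \<subseteq> ball x d"
        using y d(1) by (intro closed_segment_subset) auto
      then show ?thesis using linepath_in_path[OF that, of x y] unfolding l_def by blast
    qed
    have cl: "continuous_on {0..1} l" unfolding l_def by (rule continuous_on_linepath)
    have cs: "continuous_on (ball x d) s" using s' by (simp add: trivialization_def)
    have lp: "lifted_path K x y l (s \<circ> l)"
      unfolding lifted_path_def
    proof (intro conjI ballI)
      show "l ` {0<..<1} \<inter> K = {}" using trivializationD(1)[OF s'] l by force
      show "continuous_on {0..1} (s \<circ> l)"
        unfolding o_def by (rule continuous_on_compose2[OF cs cl]) (use l in auto)
      show "((s \<circ> l) t)\<^sup>2 = monic_poly K (l t)" if "t \<in> {0..1}" for t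
        using trivializationD(2)[OF s' l[OF that]] by simp
    qed (auto simp: l_def)
    have "lifted_primitive u l (s \<circ> l) (P \<circ> l)"
      unfolding lifted_primitive_def
    proof (intro conjI exI[of _ "{}"] ballI)
      have "continuous_on (ball x d) P"
        using P DERIV_isCont continuous_at_imp_continuous_on by blast
      then show "continuous_on {0..1} (P \<circ> l)"
        unfolding o_def by (rule continuous_on_compose2[OF _ cl]) (use l in auto)
      fix t :: real assume "t \<in> {0<..<1} - {}"
      then have t: "t \<in> {0..1}" by auto
      have l': "(l has_vector_derivative y - x) (at t)"
        unfolding l_def by (rule has_vector_derivative_linepath_within)
      show "\<exists>g'. (l has_vector_derivative g') (at t) \<and> (P \<circ> l has_vector_derivative u (l t) / (s \<circ> l) t * g') (at t)"
        using l' field_vector_diff_chain_at[OF l' P[OF l[OF t]]] by (auto simp: mult.commute)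
    qed simp
    from lifted_primitive_join[OF g(2) this]
    have "lifted_primitive u (g +++ l) (r +++ (s \<circ> l)) (\<Phi> +++ (\<lambda>t. (P \<circ> l) t + (\<Phi> 1 - (P \<circ> l) 0)))" .
    moreover have "lifted_path K p y (g +++ l) (r +++ (s \<circ> l))"
      by (rule lifted_path_join[OF g(1) lp xK(1)]) (simp add: g(3) l_def linepath_def)
    moreover have "y \<notin> K" using trivializationD(1)[OF s' y] .
    ultimately have "f y ((r +++ (s \<circ> l)) 1) = Re ((\<Phi> +++ (\<lambda>t. (P \<circ> l) t + (\<Phi> 1 - (P \<circ> l) 0))) 1 - (\<Phi> +++ (\<lambda>t. (P \<circ> l) t + (\<Phi> 1 - (P \<circ> l) 0))) 0)"
      by (intro int)
    then show ?thesis by (simp add: joinpaths_def l_def linepath_def)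
  qed
  have "has_cgrad (\<lambda>y. Re (P y + of_real (Re (\<Phi> 1 - \<Phi> 0) - Re (P x)))) (u x / s x) x"
    by (rule has_cgrad_Re) (use P[of x] d(1) in \<open>auto intro!: derivative_eq_intros\<close>)
  then show "has_cgrad (\<lambda>y. f y (s y)) (u x / s x) x"
    by (rule has_cgrad_cong[OF _ open_ball[of x d]]) (use d(1) in \<open>auto simp flip: eq\<close>)
qed

text \<open>Admissibility speaks of paths from p to another branch point, not of loops at p. Hence f
  is defined by chosen paths from a second branch point q, and every path from p is compared with
  the chosen one; independence of the path from p follows.\<close>

lemma admissible_imp_potential:
  assumes K: "finite K" and p: "p \<in> K" and q: "q \<in> K" "q \<noteq> p" and u: "admissible K p u"
  obtains f where "z2_potential K f u"
proof -
  have hu: "u holomorphic_on UNIV" using u by (simp add: admissible_def)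
  define f where "f = (\<lambda>x w. SOME c. \<exists>g r \<Phi>. lifted_path K q x g r \<and> lifted_primitive u g r \<Phi> \<and> r 1 = w \<and> c = Re (\<Phi> 1 - \<Phi> 0))"
  have int: "f x (r 1) = Re (\<Phi> 1 - \<Phi> 0)"
    if x: "x \<notin> K" and g: "lifted_path K p x g r" and \<Phi>: "lifted_primitive u g r \<Phi>" for x g r \<Phi>
  proof -
    have "(r 1)\<^sup>2 = monic_poly K x" using g by (auto simp: lifted_path_def pathfinish_def)
    from lifted_path_exists[OF K q(1) hu x this]
    have "\<exists>c. \<exists>g' r' \<Phi>'. lifted_path K q x g' r' \<and> lifted_primitive u g' r' \<Phi>' \<and> r' 1 = r 1 \<and> c = Re (\<Phi>' 1 - \<Phi>' 0)"
      by metis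
    from someI_ex[OF this] obtain g' r' \<Phi>' where g': "lifted_path K q x g' r'" "lifted_primitive u g' r' \<Phi>'"
      "r' 1 = r 1" "f x (r 1) = Re (\<Phi>' 1 - \<Phi>' 0)"
      unfolding f_def by blast
    \<comment> \<open>Admissibility is applied to the path from \<open>p\<close> through \<open>x\<close> back to \<open>q\<close>.\<close>
    define \<Psi> where "\<Psi> = \<Phi> +++ (\<lambda>t. reversepath \<Phi>' t + (\<Phi> 1 - reversepath \<Phi>' 0))"
    have "lifted_path K p q (g +++ reversepath g') (r +++ reversepath r')"
      by (rule lifted_path_join[OF g lifted_path_reverse[OF g'(1)] x]) (simp add: g'(3) reversepath_def)
    then have "Re (lifted_integral u (g +++ reversepath g') (r +++ reversepath r')) = 0"
      using u q unfolding admissible_def by blast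
    moreover have "lifted_primitive u (g +++ reversepath g') (r +++ reversepath r') \<Psi>"
      unfolding \<Psi>_def by (rule lifted_primitive_join[OF \<Phi> lifted_primitive_reverse[OF g'(2)]])
    ultimately have "Re (\<Psi> 1 - \<Psi> 0) = 0" using lifted_integral_eq_primitive by simp
    then show ?thesis by (simp add: g'(4) \<Psi>_def joinpaths_def reversepath_def)
  qed
  have "z2_function K f"
    unfolding z2_function_def
  proof (intro allI impI)
    fix x w assume x: "x \<notin> K" and w: "w\<^sup>2 = monic_poly K x"
    \<comment> \<open>The same path with the negated root has the negated integral and ends at -
      w.\<close>
    obtain g r \<Phi> where g: "lifted_path K p x g r" "lifted_primitive u g r \<Phi>" "r 1 = w"
      using lifted_path_exists[OF K p hu x w] .
    from int[OF x g(1,2)] int[OF x lifted_path_uminus[OF g(1)] lifted_primitive_uminus[OF g(2)]] g(3)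
    show "f x (- w) = - f x w" by simp
  qed
  then have "z2_potential K f u"
    by (rule z2_potential_of_path_integrals[OF K p hu]) (rule int)
  then show ?thesis by (rule that)
qed

text \<open>Off \<open>K\<close> the complex gradient u / s of the zero section is 0; on the finite
  set \<open>K\<close> the value follows by continuity.\<close>

lemma z2_potential_zero_imp_zero:
  assumes K: "finite K" and f: "z2_potential K f u"
    and zero: "\<And>x w. x \<notin> K \<Longrightarrow> w\<^sup>2 = monic_poly K x \<Longrightarrow> f x w = 0"
  shows "u x = 0"
proof -
  have off: "u y = 0" if y: "y \<notin> K" for y
  proof -
    obtain W s where s: "trivialization K W s" "y \<in> W"
      using trivialization_local[OF K y power2_csqrt] by metis
    have W: "open W" using s by (simp add: trivialization_def)
    have "has_cgrad (\<lambda>y. 0) (u y / s y) y"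
      by (rule has_cgrad_cong[OF z2_potentialD(3)[OF f s] W s(2)]) (use zero trivializationD[OF s(1)] in auto)
    moreover have "has_cgrad (\<lambda>y. 0) 0 y" by (simp add: has_cgrad_def)
    ultimately have "u y / s y = 0" by (rule has_cgrad_unique)
    then show ?thesis using trivialization_nonzero[OF K s] by simp
  qed
  have "isCont u x"
    using z2_potentialD(2)[OF f, of UNIV] holomorphic_on_imp_continuous_on continuous_on_eq_continuous_at open_UNIV by blast
  then have "(u \<longlongrightarrow> u x) (at x)" by (simp add: isCont_def)
  moreover have "(u \<longlongrightarrow> 0) (at x)"
  proof (rule tendsto_eventually)
    have "open (- (K - {x}))" using K by (intro open_Compl finite_imp_closed) simp
    from eventually_at_in_open[OF this, of x] have "\<forall>\<^sub>F y in at x. y \<in> - (K - {x}) - {x}" by simp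
    then show "\<forall>\<^sub>F y in at x. u y = 0"
      by eventually_elim (use off in auto)
  qed
  ultimately show ?thesis using tendsto_unique[of "at x"] by (metis trivial_limit_at)
qed

section \<open>Zero loci, growth of D and constancy of sign near infinity\<close>

lemma z2_zeros_eq_z2_abs:
  assumes "z2_function K f" shows "z2_zeros K f = {x. z2_abs K f x = 0}"
proof -
  have "(\<forall>w. w\<^sup>2 = monic_poly K x \<longrightarrow> f x w = 0) \<longleftrightarrow> z2_abs K f x = 0" if "x \<notin> K" for x
    using z2_abs_eq[OF assms that] power2_csqrt[of "monic_poly K x"] by fastforce
  then show ?thesis by (auto simp: z2_zeros_def z2_abs_def)
qed

lemma norm_monic_poly_ge:
  assumes K: "finite K" "K \<subseteq> cball 0 R" and x: "norm x \<ge> 2 * R"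
  shows "(norm x / 2) ^ card K \<le> norm (monic_poly K x)"
proof -
  have "(\<Prod>p\<in>K. norm x / 2) \<le> (\<Prod>p\<in>K. norm (x - p))"
  proof (rule prod_mono)
    fix p assume "p \<in> K"
    then have "norm p \<le> R" using K by auto
    moreover have "norm x - norm p \<le> norm (x - p)" by (rule norm_triangle_ineq2)
    ultimately show "0 \<le> norm x / 2 \<and> norm x / 2 \<le> norm (x - p)" using x by simp
  qed
  then show ?thesis by (simp add: monic_poly_def prod_norm)
qed

text \<open>The complement of a disc in the plane is connected, so a sign change would force a zero
  by the intermediate value theorem.\<close>

lemma sign_constant_at_infinity:
  fixes \<phi> :: "complex \<Rightarrow> real"
  assumes c: "continuous_on {x. R < norm x} \<phi>" and nz: "\<And>x. norm x > R \<Longrightarrow> \<phi> x \<noteq> 0"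
  shows "(\<forall>x. norm x > R \<longrightarrow> \<phi> x > 0) \<or> (\<forall>x. norm x > R \<longrightarrow> \<phi> x < 0)"
proof (rule ccontr)
  assume "\<not> ?thesis"
  then obtain a b where ab: "norm a > R" "\<phi> a \<le> 0" "norm b > R" "\<phi> b \<ge> 0" by (meson not_le)
  have "- cball (0::complex) R = {x. R < norm x}" by auto
  then have "connected {x::complex. R < norm x}"
    using connected_complement_bounded_convex[OF bounded_cball convex_cball, of "0::complex" R] by simp
  then have "connected (\<phi> ` {x. R < norm x})" using c by (rule connected_continuous_image[rotated])
  then have "0 \<in> \<phi> ` {x. R < norm x}" using connectedD_interval[of _ "\<phi> a" "\<phi> b" 0] ab by blast
  then show False using nz by auto
qed

theorem theorem7:
  fixes k :: nat and z :: "nat \<Rightarrow> complex" and K :: "complex set"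
    and R :: real and s :: "complex \<Rightarrow> complex"
    and G :: "complex \<Rightarrow> complex \<Rightarrow> real" and U :: "complex \<Rightarrow> complex"
  assumes "k \<ge> 1"
    and "inj_on z {1..2 * k}"
    and "K = z ` {1..2 * k}"
    and "K \<subseteq> cball 0 R"
    and "trivialization K {x. R < norm x} s"
    and "is_G K s G"
    and "is_U K (z 1) G U"
  shows "(\<forall>f. z2_harmonic K f \<longrightarrow> (\<lambda>x. f x (s x)) \<in> o[at_infinity](\<lambda>x. norm x)
              \<longrightarrow> z2_real_multiple K f G)
       \<and> compact (z2_zeros K G)
       \<and> (\<forall>f. z2_harmonic K f \<longrightarrow> compact (z2_zeros K f) \<longrightarrow> z2_real_multiple K f G)
       \<and> (\<forall>u. admissible K (z 1) u \<longrightarrow> u \<in> o[at_infinity](\<lambda>x. of_real (norm x ^ k))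
              \<longrightarrow> (\<exists>c::real. \<forall>x. u x = of_real c * U x))"
proof -
  have K: "finite K" using assms(3) by simp
  have idx: "1 \<in> {1..2 * k}" "2 \<in> {1..2 * k}" using assms(1) by auto
  \<comment> \<open>From k >= 1 there are at least two branch points; the second one is the start of
    the paths that define a section from an admissible function.\<close>
  have z1: "z 1 \<in> K" and z2: "z 2 \<in> K"
    unfolding assms(3) by (intro imageI idx)+
  have z12: "z 2 \<noteq> z 1"
    using inj_onD[OF assms(2) _ idx(2,1)] by auto
  have Kne: "K \<noteq> {}" using z1 by auto
  have "norm (z 1) \<le> R" using subsetD[OF assms(4) z1] by simp
  then have R0: "R \<ge> 0" using order_trans[OF norm_ge_zero] by blast
  have cardK: "card K = 2 * k" using assms(2,3) by (simp add: card_image)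
  note s = assms(5)

  have G: "z2_harmonic K G" using assms(6) by (simp add: is_G_def)
  obtain c0 where c0: "((\<lambda>x. G x (s x) - ln (norm x)) \<longlongrightarrow> c0) at_infinity"
    using assms(6) by (auto simp: is_G_def)
  obtain v where v: "z2_potential K G v" using z2_harmonic_imp_potential[OF K G] .
  have ln_top: "filterlim (\<lambda>x::complex. ln (norm x)) at_top at_infinity"
    by (rule filterlim_compose[OF ln_at_top filterlim_norm_at_top])
  have G_top: "filterlim (\<lambda>x. G x (s x)) at_top at_infinity"
    using filterlim_tendsto_add_at_top[OF c0 ln_top] by simp
  have G_small: "(\<lambda>x. G x (s x)) \<in> o[at_infinity](\<lambda>x. norm x)"
  proof (rule smalloI_tendsto)
    have "((\<lambda>x. (G x (s x) - ln (norm x)) / norm x + ln (norm x) / norm x) \<longlongrightarrow> 0 + 0) at_infinity"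
      by (intro tendsto_add tendsto_divide_0[OF c0] filterlim_at_top_imp_at_infinity filterlim_norm_at_top
            filterlim_compose[OF ln_x_over_x_tendsto_0 filterlim_norm_at_top])
    then show "((\<lambda>x. G x (s x) / norm x) \<longlongrightarrow> 0) at_infinity"
      by (simp flip: add_divide_distrib)
    show "\<forall>\<^sub>F x::complex in at_infinity. norm x \<noteq> 0"
      unfolding eventually_at_infinity by (intro exI[of _ 1]) auto
  qed
  note G_decay = z2_gradient_decay[OF K v s G_small]

  have proportional: "z2_real_multiple K f G"
    if "z2_potential K f u" "((\<lambda>x. u x / s x) \<longlongrightarrow> 0) at_infinity" for f u
    by (rule z2_potential_proportional[OF K Kne that(1) v s that(2) G_decay G_top])

  have part1: "z2_real_multiple K f G"
    if "z2_potential K f u" "(\<lambda>x. f x (s x)) \<in> o[at_infinity](\<lambda>x. norm x)" for f u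
    by (rule proportional[OF that(1) z2_gradient_decay[OF K that(1) s that(2)]])

  have part2a: "compact (z2_zeros K G)"
  proof -
    have zeros: "z2_zeros K G = {x. z2_abs K G x = 0}"
      by (rule z2_zeros_eq_z2_abs[OF z2_potentialD(1)[OF v]])
    have "closed (z2_zeros K G)" unfolding zeros
      by (intro closed_Collect_eq z2_abs_continuous[OF K v] continuous_on_const)
    moreover have "bounded (z2_zeros K G)"
    proof -
      have "\<forall>\<^sub>F x in at_infinity. G x (s x) > 0"
        using G_top by (simp add: filterlim_at_top_dense)
      then obtain b where b: "\<And>x. norm x \<ge> b \<Longrightarrow> G x (s x) > 0"
        unfolding eventually_at_infinity by blast
      have "norm x \<le> max b R" if "x \<in> z2_zeros K G" for x
      proof (rule ccontr)
        assume *: "\<not> norm x \<le> max b R"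
        then have "x \<in> {x. R < norm x}" "norm x \<ge> b" by (auto simp: not_le)
        from z2_abs_eq[OF z2_potentialD(1)[OF v] trivializationD[OF s this(1)]] b[OF this(2)]
        show False using that by (simp add: zeros)
      qed
      then show ?thesis unfolding bounded_iff by blast
    qed
    ultimately show ?thesis by (simp add: compact_eq_bounded_closed)
  qed

  have part2b: "z2_real_multiple K f G" if f: "z2_harmonic K f" and cpt: "compact (z2_zeros K f)" for f
  proof -
    obtain u where u: "z2_potential K f u" using z2_harmonic_imp_potential[OF K f] .
    have zeros: "z2_zeros K f = {x. z2_abs K f x = 0}"
      by (rule z2_zeros_eq_z2_abs[OF z2_potentialD(1)[OF u]])
    obtain b where b: "\<And>x. x \<in> z2_zeros K f \<Longrightarrow> norm x \<le> b"
      using compact_imp_bounded[OF cpt] unfolding bounded_iff by blast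
    \<comment> \<open>Beyond \<open>Q\<close> the section has no zero and s is defined; the 1 makes
      the radius positive, as the passage to logarithmic coordinates requires.\<close>
    define Q where "Q = max (max b R) 1"
    have Q: "Q > 0" "Q \<ge> R" "Q \<ge> b" by (auto simp: Q_def)
    have oQ: "open {x::complex. Q < norm x}" by (intro open_Collect_less continuous_intros)
    have sQ: "trivialization K {x. Q < norm x} s"
      by (rule trivialization_subset[OF s oQ]) (use Q in auto)
    have nz: "f x (s x) \<noteq> 0" if x: "norm x > Q" for x
    proof -
      have "x \<in> {x. Q < norm x}" using x by simp
      from z2_abs_eq[OF z2_potentialD(1)[OF u] trivializationD[OF sQ this]] b[of x] x Q
      show ?thesis by (force simp: zeros)
    qed
    have "continuous_on {x. Q < norm x} (\<lambda>x. f x (s x))"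
      by (intro continuous_at_imp_continuous_on ballI) (rule has_cgrad_continuous[OF z2_potentialD(3)[OF u sQ]])
    from sign_constant_at_infinity[OF this nz] show ?thesis
    proof
      assume "\<forall>x. norm x > Q \<longrightarrow> f x (s x) > 0"
      then have "(\<lambda>x. f x (s x)) \<in> o[at_infinity](\<lambda>x. norm x)"
        by (intro z2_positive_imp_sublinear[OF K u sQ Q(1)]) auto
      then show ?thesis by (rule part1[OF u])
    next
      assume neg: "\<forall>x. norm x > Q \<longrightarrow> f x (s x) < 0"
      \<comment> \<open>The negative case passes to - f, written as f - 2 f to fall under the linear
        combinations f - c g.\<close>
      have "z2_potential K (\<lambda>x w. f x w - 2 * f x w) (\<lambda>x. u x - of_real 2 * u x)"
        by (rule z2_potential_linear[OF u u])
      then have m: "z2_potential K (\<lambda>x w. - f x w) (\<lambda>x. u x - of_real 2 * u x)" by simp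
      have "(\<lambda>x. - f x (s x)) \<in> o[at_infinity](\<lambda>x. norm x)"
        by (rule z2_positive_imp_sublinear[OF K m sQ Q(1)]) (use neg in auto)
      then have "(\<lambda>x. f x (s x)) \<in> o[at_infinity](\<lambda>x. norm x)" by simp
      then show ?thesis by (rule part1[OF u])
    qed
  qed

  have part3: "\<exists>c::real. \<forall>x. u x = of_real c * U x"
    if adm: "admissible K (z 1) u" and small: "u \<in> o[at_infinity](\<lambda>x. of_real (norm x ^ k))" for u
  proof -
    have hU: "U holomorphic_on UNIV" using assms(7) by (simp add: is_U_def admissible_def)
    \<comment> \<open>\<open>U\<close> is tied to \<open>G\<close> only by path integrals from z 1.
      Once it is known as the entire function of \<open>G\<close>, proportionality of sections
      carries over to \<open>u\<close> and \<open>U\<close>.\<close>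
    have U: "z2_potential K G U"
      by (rule z2_potential_of_path_integrals[OF K z1 hU z2_potentialD(1)[OF v]])
         (use assms(7) lifted_integral_eq_primitive in \<open>auto simp: is_U_def\<close>)
    obtain f where f: "z2_potential K f u"
      using admissible_imp_potential[OF K z1 z2 z12 adm] .
    have "((\<lambda>x. u x / s x) \<longlongrightarrow> 0) at_infinity"
    proof (rule Lim_null_comparison)
      have "((\<lambda>x. u x / of_real (norm x ^ k)) \<longlongrightarrow> 0) at_infinity" by (rule smalloD_tendsto[OF small])
      then have "((\<lambda>x. 2 ^ k * norm (u x / of_real (norm x ^ k))) \<longlongrightarrow> 2 ^ k * 0) at_infinity"
        by (intro tendsto_intros tendsto_norm_zero)
      then show "((\<lambda>x. 2 ^ k * norm (u x / of_real (norm x ^ k))) \<longlongrightarrow> 0) at_infinity" by simp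
      show "\<forall>\<^sub>F x in at_infinity. norm (u x / s x) \<le> 2 ^ k * norm (u x / of_real (norm x ^ k))"
        unfolding eventually_at_infinity
      proof (intro exI[of _ "2 * R + 1"] allI impI)
        \<comment> \<open>Beyond 2 R each of the 2k factors of D has modulus at least |x|/2, hence
          |s x| >= (|x|/2)^k. The added 1 gives |x| > R and |x| > 0 also when R = 0.\<close>
        fix x :: complex assume x: "2 * R + 1 \<le> norm x"
        have xR: "x \<in> {x. R < norm x}" and x0: "norm x > 0" using x R0 by auto
        have "((norm x / 2) ^ k)\<^sup>2 \<le> norm (monic_poly K x)"
          using norm_monic_poly_ge[OF K assms(4), of x] x cardK by (simp add: power_mult[symmetric] mult.commute)
        also have "\<dots> = (norm (s x))\<^sup>2" using trivializationD(2)[OF s xR] by (simp add: norm_power flip: norm_power)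
        finally have "(norm x / 2) ^ k \<le> norm (s x)" by (rule power2_le_imp_le) simp
        then have "norm (u x) / norm (s x) \<le> norm (u x) / (norm x / 2) ^ k"
          using x0 by (intro frac_le) auto
        then show "norm (u x / s x) \<le> 2 ^ k * norm (u x / of_real (norm x ^ k))"
          by (simp add: norm_divide norm_power power_divide field_simps)
      qed
    qed
    from proportional[OF f this] obtain c where c: "\<And>x w. x \<notin> K \<Longrightarrow> w\<^sup>2 = monic_poly K x \<Longrightarrow> f x w = c * G x w"
      unfolding z2_real_multiple_def by blast
    \<comment> \<open>The section f - c G vanishes off \<open>K\<close>, and u - c U is its entire
      function.\<close>
    have "u x - of_real c * U x = 0" for x
      by (rule z2_potential_zero_imp_zero[OF K z2_potential_linear[OF f U, of c]]) (use c in simp)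
    then have "\<forall>x. u x = of_real c * U x" by simp
    then show ?thesis by blast
  qed

  show ?thesis
  proof (intro conjI allI impI)
    fix f assume f: "z2_harmonic K f" and "(\<lambda>x. f x (s x)) \<in> o[at_infinity](\<lambda>x. norm x)"
    then show "z2_real_multiple K f G"
      using part1 z2_harmonic_imp_potential[OF K f] by metis
  qed (use part2a part2b part3 in auto)
qed

end
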